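(* Let $\phi:S^2\to\mathbb{R}^3$ be an embedding and let $\varphi:[0,1]\times S^2\to\mathbb{R}^3$ be a good family of embeddings relative to $\phi$ (the spheres having oriented normal bundles). Suppose that the spheres $\varphi(0,S^2)$ and $\phi(S^2)$ intersect transversally and that their intersection is a single circle (one embedded closed curve). Then $\varphi(1,S^2)\cap\phi(S^2)\neq\emptyset$; that is, two spheres in $\mathbb{R}^3$ intersecting in one circle cannot be separated along a good family of embeddings.
   Context: All maps are smooth. A family of embeddings of $\Sigma_1$ into $M$ is a smooth map $\varphi:[0,1]\times\Sigma_1\to M$ such that $\varphi(t,\cdot)$ is an embedding for every $t$. Given a fixed embedding $\phi:\Sigma_2\to M$, the family $\varphi$ is called good (relative to $\phi$) if for every $t_0\in[0,1]$ the set $\mathrm{Im}(\phi)\cap\mathrm{Im}(\varphi(t_0,\cdot))$ is a link, and the maps $\phi:\Sigma_2\to M$ and $\varphi:[0,1]\times\Sigma_1\to M$ are transversal. (For individual values of $t$ the maps $\phi$ and $\varphi(t,\cdot)$ need not be transversal.) A link is a finite, possibly empty, disjoint union of embedded circles. Separating the spheres means moving one of them, the other being fixed, to a position where they are disjoint. *)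

theory Defs
  imports "HOL-Analysis.Analysis"
begin

text \<open>A map is C^(k+1) on an open set iff it is differentiable and all its directional
  derivatives are C^k.\<close>

primrec Ck_on :: "nat \<Rightarrow> 'a set \<Rightarrow> ('a::euclidean_space \<Rightarrow> 'b::euclidean_space) \<Rightarrow> bool" where
  "Ck_on 0 U f \<longleftrightarrow> continuous_on U f"
| "Ck_on (Suc k) U f \<longleftrightarrow>
     (\<forall>x\<in>U. f differentiable (at x)) \<and>
     (\<forall>v. Ck_on k U (\<lambda>x. frechet_derivative f (at x) v))"

text \<open>Smoothness on an arbitrary subset of Euclidean space: near each point of the subset the map
  is the restriction of a map that is C^k for every k on an open set. On a submanifold, possibly
  with boundary, this is smoothness in the intrinsic sense. Only the values on the subset matter.\<close>

definition smooth_on :: "'a set \<Rightarrow> ('a::euclidean_space \<Rightarrow> 'b::euclidean_space) \<Rightarrow> bool" where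
  "smooth_on S f \<longleftrightarrow>
     (\<forall>x\<in>S. \<exists>U F. open U \<and> x \<in> U \<and> (\<forall>k. Ck_on k U F) \<and> (\<forall>y\<in>S \<inter> U. F y = f y))"

abbreviation unit_sphere :: "'a::euclidean_space set" where
  "unit_sphere \<equiv> sphere 0 1"

definition sphere_tangent :: "'a::euclidean_space \<Rightarrow> 'a set" where
  "sphere_tangent p = {v. v \<bullet> p = 0}"

text \<open>The tangent space of [0,1] x S at (t, p) is R x T_p S, also for t = 0 and t = 1.\<close>

definition cylinder_tangent :: "real \<times> 'a::euclidean_space \<Rightarrow> (real \<times> 'a) set" where
  "cylinder_tangent q = UNIV \<times> sphere_tangent (snd q)"

text \<open>The image of the differential of f at p, for f smooth on S and T p the tangent space of S
  at p. A derivative of f at p within S is not unique as a linear map on the ambient space, but its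
  restriction to T p is, so the choice made by the library constant is irrelevant.\<close>

definition differential_image ::
  "'a set \<Rightarrow> ('a \<Rightarrow> 'a set) \<Rightarrow> ('a::euclidean_space \<Rightarrow> 'b::euclidean_space) \<Rightarrow> 'a \<Rightarrow> 'b set" where
  "differential_image S T f p = frechet_derivative f (at p within S) ` T p"

text \<open>As the unit sphere is compact, its embeddings are the injective immersions.\<close>

definition sphere_embedding :: "('a::euclidean_space \<Rightarrow> 'b::euclidean_space) \<Rightarrow> bool" where
  "sphere_embedding f \<longleftrightarrow>
     smooth_on unit_sphere f \<and>
     inj_on f unit_sphere \<and>
     (\<forall>p\<in>unit_sphere.
        inj_on (frechet_derivative f (at p within unit_sphere)) (sphere_tangent p))"

definition transversal ::
  "'a set \<Rightarrow> ('a \<Rightarrow> 'a set) \<Rightarrow> ('a::euclidean_space \<Rightarrow> 'c::euclidean_space) \<Rightarrow>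
   'b set \<Rightarrow> ('b \<Rightarrow> 'b set) \<Rightarrow> ('b::euclidean_space \<Rightarrow> 'c) \<Rightarrow> bool" where
  "transversal A TA f B TB g \<longleftrightarrow>
     (\<forall>x\<in>A. \<forall>y\<in>B. f x = g y \<longrightarrow>
        {u + v |u v. u \<in> differential_image A TA f x \<and> v \<in> differential_image B TB g y} = UNIV)"

definition embedded_circle :: "'b::euclidean_space set \<Rightarrow> bool" where
  "embedded_circle C \<longleftrightarrow>
     (\<exists>\<gamma> :: real^2 \<Rightarrow> 'b. sphere_embedding \<gamma> \<and> C = \<gamma> ` unit_sphere)"

definition is_link :: "'b::euclidean_space set \<Rightarrow> bool" where
  "is_link L \<longleftrightarrow>
     (\<exists>\<C>. finite \<C> \<and> (\<forall>C\<in>\<C>. embedded_circle C) \<and> disjoint \<C> \<and> L = \<Union>\<C>)"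

definition family_of_embeddings ::
  "(real \<times> 'a::euclidean_space \<Rightarrow> 'b::euclidean_space) \<Rightarrow> bool" where
  "family_of_embeddings \<Phi> \<longleftrightarrow>
     smooth_on ({0..1} \<times> unit_sphere) \<Phi> \<and>
     (\<forall>t\<in>{0..1}. sphere_embedding (\<lambda>x. \<Phi> (t, x)))"

definition good_family ::
  "('a::euclidean_space \<Rightarrow> 'c::euclidean_space) \<Rightarrow> (real \<times> 'b::euclidean_space \<Rightarrow> 'c) \<Rightarrow> bool" where
  "good_family \<phi> \<Phi> \<longleftrightarrow>
     family_of_embeddings \<Phi> \<and>
     (\<forall>t\<in>{0..1}. is_link (\<phi> ` unit_sphere \<inter> (\<lambda>x. \<Phi> (t, x)) ` unit_sphere)) \<and>
     transversal unit_sphere sphere_tangent \<phi> ({0..1} \<times> unit_sphere) cylinder_tangent \<Phi>"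

text \<open>For a hypersurface, an orientation of the normal line bundle is the same as a continuous
  unit normal field.\<close>

definition normal_orientation ::
  "('a::euclidean_space \<Rightarrow> 'b::euclidean_space) \<Rightarrow> ('a \<Rightarrow> 'b) \<Rightarrow> bool" where
  "normal_orientation f \<nu> \<longleftrightarrow>
     continuous_on unit_sphere \<nu> \<and>
     (\<forall>p\<in>unit_sphere. norm (\<nu> p) = 1 \<and>
        (\<forall>w\<in>differential_image unit_sphere sphere_tangent f p. \<nu> p \<bullet> w = 0))"

end

theory Submission
  imports Defs
begin

text \<open>
  Let \<open>\<Omega>\<close> be a component of the complement of the fixed sphere and colour a point of the moving
  sphere at time \<open>t\<close> according to whether it is mapped into \<open>\<Omega>\<close>. The intersection at time \<open>t\<close> is a
  finite union of disjoint Jordan curves on the moving sphere, and the invariant is the parity of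
  the number of those curves across which the colour changes. (The number of all curves is not
  invariant modulo 2: two parallel circles can merge into one circle of tangency and vanish.) By
  transversality the parity is odd at time 0; it is even if the intersection is empty.

  For local constancy one has to show that, for \<open>t\<close> near \<open>t0\<close>, every curve \<open>C\<close> of the intersection
  at time \<open>t\<close> that lies near a curve \<open>K\<close> of time \<open>t0\<close> separates the two sides of \<open>K\<close>. Where the
  slice at \<open>t0\<close> is transversal, the intersection is locally one arc that persists; a curve through
  such an arc separates. Elsewhere the derivative in \<open>t\<close> is nonzero, and the intersections for
  varying \<open>t\<close> locally foliate the sphere. So if \<open>C\<close> does not separate the sides of \<open>K\<close>, it bounds
  a disc close to \<open>K\<close> which is partitioned into Jordan curves, the intersections at nearby times.
  This is impossible: by Zorn's lemma there would be an innermost curve, but the curve through a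
  point inside it is still further inside.
\<close>

subsection \<open>Coloured families of Jordan curves\<close>

text \<open>Planar separation theory enters through a chart. A link is never the whole sphere, so at
  each \<open>t0\<close> some pole \<open>N\<close> lies off the intersection, and it still does at
  nearby times; stereographic projection from \<open>N\<close> turns the intersections into Jordan
  curves in the plane. The number of changing curves does not depend on the chart, so the pole may
  vary with \<open>t0\<close>. Curves at \<open>t\<close> cannot be matched one by one with curves
  at \<open>t0\<close>. Instead two test points are fixed, one on each side of a curve
  \<open>K\<close> of time \<open>t0\<close>. Their colours persist for a short time, and these
  colours determine the parity of the changing curves that separate the two points. What remains is
  to see that these are all the changing curves near \<open>K\<close>. The ends of the time interval
  are special, since sweeping requires moving both forwards and backwards in time. It is used only
  for \<open>0 < t0 < 1\<close>; at time 0 the slice itself is transversal, and at time 1 the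
  assumed disjointness leaves no curve.\<close>

definition jordan :: "complex set \<Rightarrow> bool" where
  "jordan J \<longleftrightarrow> (\<exists>c. simple_path c \<and> pathfinish c = pathstart c \<and> J = path_image c)"

lemma jordanD:
  assumes "jordan J"
  shows "compact J" "connected J" "J \<noteq> {}"
    "inside J \<noteq> {}" "open (inside J)" "connected (inside J)" "bounded (inside J)"
    "open (outside J)" "connected (outside J)" "\<not> bounded (outside J)"
    "inside J \<union> outside J = - J" "frontier (inside J) = J" "frontier (outside J) = J"
proof -
  obtain c where c: "simple_path c" "pathfinish c = pathstart c" "J = path_image c"
    using assms jordan_def by auto
  show "compact J" "connected J" "J \<noteq> {}"
    using c by (auto simp: compact_simple_path_image connected_simple_path_image)
  show "inside J \<noteq> {}" "open (inside J)" "connected (inside J)" "bounded (inside J)"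
    "open (outside J)" "connected (outside J)" "\<not> bounded (outside J)"
    "inside J \<union> outside J = - J" "frontier (inside J) = J" "frontier (outside J) = J"
    using Jordan_inside_outside[OF c(1,2)] c(3) by auto
qed

lemma jordan_notin_iff:
  assumes "jordan J" "x \<notin> J"
  shows "x \<notin> inside J \<longleftrightarrow> x \<in> outside J"
  using jordanD(11)[OF assms(1)] assms(2) inside_Int_outside[of J] by blast

lemma connected_subset_open_split:
  assumes "connected X" "open U" "open V" "U \<inter> V = {}" "X \<subseteq> U \<union> V"
  shows "X \<subseteq> U \<or> X \<subseteq> V"
proof (rule ccontr)
  assume "\<not> ?thesis"
  then have "U \<inter> X \<noteq> {}" "V \<inter> X \<noteq> {}" using assms(5) by blast+
  then show False using connectedD[OF assms(1-3)] assms(4,5) by blast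
qed

lemma jordan_connected_side:
  assumes "jordan J" "connected X" "X \<inter> J = {}"
  shows "X \<subseteq> inside J \<or> X \<subseteq> outside J"
  using jordanD(5,8,11)[OF assms(1)] assms connected_subset_open_split[of X "inside J" "outside J"]
    inside_Int_outside[of J] by blast

lemma jordan_same_side:
  assumes "jordan J" "connected X" "X \<inter> J = {}" "x \<in> X" "y \<in> X"
  shows "x \<in> inside J \<longleftrightarrow> y \<in> inside J"
  using jordan_connected_side[OF assms(1-3)] assms(4,5) inside_Int_outside[of J] by blast

lemma jordan_closure:
  assumes "jordan J"
  shows "closure (inside J) = J \<union> inside J" "closure (outside J) = J \<union> outside J"
  using jordanD(12,13)[OF assms] by (simp_all add: closure_Un_frontier sup_commute)

lemma jordan_nested:
  assumes J: "jordan J" and J': "jordan J'" and dis: "J' \<inter> J = {}" and ne: "J' \<inter> inside J \<noteq> {}"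
  shows "J' \<union> inside J' \<subseteq> inside J" "J \<subseteq> outside J'"
proof -
  have 1: "J' \<subseteq> inside J"
    using jordan_connected_side[OF J jordanD(2)[OF J'] dis] ne inside_Int_outside[of J] by blast
  have "outside J \<inter> J' = {}" using 1 inside_Int_outside[of J] by blast
  then have "outside J \<subseteq> inside J' \<or> outside J \<subseteq> outside J'"
    by (intro jordan_connected_side[OF J'] jordanD(9)[OF J]) auto
  then have 2: "outside J \<subseteq> outside J'"
    using jordanD(7)[OF J'] jordanD(10)[OF J] bounded_subset by blast
  have 3: "J \<subseteq> closure (outside J')"
    using closure_mono[OF 2] jordan_closure(2)[OF J] by blast
  then show 4: "J \<subseteq> outside J'" using jordan_closure(2)[OF J'] dis by blast
  have "inside J' \<inter> (J \<union> outside J) = {}"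
    using 2 4 inside_Int_outside[of J'] by blast
  then show "J' \<union> inside J' \<subseteq> inside J"
    using 1 jordanD(11)[OF J] by blast
qed

text \<open>Zorn's lemma applies to the closed discs bounded by the curves \<open>J x\<close>
  because a chain of them has a lower bound: the discs are compact and so have a common point
  \<open>p\<close>, and the disc of \<open>J p\<close> lies in each of them, since
  \<open>J p\<close> either equals the boundary curve or is nested inside it.\<close>

lemma no_partition_into_jordan_curves:
  assumes C: "jordan C"
    and J: "\<And>x. x \<in> C \<union> inside C \<Longrightarrow> jordan (J x) \<and> x \<in> J x \<and> J x \<subseteq> C \<union> inside C"
    and dis: "\<And>x y. x \<in> C \<union> inside C \<Longrightarrow> y \<in> C \<union> inside C \<Longrightarrow> J x = J y \<or> J x \<inter> J y = {}"
  shows False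
proof -
  define D where "D = C \<union> inside C"
  define h where "h x = J x \<union> inside (J x)" for x
  \<comment> \<open>The outside of \<open>C\<close> is connected, unbounded and disjoint from
    \<open>J x\<close>, so it cannot lie in the bounded set \<open>inside (J x)\<close>.\<close>
  have inD: "inside (J x) \<subseteq> D" if "x \<in> D" for x
  proof -
    have "outside C \<inter> J x = {}" using J[of x] that D_def inside_Int_outside[of C]
        outside_no_overlap[of C] by blast
    then have "outside C \<subseteq> inside (J x) \<or> outside C \<subseteq> outside (J x)"
      using J[of x] that D_def by (intro jordan_connected_side jordanD(9)[OF C]) auto
    then have "outside C \<subseteq> outside (J x)"
      using jordanD(7)[of "J x"] jordanD(10)[OF C] bounded_subset J[of x] that D_def by blast
    then show ?thesis
      using inside_Int_outside[of "J x"] jordanD(11)[OF C] D_def by blast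
  qed
  have nest: "h y \<subseteq> inside (J x) \<and> J x \<subseteq> outside (J y)"
    if "x \<in> D" "y \<in> D" "J y \<noteq> J x" "y \<in> inside (J x)" for x y
    using jordan_nested[of "J x" "J y"] J[of x] J[of y] dis[of y x] that
    unfolding h_def D_def by blast
  have cl: "compact (h x)" if "x \<in> D" for x
    using jordan_closure(1)[of "J x"] jordanD(7)[of "J x"] J[of x] that
    by (metis D_def compact_closure h_def)
  \<comment> \<open>Complements appear because \<open>subset_Zorn\<close> yields a maximal set,
    whereas a minimal disc is wanted.\<close>
  have "\<exists>M\<in>(\<lambda>x. - h x) ` D. \<forall>X\<in>(\<lambda>x. - h x) ` D. M \<subseteq> X \<longrightarrow> X = M"
  proof (rule subset_Zorn)
    fix \<C> assume ch: "subset.chain ((\<lambda>x. - h x) ` D) \<C>"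
    have "\<C> \<subseteq> (\<lambda>x. - h x) ` D" using ch by (simp add: subset.chain_def)
    then obtain E where E: "E \<subseteq> D" "\<C> = (\<lambda>x. - h x) ` E"
      by (meson subset_imageE)
    have "D \<noteq> {}" using jordanD(3)[OF C] D_def by blast
    show "\<exists>U\<in>(\<lambda>x. - h x) ` D. \<forall>X\<in>\<C>. X \<subseteq> U"
    proof (cases "E = {}")
      case True then show ?thesis using E \<open>D \<noteq> {}\<close> by blast
    next
      case False
      have "\<Inter>(h ` E) \<noteq> {}"
      proof (rule compact_chain)
        fix S T assume "S \<in> h ` E \<and> T \<in> h ` E"
        then show "S \<subseteq> T \<or> T \<subseteq> S"
          using ch E unfolding subset.chain_def by (auto simp: subset_eq)
      qed (use cl E J D_def h_def in \<open>blast+\<close>)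
      then obtain p where p: "\<And>x. x \<in> E \<Longrightarrow> p \<in> h x" by blast
      have pD: "p \<in> D" using p False E(1) inD J h_def D_def by blast
      have "h p \<subseteq> h x" if "x \<in> E" for x
      proof (cases "J p = J x")
        case False
        then have "p \<notin> J x" using J[of p] dis[of p x] pD E(1) that D_def by blast
        then show ?thesis using nest[of x p] p[OF that] False pD E(1) that h_def by blast
      qed (simp add: h_def)
      then show ?thesis using pD E(2) by blast
    qed
  qed
  then obtain m where m: "m \<in> D" "\<And>x. x \<in> D \<Longrightarrow> h x \<subseteq> h m \<Longrightarrow> h x = h m"
    by (auto simp: image_iff)
  obtain q where q: "q \<in> inside (J m)" using jordanD(4)[of "J m"] J m(1) D_def by blast
  have qD: "q \<in> D" using inD[OF m(1)] q by blast
  have "J q \<noteq> J m" using J[of q] q qD inside_no_overlap[of "J m"] D_def by blast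
  from nest[OF m(1) qD this q] have n: "h q \<subseteq> inside (J m)" "J m \<subseteq> outside (J q)" by auto
  then have "h q = h m" using m(2)[OF qD] h_def by blast
  then have "J m \<subseteq> h q" using h_def by blast
  then show False using n h_def inside_Int_outside[of "J q"] outside_no_overlap[of "J q"]
    jordanD(3)[of "J m"] J m(1) D_def by blast
qed

text \<open>By Janiszewski's theorem, if a compact and a closed set have connected intersection and
  neither separates \<open>a\<close> from \<open>b\<close>, then their union does not separate them
  either. Here the intersection is empty, hence connected, and the curves are added one at a
  time.\<close>

lemma Janiszewski_disjoint_jordan:
  assumes "finite \<C>" "\<And>C. C \<in> \<C> \<Longrightarrow> jordan C" "pairwise disjnt \<C>"
    and "a \<notin> \<Union>\<C>" "b \<notin> \<Union>\<C>" "\<And>C. C \<in> \<C> \<Longrightarrow> a \<in> inside C \<longleftrightarrow> b \<in> inside C"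
  shows "connected_component (- \<Union>\<C>) a b"
  using assms
proof (induction \<C>)
  case empty
  then show ?case by (auto simp: connected_component_def intro!: exI[of _ UNIV])
next
  case (insert C \<C>)
  have 1: "connected_component (- C) a b"
  proof (cases "a \<in> inside C")
    case True
    then have "b \<in> inside C" using insert.prems by blast
    then show ?thesis unfolding connected_component_def
      using True jordanD(6)[of C] insert.prems(1) inside_no_overlap[of C] by blast
  next
    case False
    then have "b \<in> outside C" "a \<in> outside C" using insert.prems jordan_notin_iff by auto
    then show ?thesis unfolding connected_component_def
      using jordanD(9)[of C] insert.prems(1) outside_no_overlap[of C] by blast
  qed
  have 2: "connected_component (- \<Union>\<C>) a b"
    using insert by (auto simp: pairwise_insert)
  have "C \<inter> \<Union>\<C> = {}"
    using insert.prems(2) insert.hyps by (auto simp: pairwise_insert disjnt_def)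
  then have "connected_component (- (C \<union> \<Union>\<C>)) a b"
    using 1 2 insert.prems(1) insert.hyps(1)
    by (intro Janiszewski jordanD(1) closed_Union ballI compact_imp_closed) auto
  then show ?case by simp
qed

lemma odd_card_symdiff:
  assumes "finite S"
  shows "odd (card {C\<in>S. P C \<and> (Q C \<longleftrightarrow> \<not> R C)}) \<longleftrightarrow>
    (odd (card {C\<in>S. P C \<and> Q C}) \<noteq> odd (card {C\<in>S. P C \<and> R C}))"
proof -
  let ?a = "{C\<in>S. P C \<and> Q C \<and> \<not> R C}" and ?b = "{C\<in>S. P C \<and> R C \<and> \<not> Q C}"
    and ?c = "{C\<in>S. P C \<and> R C \<and> Q C}"
  have "{C\<in>S. P C \<and> (Q C \<longleftrightarrow> \<not> R C)} = ?a \<union> ?b" "{C\<in>S. P C \<and> Q C} = ?a \<union> ?c"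
    "{C\<in>S. P C \<and> R C} = ?b \<union> ?c" by auto
  moreover have "card (?a \<union> ?b) = card ?a + card ?b" "card (?a \<union> ?c) = card ?a + card ?c"
    "card (?b \<union> ?c) = card ?b + card ?c"
    by (intro card_Un_disjoint; use assms in auto)+
  ultimately show ?thesis unfolding even_add by presburger
qed

locale coloured_curves =
  fixes \<C> :: "complex set set" and A B :: "complex set"
  assumes fin: "finite \<C>" and jor: "\<And>C. C \<in> \<C> \<Longrightarrow> jordan C" and dis: "pairwise disjnt \<C>"
    and opA: "open A" and opB: "open B" and AB: "A \<inter> B = {}" "A \<union> B = - \<Union>\<C>"
begin

lemma near:
  assumes "C \<in> \<C>" "p \<in> C"
  obtains r where "r > 0" "ball p r \<inter> \<Union>(\<C> - {C}) = {}"
proof -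
  have "closed (\<Union>(\<C> - {C}))"
    using fin jor by (intro closed_Union) (auto intro: compact_imp_closed jordanD(1))
  then have "open (- \<Union>(\<C> - {C}))" by (simp only: open_Compl)
  moreover have "p \<in> - \<Union>(\<C> - {C})"
    using dis assms by (auto simp: pairwise_def disjnt_def)
  ultimately show thesis using that by (meson openE disjoint_eq_subset_Compl)
qed

lemma constant_colour:
  assumes "connected X" "X \<inter> \<Union>\<C> = {}" "x \<in> X" "y \<in> X"
  shows "x \<in> A \<longleftrightarrow> y \<in> A"
  using connected_subset_open_split[OF assms(1) opA opB AB(1)] assms AB by blast

text \<open>Any curve other than \<open>C\<close> misses the connected set formed by
  \<open>C\<close> and the two balls, so it has \<open>x\<close> and \<open>x'\<close> on the same
  side; for \<open>C\<close> this is assumed. The two points can therefore be joined off all curves.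
  In short, the colour close to \<open>C\<close> depends only on the side of
  \<open>C\<close>.\<close>

lemma side_colour:
  assumes C: "C \<in> \<C>" and p: "p \<in> C" "p' \<in> C"
    and r: "ball p r \<inter> \<Union>(\<C> - {C}) = {}" "ball p' r' \<inter> \<Union>(\<C> - {C}) = {}"
    and x: "x \<in> ball p r" "x' \<in> ball p' r'" "x \<notin> C" "x' \<notin> C"
    and side: "x \<in> inside C \<longleftrightarrow> x' \<in> inside C"
  shows "x \<in> A \<longleftrightarrow> x' \<in> A"
proof -
  have pp: "p \<in> ball p r" "p' \<in> ball p' r'"
    using x(1,2) by (metis centre_in_ball dist_not_less_zero mem_ball not_le order_le_less_trans)+
  have con: "connected (ball p r \<union> C \<union> ball p' r')"
    using p pp jordanD(2)[OF jor[OF C]]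
    by (intro connected_Un connected_ball) blast+
  have nin: "x \<notin> \<Union>\<C>" "x' \<notin> \<Union>\<C>" using x r by auto
  have "connected_component (- \<Union>\<C>) x x'"
  proof (rule Janiszewski_disjoint_jordan[OF fin jor dis nin])
    fix C' assume C': "C' \<in> \<C>"
    show "x \<in> inside C' \<longleftrightarrow> x' \<in> inside C'"
    proof (cases "C' = C")
      case False
      have "C \<inter> C' = {}" using False C C' dis by (auto simp: pairwise_def disjnt_def)
      then have "(ball p r \<union> C \<union> ball p' r') \<inter> C' = {}" using r C' False by blast
      then show ?thesis using jordan_same_side[OF jor[OF C'] con] x by blast
    qed (use side in auto)
  qed
  then show ?thesis
    unfolding connected_component_def using constant_colour[of _ x x'] by blast
qed

lemma meets_both_sides:
  assumes C: "C \<in> \<C>" and p: "p \<in> C" and r: "r > 0"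
  shows "ball p r \<inter> inside C \<noteq> {}" "ball p r \<inter> outside C \<noteq> {}"
proof -
  have "p \<in> ball p r \<inter> closure (inside C)" "p \<in> ball p r \<inter> closure (outside C)"
    using jordan_closure[OF jor[OF C]] p r by auto
  then show "ball p r \<inter> inside C \<noteq> {}" "ball p r \<inter> outside C \<noteq> {}"
    using open_Int_closure_eq_empty[OF open_ball[of p r]] by blast+
qed

text \<open>By \<open>side_colour\<close> each side of \<open>C\<close> has a single colour close to
  \<open>C\<close>, so this says that the two colours differ. The form with closures can be checked
  point by point and is easily transported through the stereographic chart.\<close>

definition colour_changing :: "complex set \<Rightarrow> bool" where
  "colour_changing C \<longleftrightarrow> C \<subseteq> closure A \<inter> closure B"

text \<open>The truth value \<open>h x\<close> compares the colour of \<open>x\<close> with the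
  parity of the changing curves around \<open>x\<close>. Crossing a changing curve flips both and
  crossing any other curve flips neither, so \<open>h\<close> is constant off the curves.\<close>

lemma colour_parity:
  assumes x: "x \<notin> \<Union>\<C>" and y: "y \<notin> \<Union>\<C>"
  shows "(x \<in> A \<longleftrightarrow> y \<notin> A) \<longleftrightarrow>
    odd (card {C\<in>\<C>. colour_changing C \<and> (x \<in> inside C \<longleftrightarrow> y \<notin> inside C)})"
proof -
  define h where "h x = (x \<in> A \<longleftrightarrow> odd (card {C\<in>\<C>. colour_changing C \<and> x \<in> inside C}))" for x
  have "h x = h y"
  \<comment> \<open>Only values of \<open>h\<close> off the curves matter. As such points are dense,
    it suffices that every point of the plane, including one on a curve, has a neighbourhood in
    which \<open>h\<close> agrees at all points off the curves.\<close>
  proof (rule connected_equivalence_relation_gen[of UNIV x y "\<lambda>z. z \<notin> \<Union>\<C>" "\<lambda>x y. h x = h y"])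
    fix T and a :: complex assume T: "openin (top_of_set UNIV) T" "a \<in> T"
    then have "open T" by simp
    show "\<exists>z. z \<in> T \<and> z \<notin> \<Union>\<C>"
    proof (cases "a \<in> \<Union>\<C>")
      case True
      then obtain C where C: "C \<in> \<C>" "a \<in> C" by blast
      obtain r where r: "r > 0" "ball a r \<inter> \<Union>(\<C> - {C}) = {}" using near C by blast
      obtain s where s: "s > 0" "ball a s \<subseteq> T" using \<open>open T\<close> T(2) openE by blast
      have "ball a (min r s) \<inter> inside C \<noteq> {}"
        using meets_both_sides(1)[OF C, of "min r s"] r s by simp
      then obtain z where "z \<in> ball a (min r s)" "z \<in> inside C" by blast
      moreover have "z \<notin> C" using \<open>z \<in> inside C\<close> inside_no_overlap[of C] by blast
      ultimately have "z \<in> T \<and> z \<notin> \<Union>\<C>" using r s by auto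
      then show ?thesis by blast
    qed (use T in blast)
  next
    fix a :: complex
    show "\<exists>T. openin (top_of_set UNIV) T \<and> a \<in> T \<and>
      (\<forall>x\<in>T. \<forall>y\<in>T. x \<notin> \<Union>\<C> \<and> y \<notin> \<Union>\<C> \<longrightarrow> h x = h y)"
    proof (cases "a \<in> \<Union>\<C>")
      case False
      have "open (- \<Union>\<C>)" using opA opB AB(2) by (metis open_Un)
      then obtain r where r: "r > 0" "ball a r \<subseteq> - \<Union>\<C>" using False by (meson ComplI openE)
      have loc: "h x = h y" if "x \<in> ball a r" "y \<in> ball a r" for x y
      proof -
        have "x \<in> A \<longleftrightarrow> y \<in> A" using constant_colour[of "ball a r" x y] r that by auto
        moreover have "x \<in> inside C \<longleftrightarrow> y \<in> inside C" if "C \<in> \<C>" for C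
          using jordan_same_side[OF jor[OF that], of "ball a r" x y] r that
            \<open>x \<in> ball a r\<close> \<open>y \<in> ball a r\<close> by auto
        then have "{C\<in>\<C>. colour_changing C \<and> x \<in> inside C} = {C\<in>\<C>. colour_changing C \<and> y \<in> inside C}"
          by blast
        ultimately show ?thesis unfolding h_def by simp
      qed
      show ?thesis
        by (intro exI[of _ "ball a r"] conjI ballI impI loc) (use r(1) in simp_all)
    next
      case True
      then obtain C where C: "C \<in> \<C>" "a \<in> C" by blast
      obtain r where r: "r > 0" "ball a r \<inter> \<Union>(\<C> - {C}) = {}" using near C by blast
      \<comment> \<open>One pair of points on the two sides near \<open>a\<close> decides about the
        whole curve, because \<open>side_colour\<close> carries the colours along \<open>C\<close>
        to balls about its other points.\<close>
      have ch: "colour_changing C \<longleftrightarrow> (x \<in> A \<longleftrightarrow> y \<notin> A)"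
        if x: "x \<in> ball a r" "x \<in> inside C" and y: "y \<in> ball a r" "y \<in> outside C" for x y
      proof
        assume "colour_changing C"
        then have "a \<in> closure A" "a \<in> closure B" unfolding colour_changing_def using C by auto
        then have "ball a r \<inter> A \<noteq> {}" "ball a r \<inter> B \<noteq> {}"
          using open_Int_closure_eq_empty[OF open_ball[of a r]] centre_in_ball[of a r] r(1) by blast+
        then obtain u v where uv: "u \<in> ball a r" "u \<in> A" "v \<in> ball a r" "v \<in> B" by blast
        have nC: "u \<notin> C" "v \<notin> C" "x \<notin> C" "y \<notin> C"
          using uv AB C x y inside_no_overlap[of C] outside_no_overlap[of C] by blast+
        have sd: "(z \<in> inside C \<longleftrightarrow> z' \<in> inside C) \<Longrightarrow> (z \<in> A \<longleftrightarrow> z' \<in> A)"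
          if "z \<in> ball a r" "z' \<in> ball a r" "z \<notin> C" "z' \<notin> C" for z z'
          by (rule side_colour[OF C(1) C(2) C(2) r(2) r(2) that])
        have "y \<notin> inside C" using y inside_Int_outside[of C] by blast
        then show "x \<in> A \<longleftrightarrow> y \<notin> A"
          using sd[OF uv(1) x(1) nC(1,3)] sd[OF uv(1) y(1) nC(1,4)] sd[OF uv(3) x(1) nC(2,3)]
            sd[OF uv(3) y(1) nC(2,4)] uv AB(1) x(2) by blast
      next
        assume xy: "x \<in> A \<longleftrightarrow> y \<notin> A"
        have nC: "x \<notin> C" "y \<notin> C" "y \<notin> inside C"
          using x y inside_no_overlap[of C] outside_no_overlap[of C] inside_Int_outside[of C] by blast+
        have "p \<in> closure A \<and> p \<in> closure B" if p: "p \<in> C" for p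
        proof -
          obtain s where s: "s > 0" "ball p s \<inter> \<Union>(\<C> - {C}) = {}" using near[OF C(1) p] by blast
          have "ball p e \<inter> A \<noteq> {} \<and> ball p e \<inter> B \<noteq> {}" if "e > 0" for e
          proof -
            have "ball p (min s e) \<inter> inside C \<noteq> {}" "ball p (min s e) \<inter> outside C \<noteq> {}"
              using meets_both_sides[OF C(1) p, of "min s e"] s(1) that by simp_all
            then obtain u v where
              uv: "u \<in> ball p (min s e)" "u \<in> inside C" "v \<in> ball p (min s e)" "v \<in> outside C"
              by blast
            have n2: "u \<notin> C" "v \<notin> C" "v \<notin> inside C"
              using uv inside_no_overlap[of C] outside_no_overlap[of C] inside_Int_outside[of C] by blast+
            have b: "u \<in> ball p s" "v \<in> ball p s" "u \<in> ball p e" "v \<in> ball p e" using uv by auto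
            have "u \<in> A \<longleftrightarrow> x \<in> A"
              by (rule side_colour[OF C(1) p C(2) s(2) r(2) b(1) x(1) n2(1) nC(1)]) (use uv x in auto)
            moreover have "v \<in> A \<longleftrightarrow> y \<in> A"
              by (rule side_colour[OF C(1) p C(2) s(2) r(2) b(2) y(1) n2(2) nC(2)]) (use nC n2 in auto)
            moreover have "u \<notin> \<Union>\<C>" "v \<notin> \<Union>\<C>" using n2 b s(2) by auto
            ultimately show ?thesis using xy b AB by blast
          qed
          then show ?thesis unfolding closure_approachable
            by (metis IntE dist_commute ex_in_conv mem_ball)
        qed
        then show "colour_changing C" unfolding colour_changing_def by blast
      qed
      have hin: "h x = h y" if x: "x \<in> ball a r" "x \<notin> \<Union>\<C>" and y: "y \<in> ball a r" "y \<notin> \<Union>\<C>" for x y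
      proof -
        let ?m = "\<lambda>x. {C'\<in>\<C>. colour_changing C' \<and> x \<in> inside C'}"
        let ?n = "\<lambda>x. {C'\<in>\<C>. C' \<noteq> C \<and> colour_changing C' \<and> x \<in> inside C'}"
        have side: "x \<in> inside C' \<longleftrightarrow> y \<in> inside C'" if "C' \<in> \<C>" "C' \<noteq> C" for C'
          using jordan_same_side[OF jor[OF that(1)], of "ball a r" x y] r x y that by auto
        then have n: "?n x = ?n y" by blast
        have m: "card (?m z) = card (?n z) + (if colour_changing C \<and> z \<in> inside C then 1 else 0)" for z
        proof (cases "colour_changing C \<and> z \<in> inside C")
          case True
          then have "?m z = insert C (?n z)" using C by auto
          then show ?thesis using True fin by simp
        next
          case False
          then have "?m z = ?n z" by auto
          then show ?thesis using False by simp
        qed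
        have "x \<notin> C" "y \<notin> C" using x y C by auto
        note io = jordan_notin_iff[OF jor[OF C(1)] \<open>x \<notin> C\<close>] jordan_notin_iff[OF jor[OF C(1)] \<open>y \<notin> C\<close>]
        have same: "x \<in> inside C \<longleftrightarrow> y \<in> inside C \<Longrightarrow> x \<in> A \<longleftrightarrow> y \<in> A"
          by (rule side_colour[OF C(1) C(2) C(2) r(2) r(2) x(1) y(1) \<open>x \<notin> C\<close> \<open>y \<notin> C\<close>])
        show ?thesis
          unfolding h_def m n using io same ch[OF x(1) _ y(1)] ch[OF y(1) _ x(1)]
          by (auto split: if_splits)
      qed
      show ?thesis
        by (intro exI[of _ "ball a r"] conjI ballI impI hin) (use r(1) in simp_all)
    qed
  qed (use x y connected_UNIV in simp_all)
  then show ?thesis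
    unfolding odd_card_symdiff[OF fin, of colour_changing "\<lambda>C. x \<in> inside C" "\<lambda>C. y \<in> inside C"]
    unfolding h_def by argo
qed

end

subsection \<open>Families of curves without births\<close>

text \<open>Cover \<open>K\<close> by finitely many closed balls inside \<open>U\<close> and join
  their centres to one of them by paths. The purpose is to collect scattered points of one side of a
  curve into a single connected set, which no curve avoiding it can separate.\<close>

lemma compact_connected_superset:
  fixes U :: "'a::euclidean_space set"
  assumes "open U" "connected U" "compact K" "K \<subseteq> U" "K \<noteq> {}"
  obtains Q where "compact Q" "connected Q" "K \<subseteq> Q" "Q \<subseteq> U"
proof -
  have "\<exists>e>0. cball x e \<subseteq> U" if "x \<in> K" for x
    using assms(1,4) that open_contains_cball by blast
  then obtain e where e: "\<And>x. x \<in> K \<Longrightarrow> e x > 0 \<and> cball x (e x) \<subseteq> U" by metis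
  obtain F where F: "F \<subseteq> K" "finite F" "K \<subseteq> (\<Union>x\<in>F. ball x (e x))"
    using compactE_image[OF assms(3), of K "\<lambda>x. ball x (e x)"] e
    by (metis (no_types, lifting) UN_I centre_in_ball open_ball subsetI)
  then obtain x0 where x0: "x0 \<in> F" using assms(5) by blast
  have "\<exists>g. path g \<and> path_image g \<subseteq> U \<and> pathstart g = x0 \<and> pathfinish g = x" if "x \<in> F" for x
    using assms(1,2) x0 that F(1) assms(4) connected_open_path_connected[OF assms(1,2)]
    unfolding path_connected_def by blast
  then obtain g where g: "\<And>x. x \<in> F \<Longrightarrow>
      path (g x) \<and> path_image (g x) \<subseteq> U \<and> pathstart (g x) = x0 \<and> pathfinish (g x) = x"
    by metis
  define Q where "Q = (\<Union>x\<in>F. path_image (g x) \<union> cball x (e x))"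
  have "connected (path_image (g x) \<union> cball x (e x))" if "x \<in> F" for x
  proof (rule connected_Un)
    have "e x > 0" using e F(1) that by blast
    then show "path_image (g x) \<inter> cball x (e x) \<noteq> {}"
      using g[OF that] pathfinish_in_path_image[of "g x"] by auto
  qed (use g[OF that] connected_path_image in auto)
  moreover have "x0 \<in> path_image (g x)" if "x \<in> F" for x
    using g[OF that] pathstart_in_path_image[of "g x"] by auto
  ultimately have "connected Q"
    unfolding Q_def using x0 by (intro connected_Union) fastforce+
  moreover have "compact (path_image (g x) \<union> cball x (e x))" if "x \<in> F" for x
    using g[OF that] by (simp add: compact_Un compact_path_image)
  then have "compact Q" unfolding Q_def by (rule compact_UN[OF F(2)])
  moreover have "K \<subseteq> Q" unfolding Q_def
    by (rule order_trans[OF F(3)], intro UN_mono) (auto intro: le_supI2)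
  moreover have "Q \<subseteq> U" unfolding Q_def using g e F(1) by blast
  ultimately show thesis using that by blast
qed

text \<open>This is the intersection as seen in a planar chart. By \<open>usc\<close> no part of
  \<open>Z t\<close> appears away from \<open>Z t0\<close>, and by \<open>persistA\<close> and
  \<open>persistB\<close> a fixed point off \<open>Z t0\<close> keeps its colour for a while. All
  limits are restricted to \<open>T\<close>, so that \<open>t0\<close> may be an end of the time
  interval.\<close>

locale curve_family =
  fixes T :: "real set" and t0 :: real and Z A B :: "real \<Rightarrow> complex set"
  assumes t0: "t0 \<in> T"
    and fin: "\<And>t. t \<in> T \<Longrightarrow> finite (components (Z t))"
    and jor: "\<And>t C. t \<in> T \<Longrightarrow> C \<in> components (Z t) \<Longrightarrow> jordan C"
    and usc: "\<And>V. open V \<Longrightarrow> Z t0 \<subseteq> V \<Longrightarrow> \<forall>\<^sub>F t in nhds t0. t \<in> T \<longrightarrow> Z t \<subseteq> V"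
    and opA: "\<And>t. t \<in> T \<Longrightarrow> open (A t)" and opB: "\<And>t. t \<in> T \<Longrightarrow> open (B t)"
    and AB: "\<And>t. t \<in> T \<Longrightarrow> A t \<inter> B t = {}" "\<And>t. t \<in> T \<Longrightarrow> A t \<union> B t = - Z t"
    and persistA: "\<And>x. x \<in> A t0 \<Longrightarrow> \<forall>\<^sub>F t in nhds t0. t \<in> T \<longrightarrow> x \<in> A t"
    and persistB: "\<And>x. x \<in> B t0 \<Longrightarrow> \<forall>\<^sub>F t in nhds t0. t \<in> T \<longrightarrow> x \<in> B t"
begin

text \<open>At a point of \<open>Z t0\<close> where the slice is transversal, the curves nearby form a single arc that
  splits a fixed box in two; where the time derivative is nonzero, the curves of nearby times sweep
  out a neighbourhood, each point being hit exactly once.\<close>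

definition crosses_box :: "complex set \<Rightarrow> complex \<Rightarrow> complex \<Rightarrow> real \<Rightarrow> bool" where
  "crosses_box N u v t \<longleftrightarrow> connected (Z t \<inter> N) \<and>
     (\<exists>P Q. connected P \<and> connected Q \<and> N - Z t = P \<union> Q \<and> u \<in> P \<and> v \<in> Q)"

definition persistent_at :: "complex \<Rightarrow> bool" where
  "persistent_at y \<longleftrightarrow> (\<exists>N u v. open N \<and> connected N \<and> y \<in> N \<and>
     (\<forall>\<^sub>F t in nhds t0. t \<in> T \<longrightarrow> crosses_box N u v t))"

definition sweeping_at :: "complex \<Rightarrow> bool" where
  "sweeping_at y \<longleftrightarrow>
     (\<exists>e>0. \<exists>N. open N \<and> y \<in> N \<and>
        (\<forall>x\<in>N. \<forall>t\<in>T \<inter> ball t0 e. \<forall>t'\<in>T \<inter> ball t0 e. x \<in> Z t \<longrightarrow> x \<in> Z t' \<longrightarrow> t = t')) \<and>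
     (\<forall>e>0. \<exists>N. open N \<and> y \<in> N \<and> (\<forall>x\<in>N. \<exists>t\<in>T \<inter> ball t0 e. x \<in> Z t))"

text \<open>The connected arc \<open>Z t \<inter> N\<close> belongs to the single component
  \<open>C\<close>, so \<open>P\<close> and \<open>Q\<close> make up the whole of \<open>N\<close>
  off \<open>C\<close>. Each lies on one side of \<open>C\<close>, and both sides occur in
  \<open>N\<close> because \<open>C\<close> is the frontier of both.\<close>

lemma crosses_box_separates:
  assumes t: "t \<in> T" and C: "C \<in> components (Z t)" and N: "open N" "crosses_box N u v t"
    and meet: "C \<inter> N \<noteq> {}"
  shows "u \<in> inside C \<longleftrightarrow> v \<notin> inside C" "u \<notin> C" "v \<notin> C"
proof -
  obtain P Q where PQ: "connected P" "connected Q" "N - Z t = P \<union> Q" "u \<in> P" "v \<in> Q"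
    and con: "connected (Z t \<inter> N)" using N(2) crosses_box_def by auto
  have J: "jordan C" using jor t C by blast
  have CZ: "C \<subseteq> Z t" using in_components_subset[OF C] .
  have ZN: "Z t \<inter> N \<subseteq> C"
    using components_maximal[OF C con] meet CZ by blast
  have dP: "P \<inter> C = {}" "Q \<inter> C = {}" using PQ(3) CZ by blast+
  show "u \<notin> C" "v \<notin> C" using dP PQ by auto
  have "N \<inter> closure (inside C) \<noteq> {}" "N \<inter> closure (outside C) \<noteq> {}"
    using jordan_closure[OF J] meet by blast+
  then have "N \<inter> inside C \<noteq> {}" "N \<inter> outside C \<noteq> {}"
    using open_Int_closure_eq_empty[OF N(1)] by blast+
  then have "(P \<union> Q) \<inter> inside C \<noteq> {}" "(P \<union> Q) \<inter> outside C \<noteq> {}"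
    using ZN PQ(3) inside_no_overlap[of C] outside_no_overlap[of C] by blast+
  then show "u \<in> inside C \<longleftrightarrow> v \<notin> inside C"
    using jordan_connected_side[OF J PQ(1) dP(1)] jordan_connected_side[OF J PQ(2) dP(2)]
      PQ(4,5) inside_Int_outside[of C] by blast
qed

text \<open>The neighbourhood of \<open>K\<close> avoids one connected set on each side of
  \<open>K\<close>, which contains the test point, the markers of the boxes, and everything on that
  side not covered by boxes or sweeping neighbourhoods. A curve that does not separate
  \<open>a\<close> from \<open>b\<close> has both connected sets outside it, so its disc contains no
  marker and no uncovered point. That confines the disc to the sweeping region.\<close>

lemma nearby_curves_separate:
  assumes K: "K \<in> components (Z t0)"
    and types: "\<And>y. y \<in> K \<Longrightarrow> persistent_at y \<or> sweeping_at y"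
    and a: "a \<in> inside K" and b: "b \<in> outside K"
  obtains N where "open N" "K \<subseteq> N"
    "\<forall>\<^sub>F t in nhds t0. t \<in> T \<longrightarrow>
      (\<forall>C\<in>components (Z t). C \<subseteq> N \<longrightarrow> (a \<in> inside C \<longleftrightarrow> b \<notin> inside C))"
proof -
  have JK: "jordan K" using jor t0 K by blast
  define KA where "KA = {y\<in>K. persistent_at y}"
  have "\<exists>N u v. open N \<and> connected N \<and> y \<in> N \<and>
     (\<forall>\<^sub>F t in nhds t0. t \<in> T \<longrightarrow> crosses_box N u v t)" if "y \<in> KA" for y
    using that unfolding KA_def persistent_at_def by blast
  then obtain N u v where N: "\<And>y. y \<in> KA \<Longrightarrow> open (N y) \<and> connected (N y) \<and> y \<in> N y \<and>
     (\<forall>\<^sub>F t in nhds t0. t \<in> T \<longrightarrow> crosses_box (N y) (u y) (v y) t)" by metis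
  \<comment> \<open>The part of \<open>K\<close> not covered by boxes is compact and consists of
    sweeping points only.\<close>
  define K' where "K' = K - (\<Union>y\<in>KA. N y)"
  have cK': "compact K'" unfolding K'_def
    using jordanD(1)[OF JK] N by (intro compact_diff open_UN) auto
  have sw: "sweeping_at y" if "y \<in> K'" for y
    using that types[of y] N[of y] unfolding K'_def KA_def by blast
  then have "\<exists>e N. e > 0 \<and> open N \<and> y \<in> N \<and>
      (\<forall>x\<in>N. \<forall>t\<in>T \<inter> ball t0 e. \<forall>t'\<in>T \<inter> ball t0 e. x \<in> Z t \<longrightarrow> x \<in> Z t' \<longrightarrow> t = t')"
    if "y \<in> K'" for y using that unfolding sweeping_at_def by blast
  then obtain \<epsilon> M where M: "\<And>y. y \<in> K' \<Longrightarrow> \<epsilon> y > 0 \<and> open (M y) \<and> y \<in> M y \<and>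
      (\<forall>x\<in>M y. \<forall>t\<in>T \<inter> ball t0 (\<epsilon> y). \<forall>t'\<in>T \<inter> ball t0 (\<epsilon> y). x \<in> Z t \<longrightarrow> x \<in> Z t' \<longrightarrow> t = t')"
    by metis
  obtain FB where FB: "FB \<subseteq> K'" "finite FB" "K' \<subseteq> (\<Union>y\<in>FB. M y)"
    using compactE_image[OF cK', of K' M] M by (metis UN_I subsetI)
  \<comment> \<open>The radius \<open>e\<close> is fixed by uniqueness before existence is invoked,
    so that both hold on \<open>V\<close> for the same \<open>e\<close>. The extra element 1 keeps
    \<open>Min\<close> meaningful when \<open>FB\<close> is empty.\<close>
  define e where "e = Min (insert 1 (\<epsilon> ` FB))"
  have e: "e > 0" "\<And>y. y \<in> FB \<Longrightarrow> e \<le> \<epsilon> y" unfolding e_def using FB M by auto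
  have "\<exists>N. open N \<and> y \<in> N \<and> (\<forall>x\<in>N. \<exists>t\<in>T \<inter> ball t0 e. x \<in> Z t)" if "y \<in> K'" for y
    using sw[OF that] e(1) unfolding sweeping_at_def by blast
  then obtain M' where M': "\<And>y. y \<in> K' \<Longrightarrow> open (M' y) \<and> y \<in> M' y \<and>
      (\<forall>x\<in>M' y. \<exists>t\<in>T \<inter> ball t0 e. x \<in> Z t)" by metis
  define V where "V = (\<Union>y\<in>FB. M y) \<inter> (\<Union>y\<in>K'. M' y)"
  have V: "open V" "K' \<subseteq> V" unfolding V_def using FB M M' by (auto intro!: open_Int open_UN)
  have Vex: "\<exists>t\<in>T \<inter> ball t0 e. x \<in> Z t" if "x \<in> V" for x
    using that M' unfolding V_def by blast
  have Vuniq: "t = t'" if xV: "x \<in> V" and "t \<in> T" "t \<in> ball t0 e" "t' \<in> T" "t' \<in> ball t0 e" "x \<in> Z t" "x \<in> Z t'"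
    for x t t'
  proof -
    obtain y where y: "y \<in> FB" "x \<in> M y" using xV unfolding V_def by blast
    have "ball t0 e \<subseteq> ball t0 (\<epsilon> y)" using e(2)[OF y(1)] by (rule subset_ball)
    then show ?thesis using M[of y] y FB(1) that by blast
  qed
  have "compact (K - V)" using jordanD(1)[OF JK] V(1) by (rule compact_diff)
  \<comment> \<open>Finitely many boxes suffice beside \<open>V\<close>; hence all of them are
    crossed simultaneously at times close to \<open>t0\<close>.\<close>
  then obtain FA where FA: "FA \<subseteq> KA" "finite FA" "K - V \<subseteq> (\<Union>y\<in>FA. N y)"
    using compactE_image[of "K - V" KA N] N V(2) K'_def by (smt (verit) DiffD1 DiffD2 DiffI subset_iff)
  define U where "U = (\<Union>y\<in>FA. N y) \<union> V"
  obtain R where R: "K \<subseteq> ball 0 R"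
    using bounded_subset_ballD[OF compact_imp_bounded[OF jordanD(1)[OF JK]]] by blast
  define U' where "U' = U \<inter> ball 0 R"
  have U': "open U'" "K \<subseteq> U'" unfolding U'_def U_def using N FA V(1) R by (auto intro!: open_Un open_UN)
  have uv: "u y \<notin> K \<and> v y \<notin> K" if "y \<in> FA" for y
  proof -
    have "crosses_box (N y) (u y) (v y) t0"
      using eventually_nhds_x_imp_x[of _ t0] N[of y] FA(1) that t0 by (metis (no_types, lifting) subsetD)
    moreover have "open (N y)" "K \<inter> N y \<noteq> {}" using N[of y] FA(1) that KA_def by auto
    ultimately show ?thesis using crosses_box_separates(2,3)[OF t0 K] by blast
  qed
  define S where "S = u ` FA \<union> v ` FA"
  have S: "finite S" "S \<subseteq> inside K \<union> outside K"
    using FA(2) uv jordanD(11)[OF JK] unfolding S_def by auto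
  \<comment> \<open>The markers are included so that a curve having \<open>Ka\<close> and its
    counterpart outside can meet no box; the points off \<open>U'\<close> are included so that its
    disc stays in \<open>U'\<close>.\<close>
  obtain Ka where Ka: "compact Ka" "connected Ka"
    "{a} \<union> (S \<inter> inside K) \<union> (inside K - U') \<subseteq> Ka" "Ka \<subseteq> inside K"
  proof (rule compact_connected_superset[OF jordanD(5)[OF JK] jordanD(6)[OF JK]])
    have "inside K - U' = closure (inside K) - U'" using jordan_closure(1)[OF JK] U'(2) by blast
    moreover have "compact (closure (inside K) - U')"
      using jordanD(7)[OF JK] U'(1) by (intro compact_diff) auto
    ultimately show "compact ({a} \<union> (S \<inter> inside K) \<union> (inside K - U'))"
      using S(1) by (metis compact_Un compact_sing finite_Int finite_imp_compact)
  qed (use a that in auto)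
  \<comment> \<open>This point links \<open>Q\<close> to the complement of the large ball.\<close>
  obtain w where w: "w \<in> outside K" "w \<notin> ball 0 R"
    using jordanD(10)[OF JK] bounded_subset[OF bounded_ball] by blast
  obtain Q where Q: "compact Q" "connected Q"
    "{b,w} \<union> (S \<inter> outside K) \<union> (outside K \<inter> cball 0 R - U') \<subseteq> Q" "Q \<subseteq> outside K"
  proof (rule compact_connected_superset[OF jordanD(8)[OF JK] jordanD(9)[OF JK]])
    have "outside K \<inter> cball 0 R - U' = closure (outside K) \<inter> cball 0 R - U'"
      using jordan_closure(2)[OF JK] U'(2) by blast
    moreover have "compact (closure (outside K) \<inter> cball 0 R - U')"
      using U'(1) by (intro compact_diff closed_Int_compact) auto
    ultimately show "compact ({b,w} \<union> (S \<inter> outside K) \<union> (outside K \<inter> cball 0 R - U'))"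
      using S(1) by (metis compact_Un finite.emptyI finite.insertI finite_Int finite_imp_compact)
  qed (use b w that in auto)
  \<comment> \<open>Being connected and unbounded, \<open>Kb\<close> must lie outside every Jordan
    curve that avoids it.\<close>
  define Kb where "Kb = Q \<union> - ball 0 R"
  have conKb: "connected Kb" unfolding Kb_def
    using Q w(2) by (intro connected_Un connected_complement_bounded_convex) auto
  have unKb: "\<not> bounded Kb"
  proof
    assume "bounded Kb"
    then have "bounded (Kb \<union> ball 0 R)" by simp
    moreover have "Kb \<union> ball 0 R = UNIV" unfolding Kb_def by blast
    ultimately show False by simp
  qed
  define N0 where "N0 = U' \<inter> - Ka \<inter> - Kb"
  have closKb: "closed Kb" unfolding Kb_def using Q(1) by (auto intro: compact_imp_closed)
  show thesis
  proof
    show "open N0" unfolding N0_def using U'(1) Ka(1) closKb by (auto intro!: open_Int compact_imp_closed)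
    show "K \<subseteq> N0" unfolding N0_def Kb_def using U'(2) Ka(4) Q(4) R
      inside_no_overlap[of K] outside_no_overlap[of K] by blast
    have "\<forall>\<^sub>F t in nhds t0. \<forall>y\<in>FA. t \<in> T \<longrightarrow> crosses_box (N y) (u y) (v y) t"
      using N FA by (intro eventually_ball_finite) auto
    moreover have "\<forall>\<^sub>F t in nhds t0. t \<in> ball t0 e"
      using e(1) by (intro eventually_nhds_in_open) auto
    ultimately show "\<forall>\<^sub>F t in nhds t0. t \<in> T \<longrightarrow>
      (\<forall>C\<in>components (Z t). C \<subseteq> N0 \<longrightarrow> (a \<in> inside C \<longleftrightarrow> b \<notin> inside C))"
    proof eventually_elim
      case (elim t)
      show ?case
      proof (intro impI ballI)
        fix C assume t: "t \<in> T" and C: "C \<in> components (Z t)" and CN: "C \<subseteq> N0"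
        have JC: "jordan C" using jor t C by blast
        show "a \<in> inside C \<longleftrightarrow> b \<notin> inside C"
        proof (rule ccontr)
          assume "\<not> ?thesis"
          then have ab: "a \<in> inside C \<longleftrightarrow> b \<in> inside C" by blast
          have dis: "Ka \<inter> C = {}" "Kb \<inter> C = {}" using CN N0_def by auto
          have "Kb \<subseteq> outside C"
            using jordan_connected_side[OF JC conKb dis(2)] unKb jordanD(7)[OF JC] bounded_subset by blast
          moreover have "a \<in> Ka" "b \<in> Kb" using Ka(3) Q(3) Kb_def by auto
          moreover have "Ka \<subseteq> outside C"
            using jordan_connected_side[OF JC Ka(2) dis(1)] ab \<open>a \<in> Ka\<close> \<open>b \<in> Kb\<close> \<open>Kb \<subseteq> outside C\<close>
              inside_Int_outside[of C] by blast
          ultimately have KK: "Ka \<union> Kb \<subseteq> outside C" by blast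
          define D where "D = C \<union> inside C"
          \<comment> \<open>Every point off \<open>U'\<close> belongs to \<open>Ka\<close> or
            \<open>Kb\<close>, and both are outside \<open>C\<close>.\<close>
          have "D \<subseteq> U'"
          proof
            fix x assume x: "x \<in> D"
            then have nx: "x \<notin> Ka" "x \<notin> Kb"
              using KK D_def inside_Int_outside[of C] outside_no_overlap[of C] by blast+
            have "x \<in> cball 0 R" using nx(2) unfolding Kb_def by auto
            then show "x \<in> U'" using nx Ka(3) Q(3) U'(2) jordanD(11)[OF JK] unfolding Kb_def by blast
          qed
          have SK: "S \<subseteq> outside C" using KK S(2) Ka(3) Q(3) unfolding Kb_def by blast
          have "D \<inter> N y = {}" if y: "y \<in> FA" for y
          proof -
            have cb: "crosses_box (N y) (u y) (v y) t" using elim(1) t y by blast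
            have Ny: "open (N y)" "connected (N y)" using N FA(1) y by blast+
            have uvo: "u y \<in> outside C" "v y \<in> outside C" using SK y S_def by auto
            \<comment> \<open>Had \<open>C\<close> met the box, it would separate the two markers,
              but both are outside \<open>C\<close>.\<close>
            have CN: "N y \<inter> C = {}"
              using crosses_box_separates(1)[OF t C Ny(1) cb] uvo inside_Int_outside[of C] by blast
            have "u y \<in> N y" using cb unfolding crosses_box_def by blast
            then show ?thesis
              using jordan_connected_side[OF JC Ny(2) CN] uvo CN inside_Int_outside[of C] D_def by blast
          qed
          then have DV: "D \<subseteq> V" using \<open>D \<subseteq> U'\<close> unfolding U'_def U_def by blast
          then have "\<exists>s. s \<in> T \<and> s \<in> ball t0 e \<and> x \<in> Z s" if "x \<in> D" for x using Vex that by blast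
          then obtain \<tau> where \<tau>: "\<And>x. x \<in> D \<Longrightarrow> \<tau> x \<in> T \<and> \<tau> x \<in> ball t0 e \<and> x \<in> Z (\<tau> x)"
            by metis
          \<comment> \<open>The intersection curve through \<open>x\<close> at the only time near
            \<open>t0\<close> at which \<open>x\<close> is hit.\<close>
          define J where "J x = connected_component_set (Z (\<tau> x)) x" for x
          have JJ: "J x \<in> components (Z (\<tau> x))" "x \<in> J x" if "x \<in> D" for x
            using \<tau>[OF that] unfolding J_def by (auto intro: componentsI)
          have JD: "J x \<subseteq> D" if x: "x \<in> D" for x
          proof (cases "J x \<inter> C = {}")
            case True
            then have "J x \<subseteq> inside C \<or> J x \<subseteq> outside C"
              using JJ[OF x] in_components_connected by (intro jordan_connected_side[OF JC]) auto
            moreover have "x \<in> inside C" using True JJ(2)[OF x] x D_def by blast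
            ultimately show ?thesis
              using JJ(2)[OF x] inside_Int_outside[of C] D_def by blast
          next
            case False
            then obtain q where q: "q \<in> J x" "q \<in> C" by blast
            have "q \<in> Z (\<tau> x)" "q \<in> Z t"
              using q in_components_subset[OF JJ(1)[OF x]] in_components_subset[OF C] by auto
            moreover have "q \<in> V" using q(2) DV D_def by blast
            \<comment> \<open>The point \<open>q\<close> is hit at both times, so uniqueness in
              \<open>V\<close> identifies them and \<open>J x\<close> must be \<open>C\<close>
              itself. This is why no curve leaves the disc.\<close>
            ultimately have "\<tau> x = t" using Vuniq \<tau>[OF x] t elim(2) by blast
            then have "J x = C" using components_eq[OF JJ(1)[OF x]] C False by auto
            then show ?thesis using D_def by blast
          qed
          show False
          proof (rule no_partition_into_jordan_curves[OF JC, folded D_def])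
            fix x assume "x \<in> D"
            then show "jordan (J x) \<and> x \<in> J x \<and> J x \<subseteq> D" using JJ JD jor \<tau> by blast
          next
            fix x y assume x: "x \<in> D" and y: "y \<in> D"
            show "J x = J y \<or> J x \<inter> J y = {}"
            proof (cases "J x \<inter> J y = {}")
              case False
              then obtain q where q: "q \<in> J x" "q \<in> J y" by blast
              have "q \<in> V" using q(1) JD[OF x] DV by blast
              moreover have "q \<in> Z (\<tau> x)" "q \<in> Z (\<tau> y)"
                using q in_components_subset[OF JJ(1)[OF x]] in_components_subset[OF JJ(1)[OF y]] by auto
              ultimately have "\<tau> x = \<tau> y" using Vuniq \<tau>[OF x] \<tau>[OF y] by blast
              then show ?thesis using components_eq[OF JJ(1)[OF x]] JJ(1)[OF y] False by auto
            qed simp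
          qed
        qed
      qed
    qed
  qed
qed

definition changing :: "real \<Rightarrow> complex set set" where
  "changing t = {C \<in> components (Z t). C \<subseteq> closure (A t) \<inter> closure (B t)}"

lemma coloured:
  assumes "t \<in> T"
  shows "coloured_curves (components (Z t)) (A t) (B t)"
  by unfold_locales
    (use assms fin jor opA opB AB pairwise_disjoint_components[of "Z t"] in
      \<open>auto simp: disjnt_def[abs_def]\<close>)

text \<open>Every curve at a time near \<open>t0\<close> lies in exactly one of the disjoint
  neighbourhoods \<open>G K\<close>. The changing ones in \<open>G K\<close> are precisely the
  changing ones that separate the test points \<open>a K\<close> and \<open>b K\<close>, so
  \<open>colour_parity\<close> reads off the parity of their number from the colours of these
  points, and those are still the colours at \<open>t0\<close>.\<close>

theorem changing_parity_locally_constant: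
  assumes types: "\<And>y. y \<in> Z t0 \<Longrightarrow> persistent_at y \<or> sweeping_at y"
  shows "\<forall>\<^sub>F t in nhds t0. t \<in> T \<longrightarrow> (odd (card (changing t)) \<longleftrightarrow> odd (card (changing t0)))"
proof -
  let ?K = "components (Z t0)"
  interpret c0: coloured_curves ?K "A t0" "B t0" using coloured t0 by blast
  \<comment> \<open>The test points are taken within \<open>s/2\<close> so that the closed ball of
    that radius still misses every other curve and can be removed from their neighbourhoods.\<close>
  have "\<exists>p s a b. p \<in> K \<and> s > 0 \<and> ball p s \<inter> \<Union>(?K - {K}) = {} \<and>
      a \<in> ball p (s/2) \<and> a \<in> inside K \<and> b \<in> ball p (s/2) \<and> b \<in> outside K" if K: "K \<in> ?K" for K
  proof -
    obtain p where p: "p \<in> K" using in_components_nonempty[OF K] by blast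
    obtain s where s: "s > 0" "ball p s \<inter> \<Union>(?K - {K}) = {}" using c0.near[OF K p] by blast
    show ?thesis using c0.meets_both_sides[OF K p, of "s/2"] s p by auto
  qed
  then obtain p s a b where psab: "\<And>K. K \<in> ?K \<Longrightarrow> p K \<in> K \<and> s K > 0 \<and> ball (p K) (s K) \<inter> \<Union>(?K - {K}) = {} \<and>
      a K \<in> ball (p K) (s K/2) \<and> a K \<in> inside K \<and> b K \<in> ball (p K) (s K/2) \<and> b K \<in> outside K"
    by metis
  have "\<exists>N. open N \<and> K \<subseteq> N \<and> (\<forall>\<^sub>F t in nhds t0. t \<in> T \<longrightarrow>
      (\<forall>C\<in>components (Z t). C \<subseteq> N \<longrightarrow> (a K \<in> inside C \<longleftrightarrow> b K \<notin> inside C)))" if K: "K \<in> ?K" for K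
  proof -
    have ty: "persistent_at y \<or> sweeping_at y" if "y \<in> K" for y
      using types in_components_subset[OF K] that by blast
    obtain N where "open N" "K \<subseteq> N" "\<forall>\<^sub>F t in nhds t0. t \<in> T \<longrightarrow>
      (\<forall>C\<in>components (Z t). C \<subseteq> N \<longrightarrow> (a K \<in> inside C \<longleftrightarrow> b K \<notin> inside C))"
      using nearby_curves_separate[OF K ty, of "a K" "b K"] psab[OF K] by blast
    then show ?thesis by blast
  qed
  then have "\<forall>K\<in>?K. \<exists>N. open N \<and> K \<subseteq> N \<and> (\<forall>\<^sub>F t in nhds t0. t \<in> T \<longrightarrow>
      (\<forall>C\<in>components (Z t). C \<subseteq> N \<longrightarrow> (a K \<in> inside C \<longleftrightarrow> b K \<notin> inside C)))"
    by blast
  from bchoice[OF this] obtain N where N: "\<And>K. K \<in> ?K \<Longrightarrow> open (N K) \<and> K \<subseteq> N K \<and> (\<forall>\<^sub>F t in nhds t0. t \<in> T \<longrightarrow>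
      (\<forall>C\<in>components (Z t). C \<subseteq> N K \<longrightarrow> (a K \<in> inside C \<longleftrightarrow> b K \<notin> inside C)))"
    by blast
  \<comment> \<open>Comparing distances makes these neighbourhoods disjoint. Removing the closed
    balls about the other test points keeps a curve in \<open>G K\<close> from separating
    \<open>a L\<close> from \<open>b L\<close> when \<open>L\<close> differs from
    \<open>K\<close>.\<close>
  define G where "G K = N K \<inter> (\<Inter>L\<in>?K - {K}. {z. infdist z K < infdist z L} \<inter> - cball (p L) (s L/2))" for K
  have oG: "open (G K)" if "K \<in> ?K" for K
  proof -
    have "open ({z. infdist z K < infdist z L} \<inter> - cball (p L) (s L/2))" for L
      by (intro open_Int open_Collect_less continuous_intros) simp
    then show ?thesis unfolding G_def using N[OF that] c0.fin by (intro open_Int open_INT) simp_all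
  qed
  have KG: "K \<subseteq> G K" if K: "K \<in> ?K" for K
  proof -
    have "infdist z K < infdist z L \<and> z \<notin> cball (p L) (s L/2)"
      if z: "z \<in> K" and L: "L \<in> ?K" "L \<noteq> K" for z L
    proof
      have "z \<notin> L" using c0.dis K L z by (auto simp: pairwise_def disjnt_def)
      then have "infdist z L > 0"
        using jordanD(1,3)[OF c0.jor[OF L(1)]] infdist_pos_not_in_closed compact_imp_closed by blast
      then show "infdist z K < infdist z L" using z by simp
      have "z \<notin> ball (p L) (s L)" using psab[OF L(1)] z K L by blast
      then show "z \<notin> cball (p L) (s L/2)" using psab[OF L(1)] by auto
    qed
    then show ?thesis unfolding G_def using N[OF K] by blast
  qed
  have Gdis: "G K \<inter> G L = {}" if "K \<in> ?K" "L \<in> ?K" "K \<noteq> L" for K L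
  proof -
    have "infdist z K < infdist z L" if "z \<in> G K" for z
      using that \<open>L \<in> ?K\<close> \<open>K \<noteq> L\<close> unfolding G_def by blast
    moreover have "infdist z L < infdist z K" if "z \<in> G L" for z
      using that \<open>K \<in> ?K\<close> \<open>K \<noteq> L\<close> unfolding G_def by blast
    ultimately show ?thesis by (meson disjoint_iff less_asym)
  qed
  have nZ: "a K \<notin> Z t0" "b K \<notin> Z t0" if K: "K \<in> ?K" for K
  proof -
    have "ball (p K) (s K/2) \<subseteq> ball (p K) (s K)" using psab[OF K] by (intro subset_ball) auto
    then have "a K \<notin> \<Union>?K" "b K \<notin> \<Union>?K"
      using psab[OF K] inside_no_overlap[of K] outside_no_overlap[of K] by blast+
    then show "a K \<notin> Z t0" "b K \<notin> Z t0" by (simp_all only: Union_components not_False_eq_True)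
  qed
  define good where "good K t \<longleftrightarrow> a K \<notin> Z t \<and> b K \<notin> Z t \<and> (a K \<in> A t \<longleftrightarrow> a K \<in> A t0) \<and>
    (b K \<in> A t \<longleftrightarrow> b K \<in> A t0) \<and>
    (\<forall>C\<in>components (Z t). C \<subseteq> N K \<longrightarrow> (a K \<in> inside C \<longleftrightarrow> b K \<notin> inside C))" for K t
  have persist: "\<forall>\<^sub>F t in nhds t0. t \<in> T \<longrightarrow> x \<notin> Z t \<and> (x \<in> A t \<longleftrightarrow> x \<in> A t0)" if x: "x \<notin> Z t0" for x
  proof (cases "x \<in> A t0")
    case True
    then show ?thesis using persistA[OF True] AB by (auto elim!: eventually_mono)
  next
    case False
    then have "x \<in> B t0" using AB[OF t0] x by blast
    then show ?thesis using persistB[of x] AB False by (auto elim!: eventually_mono)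
  qed
  have "\<forall>\<^sub>F t in nhds t0. \<forall>K\<in>?K. t \<in> T \<longrightarrow> good K t"
  proof (rule eventually_ball_finite[OF c0.fin], rule ballI)
    fix K assume K: "K \<in> ?K"
    have "\<forall>\<^sub>F t in nhds t0. t \<in> T \<longrightarrow>
      (\<forall>C\<in>components (Z t). C \<subseteq> N K \<longrightarrow> (a K \<in> inside C \<longleftrightarrow> b K \<notin> inside C))"
      using N[OF K] by blast
    then show "\<forall>\<^sub>F t in nhds t0. t \<in> T \<longrightarrow> good K t"
      using persist[OF nZ(1)[OF K]] persist[OF nZ(2)[OF K]]
      by eventually_elim (auto simp: good_def)
  qed
  moreover have "\<forall>\<^sub>F t in nhds t0. t \<in> T \<longrightarrow> Z t \<subseteq> (\<Union>K\<in>?K. G K)"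
  proof (rule usc)
    show "open (\<Union>K\<in>?K. G K)" using oG by blast
    have "\<Union>?K \<subseteq> (\<Union>K\<in>?K. G K)" using KG by blast
    then show "Z t0 \<subseteq> (\<Union>K\<in>?K. G K)" by simp
  qed
  ultimately have ev: "\<forall>\<^sub>F t in nhds t0. t \<in> T \<longrightarrow> Z t \<subseteq> (\<Union>K\<in>?K. G K) \<and> (\<forall>K\<in>?K. good K t)"
    by eventually_elim blast
  \<comment> \<open>The right-hand side refers only to \<open>t0\<close>. Used at \<open>t\<close>
    and at \<open>t0\<close> itself, this identifies the two parities.\<close>
  have count: "odd (card (changing t)) \<longleftrightarrow> odd (card {K\<in>?K. a K \<in> A t0 \<longleftrightarrow> b K \<notin> A t0})"
    if t: "t \<in> T" and sub: "Z t \<subseteq> (\<Union>K\<in>?K. G K)" and good: "\<And>K. K \<in> ?K \<Longrightarrow> good K t" for t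
  proof -
    interpret c: coloured_curves "components (Z t)" "A t" "B t" using coloured t by blast
    have inG: "\<exists>K\<in>?K. C \<subseteq> G K" if C: "C \<in> components (Z t)" for C
    proof -
      obtain q where q: "q \<in> C" using in_components_nonempty[OF C] by blast
      then obtain K where K: "K \<in> ?K" "q \<in> G K" using sub in_components_subset[OF C] by blast
      have "C \<subseteq> G K \<or> C \<subseteq> (\<Union>L\<in>?K - {K}. G L)"
      proof (rule connected_subset_open_split)
        show "C \<subseteq> G K \<union> (\<Union>L\<in>?K - {K}. G L)"
          using sub in_components_subset[OF C] by blast
        show "G K \<inter> (\<Union>L\<in>?K - {K}. G L) = {}" using Gdis K(1) by blast
      qed (use oG K C in_components_connected in auto)
      then show ?thesis using K q Gdis by blast
    qed
    define f where "f K = {C \<in> changing t. C \<subseteq> G K}" for K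
    have fch: "finite (changing t)" unfolding changing_def using c.fin by simp
    have "changing t = (\<Union>K\<in>?K. f K)" unfolding f_def using inG unfolding changing_def by blast
    moreover have "card (\<Union>K\<in>?K. f K) = (\<Sum>K\<in>?K. card (f K))"
    proof (rule card_UN_disjoint[OF c0.fin])
      show "\<forall>K\<in>?K. finite (f K)" unfolding f_def using fch by simp
      have "C \<noteq> {}" if "C \<in> changing t" for C
        using that in_components_nonempty unfolding changing_def by blast
      then show "\<forall>K\<in>?K. \<forall>L\<in>?K. K \<noteq> L \<longrightarrow> f K \<inter> f L = {}"
        using Gdis unfolding f_def by blast
    qed
    ultimately have cs: "card (changing t) = (\<Sum>K\<in>?K. card (f K))" by simp
    have par: "odd (card (f K)) \<longleftrightarrow> (a K \<in> A t0 \<longleftrightarrow> b K \<notin> A t0)" if K: "K \<in> ?K" for K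
    proof -
      have gd: "a K \<notin> \<Union>(components (Z t))" "b K \<notin> \<Union>(components (Z t))"
        using good[OF K] unfolding good_def by auto
      have "f K = {C \<in> components (Z t). c.colour_changing C \<and> (a K \<in> inside C \<longleftrightarrow> b K \<notin> inside C)}"
      proof (intro equalityI subsetI)
        fix C assume "C \<in> f K"
        then show "C \<in> {C \<in> components (Z t). c.colour_changing C \<and> (a K \<in> inside C \<longleftrightarrow> b K \<notin> inside C)}"
          using good[OF K] unfolding f_def changing_def c.colour_changing_def good_def G_def by blast
      next
        fix C assume C: "C \<in> {C \<in> components (Z t). c.colour_changing C \<and> (a K \<in> inside C \<longleftrightarrow> b K \<notin> inside C)}"
        then obtain L where L: "L \<in> ?K" "C \<subseteq> G L" using inG by blast
        \<comment> \<open>Otherwise the ball containing both test points of \<open>K\<close> would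
          be disjoint from \<open>C\<close>, and \<open>C\<close> could not separate them.\<close>
        have "L = K"
        proof (rule ccontr)
          assume "L \<noteq> K"
          then have "ball (p K) (s K/2) \<inter> C = {}"
            using L K ball_subset_cball[of "p K" "s K/2"] unfolding G_def by blast
          then have "a K \<in> inside C \<longleftrightarrow> b K \<in> inside C"
            using psab[OF K] C by (intro jordan_same_side[OF c.jor, of _ "ball (p K) (s K/2)"]) auto
          then show False using C by blast
        qed
        then show "C \<in> f K"
          using C L unfolding f_def changing_def c.colour_changing_def by blast
      qed
      then show ?thesis
        using c.colour_parity[OF gd] good[OF K] unfolding good_def by simp
    qed
    have "{K\<in>?K. odd (card (f K))} = {K\<in>?K. a K \<in> A t0 \<longleftrightarrow> b K \<notin> A t0}" using par by blast
    then show ?thesis unfolding cs even_sum_iff[OF c0.fin] by simp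
  qed
  have "Z t0 \<subseteq> (\<Union>K\<in>?K. G K) \<and> (\<forall>K\<in>?K. good K t0)"
    using eventually_nhds_x_imp_x[OF ev] t0 by blast
  then have 0: "odd (card (changing t0)) \<longleftrightarrow> odd (card {K\<in>?K. a K \<in> A t0 \<longleftrightarrow> b K \<notin> A t0})"
    using count[OF t0] by blast
  show ?thesis using ev by eventually_elim (use 0 count in blast)
qed

end

subsection \<open>Continuously differentiable maps and spheres\<close>

text \<open>The derivative is carried as a map into bounded linear functions, so that its continuity
  is meant in operator norm, the form in which the inverse function theorem is stated.\<close>

definition C1_on :: "('a::euclidean_space \<Rightarrow> 'b::euclidean_space) \<Rightarrow> ('a \<Rightarrow> 'a \<Rightarrow>\<^sub>L 'b) \<Rightarrow> 'a set \<Rightarrow> bool" where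
  "C1_on f f' U \<longleftrightarrow> (\<forall>x\<in>U. (f has_derivative blinfun_apply (f' x)) (at x)) \<and> continuous_on U f'"

lemma C1_on_derivative: "C1_on f f' U \<Longrightarrow> x \<in> U \<Longrightarrow> (f has_derivative blinfun_apply (f' x)) (at x)"
  by (simp add: C1_on_def)

lemma C1_on_continuous: "C1_on f f' U \<Longrightarrow> continuous_on U f"
  by (meson C1_on_def continuous_at_imp_continuous_on has_derivative_continuous)

lemma C1_on_subset: "C1_on f f' U \<Longrightarrow> V \<subseteq> U \<Longrightarrow> C1_on f f' V"
  unfolding C1_on_def by (meson continuous_on_subset subsetD)

text \<open>In finite dimension, continuity of the derivative in each fixed direction already gives
  continuity in operator norm.\<close>

lemma C1_onI:
  assumes "\<And>x. x \<in> U \<Longrightarrow> (f has_derivative D x) (at x)"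
    and "\<And>v. continuous_on U (\<lambda>x. D x v)"
  shows "C1_on f (\<lambda>x. Blinfun (D x)) U" "\<And>x v. x \<in> U \<Longrightarrow> Blinfun (D x) v = D x v"
proof -
  have *: "blinfun_apply (Blinfun (D x)) = D x" if "x \<in> U" for x
    using assms(1)[OF that] has_derivative_bounded_linear bounded_linear_Blinfun_apply by blast
  then show "\<And>x v. x \<in> U \<Longrightarrow> Blinfun (D x) v = D x v" by simp
  have "continuous_on U (\<lambda>x. Blinfun (D x))"
  proof (rule continuous_on_blinfun_componentwise)
    fix i show "continuous_on U (\<lambda>x. blinfun_apply (Blinfun (D x)) i)"
      using assms(2)[of i] * by (simp cong: continuous_on_cong)
  qed
  then show "C1_on f (\<lambda>x. Blinfun (D x)) U" unfolding C1_on_def using assms(1) * by simp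
qed

lemma C1_on_compose:
  assumes f: "C1_on f f' U" and g: "C1_on g g' V" and sub: "f ` U \<subseteq> V"
  shows "C1_on (g \<circ> f) (\<lambda>x. g' (f x) o\<^sub>L f' x) U"
proof -
  have "(g \<circ> f has_derivative blinfun_apply (g' (f x) o\<^sub>L f' x)) (at x)" if "x \<in> U" for x
  proof -
    have "blinfun_apply (g' (f x) o\<^sub>L f' x) = blinfun_apply (g' (f x)) \<circ> blinfun_apply (f' x)"
      by (simp add: fun_eq_iff)
    then show ?thesis
      using diff_chain_at[OF C1_on_derivative[OF f that] C1_on_derivative[OF g, of "f x"]] sub that
      by (metis image_subset_iff)
  qed
  moreover have "continuous_on U (\<lambda>x. g' (f x) o\<^sub>L f' x)"
    using f g continuous_on_compose2[of V g' U f] C1_on_continuous[OF f] sub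
    unfolding C1_on_def by (intro bounded_bilinear.continuous_on[OF bounded_bilinear_blinfun_compose]) auto
  ultimately show ?thesis unfolding C1_on_def by blast
qed

lemma smooth_on_C1:
  assumes "smooth_on S f" "x \<in> S"
  obtains U F F' where "open U" "x \<in> U" "C1_on F F' U" "\<And>y. y \<in> S \<Longrightarrow> y \<in> U \<Longrightarrow> F y = f y"
proof -
  have "\<exists>U F. open U \<and> x \<in> U \<and> (\<forall>k. Ck_on k U F) \<and> (\<forall>y\<in>S \<inter> U. F y = f y)"
    using assms unfolding smooth_on_def by (rule bspec)
  then obtain U F where U: "open U" "x \<in> U" "\<forall>k. Ck_on k U F" "\<forall>y\<in>S \<inter> U. F y = f y"
    by (elim exE conjE)
  have "Ck_on (Suc 0) U F" using U(3) by blast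
  then have "\<And>y. y \<in> U \<Longrightarrow> F differentiable (at y)"
    and 2: "\<And>v. continuous_on U (\<lambda>x. frechet_derivative F (at x) v)"
    by simp_all
  then have "\<And>y. y \<in> U \<Longrightarrow> (F has_derivative frechet_derivative F (at y)) (at y)"
    using frechet_derivative_works by blast
  from C1_onI(1)[OF this 2] show thesis using that U by blast
qed

section \<open>The radial retraction, and tangent vectors as velocities of curves\<close>

definition radial :: "'a::euclidean_space \<Rightarrow> 'a" where
  "radial x = inverse (norm x) *\<^sub>R x"

definition radial_deriv :: "'a::euclidean_space \<Rightarrow> 'a \<Rightarrow> 'a" where
  "radial_deriv x v = inverse (norm x) *\<^sub>R v - (inverse (norm x) ^ 3 * (x \<bullet> v)) *\<^sub>R x"

lemma radial_has_derivative:
  assumes "x \<noteq> 0"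
  shows "(radial has_derivative radial_deriv x) (at x)"
proof -
  have n: "(norm has_derivative (\<lambda>v. inverse (norm x) * (x \<bullet> v))) (at x)"
    using has_derivative_norm[OF assms] by (simp add: sgn_div_norm inner_commute divide_inverse mult.commute)
  show ?thesis
    unfolding radial_def[abs_def] radial_deriv_def[abs_def]
    by (rule derivative_eq_intros n refl | use assms in force)+
       (auto simp: fun_eq_iff power3_eq_cube algebra_simps)
qed

lemma radial_C1:
  fixes x :: "'a::euclidean_space"
  shows "C1_on radial (\<lambda>x::'a. Blinfun (radial_deriv x)) (- {0})"
    and "x \<noteq> 0 \<Longrightarrow> Blinfun (radial_deriv x) v = radial_deriv x v"
proof -
  have 1: "\<And>x::'a. x \<in> - {0} \<Longrightarrow> (radial has_derivative radial_deriv x) (at x)"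
    using radial_has_derivative by auto
  have 2: "continuous_on (- {0::'a}) (\<lambda>x. radial_deriv x v)" for v
    unfolding radial_deriv_def by (intro continuous_intros) auto
  show "C1_on radial (\<lambda>x::'a. Blinfun (radial_deriv x)) (- {0})" by (rule C1_onI(1)[OF 1 2])
  show "x \<noteq> 0 \<Longrightarrow> Blinfun (radial_deriv x) v = radial_deriv x v"
    using C1_onI(2)[OF 1 2] by auto
qed

lemma radial_in_sphere: "x \<noteq> 0 \<Longrightarrow> radial x \<in> unit_sphere"
  by (simp add: radial_def)

lemma radial_eq: "norm x = 1 \<Longrightarrow> radial x = x"
  by (simp add: radial_def)

text \<open>The derivative within a set is only determined on vectors that are velocities of curves
  in that set; this is what makes the library's choice of derivative harmless.\<close>

definition velocity :: "'a::euclidean_space set \<Rightarrow> 'a \<Rightarrow> 'a \<Rightarrow> bool" where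
  "velocity S x v \<longleftrightarrow> (\<exists>c. c (0::real) = x \<and> (c has_derivative (\<lambda>s. s *\<^sub>R v)) (at 0) \<and>
     (\<forall>\<^sub>F s in nhds 0. c s \<in> S))"

text \<open>The curve is \<open>radial (x + s *\<^sub>R v)\<close>. Its argument has inner product 1
  with \<open>x\<close> and so never vanishes, and the derivative of the retraction at
  \<open>x\<close> fixes tangent vectors.\<close>

lemma velocity_sphere:
  fixes x :: "'a::euclidean_space"
  assumes "x \<in> unit_sphere" "v \<in> sphere_tangent x"
  shows "velocity unit_sphere x v"
proof -
  have x: "norm x = 1" "x \<noteq> 0" "v \<bullet> x = 0" using assms by (auto simp: sphere_tangent_def)
  let ?c = "\<lambda>s. radial (x + s *\<^sub>R v)"
  have l: "((\<lambda>s. x + s *\<^sub>R v) has_derivative (\<lambda>s. s *\<^sub>R v)) (at 0)"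
    by (auto intro!: derivative_eq_intros)
  have r: "(radial has_derivative radial_deriv x) (at (x + 0 *\<^sub>R v))"
    using radial_has_derivative[OF x(2)] by simp
  have "(?c has_derivative (\<lambda>s. radial_deriv x (s *\<^sub>R v))) (at 0)"
    using diff_chain_at[OF l r] by (simp add: o_def)
  moreover have "radial_deriv x (s *\<^sub>R v) = s *\<^sub>R v" for s
    using x by (simp add: radial_deriv_def inner_commute)
  moreover have "x + s *\<^sub>R v \<noteq> 0" for s
  proof
    assume "x + s *\<^sub>R v = 0"
    then have "(x + s *\<^sub>R v) \<bullet> x = 0" by simp
    then show False using x by (simp add: inner_add_left)
  qed
  then have "\<forall>s. ?c s \<in> unit_sphere" using radial_in_sphere by blast
  ultimately show ?thesis unfolding velocity_def using x(1)
    by (intro exI[of _ ?c]) (auto simp: radial_eq)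
qed

text \<open>The curves are two-sided, and a vector with nonzero time component leaves the interval
  at once on one side of either end. Hence the restriction to interior times.\<close>

lemma velocity_cylinder:
  fixes x :: "'a::euclidean_space"
  assumes "0 < t" "t < 1" "x \<in> unit_sphere" "v \<in> cylinder_tangent (t, x)"
  shows "velocity ({0..1} \<times> unit_sphere) (t, x) v"
proof -
  have "snd v \<in> sphere_tangent x" using assms(4) by (auto simp: cylinder_tangent_def)
  then obtain c where c: "c 0 = x" "(c has_derivative (\<lambda>s. s *\<^sub>R snd v)) (at 0)"
    "\<forall>\<^sub>F s in nhds 0. c s \<in> unit_sphere"
    using velocity_sphere[OF assms(3)] unfolding velocity_def by blast
  have "((\<lambda>s. t + s * fst v) \<longlongrightarrow> t + 0 * fst v) (nhds 0)"
    by (intro tendsto_intros) (simp add: filterlim_ident)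
  then have "\<forall>\<^sub>F s in nhds 0. t + s * fst v \<in> {0<..<1}"
    using assms(1,2) by (intro topological_tendstoD[where S = "{0<..<1}" and l = t]) auto
  with c(3) have "\<forall>\<^sub>F s in nhds 0. (t + s * fst v, c s) \<in> {0..1} \<times> unit_sphere"
    by eventually_elim auto
  moreover have "((\<lambda>s. (t + s * fst v, c s)) has_derivative (\<lambda>s. s *\<^sub>R v)) (at 0)"
    by (auto intro!: derivative_eq_intros c(2) simp: fun_eq_iff prod_eq_iff scaleR_prod_def)
  ultimately show ?thesis unfolding velocity_def using c(1)
    by (intro exI[of _ "\<lambda>s. (t + s * fst v, c s)"]) auto
qed

lemma derivative_along_curve:
  assumes c: "c (0::real) = x" "(c has_derivative (\<lambda>s. s *\<^sub>R v)) (at 0)" "\<forall>\<^sub>F s in nhds 0. c s \<in> S"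
    and f: "(f has_derivative D) (at x within S)"
  shows "((\<lambda>s. f (c s)) has_derivative (\<lambda>s. s *\<^sub>R D v)) (at 0)"
proof -
  obtain V where V: "open V" "0 \<in> V" "\<And>s. s \<in> V \<Longrightarrow> c s \<in> S"
    using c(3) unfolding eventually_nhds by blast
  have "c ` V \<subseteq> S" using V(3) by blast
  then have "(f has_derivative D) (at (c 0) within c ` V)"
    using f c(1) has_derivative_subset by blast
  then have "((\<lambda>s. f (c s)) has_derivative (\<lambda>s. D (s *\<^sub>R v))) (at 0 within V)"
    by (intro has_derivative_in_compose[where f = c and g = f and g' = D]
        has_derivative_at_withinI[OF c(2)])
  then show ?thesis
    by (simp only: at_within_open[OF V(2,1)] linear_scale[OF has_derivative_linear[OF f]])
qed

text \<open>Composing \<open>f\<close> with the curve gives a function of one real variable near 0,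
  whose derivative is unique.\<close>

lemma derivative_unique_on_velocity:
  assumes "velocity S x v" "(f has_derivative D) (at x within S)" "(f has_derivative E) (at x within S)"
  shows "D v = E v"
proof -
  obtain c where c: "c 0 = x" "(c has_derivative (\<lambda>s. s *\<^sub>R v)) (at 0)" "\<forall>\<^sub>F s in nhds 0. c s \<in> S"
    using assms(1) velocity_def by blast
  have "(\<lambda>s::real. s *\<^sub>R D v) = (\<lambda>s. s *\<^sub>R E v)"
    using derivative_along_curve[OF c assms(2)] derivative_along_curve[OF c assms(3)] has_derivative_unique
    by blast
  then show ?thesis by (metis scaleR_one)
qed

lemma has_derivative_restrict:
  assumes "open U" "x \<in> U" "x \<in> S" "(F has_derivative D) (at x)" "\<And>y. y \<in> S \<Longrightarrow> y \<in> U \<Longrightarrow> F y = f y"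
  shows "(f has_derivative D) (at x within S)"
proof -
  obtain d where d: "d > 0" "ball x d \<subseteq> U" using assms(1,2) openE by blast
  show ?thesis
    by (rule has_derivative_transform_within[OF has_derivative_at_withinI[OF assms(4)] d(1) assms(3)])
       (use assms(5) d in \<open>auto simp: dist_commute subset_iff\<close>)
qed

lemma smooth_on_continuous:
  assumes "smooth_on S f"
  shows "continuous_on S f"
proof -
  have "continuous (at x within S) f" if x: "x \<in> S" for x
  proof -
    obtain U F F' where U: "open U" "x \<in> U" "C1_on F F' U" "\<And>y. y \<in> S \<Longrightarrow> y \<in> U \<Longrightarrow> F y = f y"
      using smooth_on_C1[OF assms x] by metis
    show ?thesis
      using has_derivative_restrict[OF U(1,2) x C1_on_derivative[OF U(3,2)] U(4)]
      by (rule has_derivative_continuous)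
  qed
  then show ?thesis by (simp add: continuous_on_eq_continuous_within)
qed

lemma sphere_embedding_homeomorphism:
  fixes f :: "'a::euclidean_space \<Rightarrow> 'b::euclidean_space"
  assumes "sphere_embedding f"
  obtains g where "homeomorphism unit_sphere (f ` unit_sphere) f g"
proof -
  have "\<exists>g. homeomorphism unit_sphere (f ` unit_sphere) f g"
    using assms smooth_on_continuous unfolding sphere_embedding_def
    by (intro homeomorphism_compact) auto
  then show thesis using that by blast
qed

text \<open>This replaces the chosen derivative within \<open>S\<close> by the derivative of an
  extension to an open set, where the chain rule is available.\<close>

lemma frechet_derivative_on_velocity:
  assumes "open U" "x \<in> U" "x \<in> S" "(F has_derivative D) (at x)" "\<And>y. y \<in> S \<Longrightarrow> y \<in> U \<Longrightarrow> F y = f y"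
    and "velocity S x v"
  shows "frechet_derivative f (at x within S) v = D v"
  using has_derivative_restrict[OF assms(1-5)] derivative_unique_on_velocity[OF assms(6)]
  by (metis differentiableI frechet_derivative_works)

section \<open>Local defining functions of an embedded sphere\<close>

lemma continuous_inverse_blinfun:
  fixes f' :: "'a::euclidean_space \<Rightarrow> 'b::euclidean_space \<Rightarrow>\<^sub>L 'b"
  assumes "continuous_on U f'" "\<And>x. x \<in> U \<Longrightarrow> bij (blinfun_apply (f' x))"
  shows "continuous_on U (\<lambda>x. inv (blinfun_apply (f' x)) v)"
  unfolding continuous_on_def
proof
  fix x0 assume x0: "x0 \<in> U"
  let ?u = "\<lambda>x. inv (blinfun_apply (f' x)) v"
  have sol: "f' x (?u x) = v" if "x \<in> U" for x
    using assms(2)[OF that] by (simp add: bij_is_surj surj_f_inv_f)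
  have "linear (blinfun_apply (f' x0))" by (rule bounded_linear.linear[OF blinfun.bounded_linear_right])
  \<comment> \<open>Once \<open>f' x\<close> is within \<open>B / 2\<close> of \<open>f' x0\<close>,
    it is bounded below by \<open>B / 2\<close>. Applied to the difference of the two preimages of
    \<open>v\<close>, this bounds that difference by a multiple of the distance of
    \<open>f' x\<close> from \<open>f' x0\<close>.\<close>
  then obtain B where B: "B > 0" "\<And>u. B * norm u \<le> norm (f' x0 u)"
    using linear_inj_bounded_below_pos bij_is_inj[OF assms(2)[OF x0]] by blast
  have lim: "(f' \<longlongrightarrow> f' x0) (at x0 within U)" using assms(1) x0 by (simp add: continuous_on_def)
  then have "\<forall>\<^sub>F x in at x0 within U. dist (f' x) (f' x0) < B / 2"
    using B(1) by (intro tendstoD) auto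
  moreover have "\<forall>\<^sub>F x in at x0 within U. x \<in> U" by (simp add: eventually_at_filter)
  ultimately have "\<forall>\<^sub>F x in at x0 within U. norm (?u x - ?u x0) \<le> norm (f' x - f' x0) * (2 / B * norm (?u x0))"
  proof eventually_elim
    case (elim x)
    let ?d = "?u x - ?u x0"
    have "f' x ?d = v - f' x (?u x0)" using sol[OF elim(2)] by (simp add: blinfun.diff_right)
    also have "\<dots> = - ((f' x - f' x0) (?u x0))" using sol[OF x0] by (simp add: blinfun.diff_left)
    finally have 1: "norm (f' x ?d) \<le> norm (f' x - f' x0) * norm (?u x0)"
      using norm_blinfun[of "f' x - f' x0" "?u x0"] by simp
    have "norm (f' x0 ?d) \<le> norm (f' x ?d) + norm ((f' x - f' x0) ?d)"
      by (metis add.commute blinfun.diff_left norm_minus_commute norm_triangle_sub)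
    moreover have "norm ((f' x - f' x0) ?d) \<le> B / 2 * norm ?d"
      using norm_blinfun[of "f' x - f' x0" ?d] elim(1)
      by (smt (verit) dist_norm mult_right_mono norm_ge_zero)
    ultimately have "B / 2 * norm ?d \<le> norm (f' x ?d)" using B(2)[of ?d] by simp
    then have "B / 2 * norm ?d \<le> norm (f' x - f' x0) * norm (?u x0)" using 1 by linarith
    then show ?case using B(1) by (simp add: field_simps)
  qed
  moreover have "((\<lambda>x. norm (f' x - f' x0) * (2 / B * norm (?u x0))) \<longlongrightarrow> 0) (at x0 within U)"
    by (rule tendsto_mult_left_zero[OF tendsto_norm_zero[OF LIM_zero[OF lim]]])
  ultimately have "((\<lambda>x. ?u x - ?u x0) \<longlongrightarrow> 0) (at x0 within U)"
    by (rule Lim_null_comparison)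
  then show "(?u \<longlongrightarrow> ?u x0) (at x0 within U)" by (rule LIM_zero_cancel)
qed

lemma C1_on_add:
  assumes "C1_on f f' U" "C1_on g g' U"
  shows "C1_on (\<lambda>x. f x + g x) (\<lambda>x. f' x + g' x) U"
proof -
  have "blinfun_apply (f' x + g' x) = (\<lambda>v. f' x v + g' x v)" for x
    by (simp add: fun_eq_iff plus_blinfun.rep_eq)
  then show ?thesis
    using assms unfolding C1_on_def by (auto intro!: has_derivative_add continuous_on_add)
qed

text \<open>The inverse function theorem straightens the surface to a plane, and the height over
  that plane is \<open>F\<close>. Connectedness of the two sides is recorded because it later forces
  each side into a single component of the complement of the surface.\<close>

lemma local_defining_function:
  fixes \<phi> :: "'a::euclidean_space \<Rightarrow> 'a"
  assumes emb: "sphere_embedding \<phi>" and y0: "y0 \<in> unit_sphere"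
  obtains G F F' where "open G" "\<phi> y0 \<in> G" "C1_on F F' G"
    "\<And>w. w \<in> G \<Longrightarrow> w \<in> \<phi> ` unit_sphere \<longleftrightarrow> F w = (0::real)" "F' (\<phi> y0) \<noteq> 0"
    "connected {w\<in>G. F w > 0}" "connected {w\<in>G. F w < 0}"
proof -
  have smooth: "smooth_on unit_sphere \<phi>" and inj: "inj_on \<phi> unit_sphere"
    and imm: "inj_on (frechet_derivative \<phi> (at y0 within unit_sphere)) (sphere_tangent y0)"
    using emb y0 unfolding sphere_embedding_def by auto
  have n1: "norm y0 = 1" "y0 \<bullet> y0 = 1" "y0 \<noteq> 0" using y0 by (auto simp: dot_square_norm)
  obtain U f f' where U: "open U" "y0 \<in> U" "C1_on f f' U" "\<And>y. y \<in> unit_sphere \<Longrightarrow> y \<in> U \<Longrightarrow> f y = \<phi> y"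
    using smooth_on_C1[OF smooth y0] by metis
  have fd: "f' y0 v = frechet_derivative \<phi> (at y0 within unit_sphere) v" if "v \<in> sphere_tangent y0" for v
    using frechet_derivative_on_velocity[OF U(1,2) y0 C1_on_derivative[OF U(3,2)] U(4) velocity_sphere[OF y0 that]]
    by simp
  \<comment> \<open>The differential preceded by the orthogonal projection to the tangent plane. It
    kills \<open>y0\<close>, so it is not onto, and a vector \<open>n\<close> outside its range
    points off the surface.\<close>
  define L where "L u = f' y0 (u - (u \<bullet> y0) *\<^sub>R y0)" for u
  have linL: "linear L" unfolding L_def
    by (rule linearI) (simp_all add: blinfun.add_right blinfun.diff_right blinfun.scaleR_right algebra_simps)
  have "L y0 = 0" unfolding L_def using n1 by (simp add: blinfun.zero_right)
  then have "\<not> inj L" using n1(3) linear_injective_0[OF linL] by blast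
  then have "\<not> surj L" using linear_surjective_imp_injective[OF linL] by blast
  then obtain n where n: "n \<notin> range L" by blast
  \<comment> \<open>\<open>\<Psi>\<close> below maps the tangent plane \<open>z \<bullet> y0 = 1\<close> onto the surface and moves off it in the
    direction \<open>n\<close>, so its height coordinate is a defining function with half balls as sides.\<close>
  define q where "q z = z - (z \<bullet> y0 - 1) *\<^sub>R y0" for z
  define q' where "q' = Blinfun (\<lambda>u. u - (u \<bullet> y0) *\<^sub>R y0)"
  have q'_apply: "q' u = u - (u \<bullet> y0) *\<^sub>R y0" for u
    unfolding q'_def by (subst bounded_linear_Blinfun_apply) (auto intro!: bounded_linear_intros)
  have qC: "C1_on q (\<lambda>_. q') UNIV" unfolding C1_on_def q_def
    by (auto intro!: derivative_eq_intros simp: q'_apply[abs_def])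
  define k where "k z = (z \<bullet> y0 - 1) *\<^sub>R n" for z
  define k' where "k' = Blinfun (\<lambda>u. (u \<bullet> y0) *\<^sub>R n)"
  have k'_apply: "k' u = (u \<bullet> y0) *\<^sub>R n" for u
    unfolding k'_def by (subst bounded_linear_Blinfun_apply) (auto intro!: bounded_linear_intros)
  have kC: "C1_on k (\<lambda>_. k') UNIV" unfolding C1_on_def k_def
    by (auto intro!: derivative_eq_intros simp: k'_apply[abs_def])
  define r' where "r' x = Blinfun (radial_deriv (x::'a))" for x
  have rC: "C1_on radial r' (- {0})" using radial_C1(1) unfolding r'_def .
  define W where "W = {z. q z \<noteq> 0 \<and> radial (q z) \<in> U}"
  have q0: "q y0 = y0" unfolding q_def using n1 by simp
  have WA: "W = q -` (- {0}) \<inter> (radial \<circ> q) -` U" unfolding W_def by auto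
  have rq: "C1_on (radial \<circ> q) (\<lambda>z. r' (q z) o\<^sub>L q') (q -` (- {0}))"
    by (rule C1_on_compose[OF C1_on_subset[OF qC] rC]) auto
  have oq: "open (q -` (- {0}))"
    using C1_on_continuous[OF qC] by (intro open_vimage) auto
  have oW: "open W" unfolding WA by (rule continuous_open_preimage[OF C1_on_continuous[OF rq] oq U(1)])
  have y0W: "y0 \<in> W" unfolding W_def using q0 n1 U(2) by (simp add: radial_eq)
  have "C1_on (f \<circ> (radial \<circ> q)) (\<lambda>z. f' ((radial \<circ> q) z) o\<^sub>L (r' (q z) o\<^sub>L q')) W"
    by (rule C1_on_compose[OF C1_on_subset[OF rq] U(3)]) (auto simp: W_def)
  define \<Psi> where "\<Psi> z = f (radial (q z)) + k z" for z
  define \<Psi>' where "\<Psi>' z = (f' (radial (q z)) o\<^sub>L (r' (q z) o\<^sub>L q')) + k'" for z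
  have \<Psi>C: "C1_on \<Psi> \<Psi>' W"
    using C1_on_add[OF \<open>C1_on (f \<circ> _) _ W\<close> C1_on_subset[OF kC subset_UNIV]]
    unfolding \<Psi>_def[abs_def] \<Psi>'_def[abs_def] o_def .
  have \<Psi>y0: "\<Psi> y0 = \<phi> y0" unfolding \<Psi>_def k_def using q0 n1 U(2) U(4)[of y0] y0 by (simp add: radial_eq)
  have \<Psi>'y0: "\<Psi>' y0 u = L u + (u \<bullet> y0) *\<^sub>R n" for u
  proof -
    have "radial_deriv y0 (q' u) = q' u"
      using n1 by (simp add: radial_deriv_def q'_apply inner_diff_right inner_commute)
    then show ?thesis unfolding \<Psi>'_def L_def
      using q0 n1 radial_C1(2)[of y0] by (simp add: plus_blinfun.rep_eq k'_apply q'_apply radial_eq r'_def)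
  qed
  have inj\<Psi>: "inj (blinfun_apply (\<Psi>' y0))"
  proof (subst linear_injective_0)
    show "linear (blinfun_apply (\<Psi>' y0))" by (rule bounded_linear.linear[OF blinfun.bounded_linear_right])
    show "\<forall>u. \<Psi>' y0 u = 0 \<longrightarrow> u = 0"
    proof (intro allI impI)
      fix u assume "\<Psi>' y0 u = 0"
      then have eq: "L u + (u \<bullet> y0) *\<^sub>R n = 0" using \<Psi>'y0 by simp
      have uy: "u \<bullet> y0 = 0"
      proof (rule ccontr)
        assume nz: "u \<bullet> y0 \<noteq> 0"
        have "L ((- inverse (u \<bullet> y0)) *\<^sub>R u) = (- inverse (u \<bullet> y0)) *\<^sub>R L u"
          by (rule linear_scale[OF linL])
        also have "L u = - ((u \<bullet> y0) *\<^sub>R n)" using eq by (simp add: eq_neg_iff_add_eq_0)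
        also have "(- inverse (u \<bullet> y0)) *\<^sub>R (- ((u \<bullet> y0) *\<^sub>R n)) = n" using nz by simp
        finally show False using n by (metis rangeI)
      qed
      then have "u \<in> sphere_tangent y0" "0 \<in> sphere_tangent y0" by (auto simp: sphere_tangent_def)
      moreover have "f' y0 u = 0" using eq uy unfolding L_def by simp
      ultimately show "u = 0"
        using inj_onD[OF imm, of u 0] fd[of u] fd[of 0] by (simp add: blinfun.zero_right)
    qed
  qed
  obtain iv where iv: "linear iv" "iv \<circ> blinfun_apply (\<Psi>' y0) = id"
    using linear_injective_left_inverse[OF bounded_linear.linear[OF blinfun.bounded_linear_right] inj\<Psi>] by blast
  have "Blinfun iv o\<^sub>L \<Psi>' y0 = id_blinfun"
    using iv linear_conv_bounded_linear[of iv]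
    by (intro blinfun_eqI) (simp add: bounded_linear_Blinfun_apply fun_eq_iff)
  then obtain U1 V g g' where IF: "open U1" "U1 \<subseteq> W" "y0 \<in> U1" "open V" "\<Psi> y0 \<in> V" "homeomorphism U1 V \<Psi> g"
    and dg: "\<And>y. y \<in> V \<Longrightarrow> (g has_derivative (g' y)) (at y)"
    and g': "\<And>y. y \<in> V \<Longrightarrow> g' y = inv (blinfun_apply (\<Psi>'(g y)))"
    and bij: "\<And>y. y \<in> V \<Longrightarrow> bij (blinfun_apply (\<Psi>'(g y)))"
    using inverse_function_theorem[OF oW C1_on_derivative[OF \<Psi>C] _ y0W] \<Psi>C unfolding C1_on_def by metis
  have gV: "g y \<in> U1" "\<Psi> (g y) = y" if "y \<in> V" for y
    using IF(6) that unfolding homeomorphism_def by auto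
  have gU: "g (\<Psi> z) = z" "\<Psi> z \<in> V" if "z \<in> U1" for z
    using IF(6) that unfolding homeomorphism_def by auto
  have cg: "continuous_on V g" using IF(6) homeomorphism_def by blast
  have "continuous_on V (\<lambda>y. \<Psi>' (g y))"
    by (rule continuous_on_compose2[OF _ cg]) (use \<Psi>C IF(2) gV in \<open>auto simp: C1_on_def\<close>)
  from continuous_inverse_blinfun[OF this bij]
  have cg': "continuous_on V (\<lambda>y. g' y v)" for v using g' by (simp cong: continuous_on_cong)
  define F where "F y = g y \<bullet> y0 - 1" for y
  have dF: "(F has_derivative (\<lambda>v. g' y v \<bullet> y0)) (at y)" if "y \<in> V" for y
    unfolding F_def using dg[OF that] by (auto intro!: derivative_eq_intros)
  have dFc: "continuous_on V (\<lambda>y. g' y v \<bullet> y0)" for v using cg' by (intro continuous_intros)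
  note FC = C1_onI[OF dF dFc]
  obtain r where r: "r > 0" "ball y0 r \<subseteq> U1" using IF(1,3) openE by blast
  \<comment> \<open>The points of the sphere whose central projection to the tangent plane is close
    to \<open>y0\<close>. The rest of the sphere is compact and its image misses
    \<open>\<phi> y0\<close> by injectivity, so no other sheet of the surface enters a small
    neighbourhood.\<close>
  define Y where "Y = {y \<in> unit_sphere. y \<bullet> y0 > 0 \<and> inverse (y \<bullet> y0) *\<^sub>R y \<in> ball y0 r}"
  \<comment> \<open>Multiplication by \<open>y \<bullet> y0\<close> clears the denominator and
    exhibits the complement of \<open>Y\<close> by closed conditions.\<close>
  have "closed (unit_sphere \<inter> {y. y \<bullet> y0 \<le> 0 \<or> r * (y \<bullet> y0) \<le> norm ((y \<bullet> y0) *\<^sub>R y0 - y)})"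
    by (intro closed_Int closed_sphere closed_Collect_disj closed_Collect_le continuous_intros)
  moreover have "unit_sphere \<inter> {y. y \<bullet> y0 \<le> 0 \<or> r * (y \<bullet> y0) \<le> norm ((y \<bullet> y0) *\<^sub>R y0 - y)} = unit_sphere - Y"
  proof -
    have "inverse (y \<bullet> y0) *\<^sub>R y \<in> ball y0 r \<longleftrightarrow> norm ((y \<bullet> y0) *\<^sub>R y0 - y) < r * (y \<bullet> y0)"
      if pos: "y \<bullet> y0 > 0" for y
    proof -
      have "norm ((y \<bullet> y0) *\<^sub>R y0 - y) = (y \<bullet> y0) * norm (y0 - inverse (y \<bullet> y0) *\<^sub>R y)"
      proof -
        have "(y \<bullet> y0) *\<^sub>R y0 - y = (y \<bullet> y0) *\<^sub>R (y0 - inverse (y \<bullet> y0) *\<^sub>R y)"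
          using pos by (simp add: scaleR_right_diff_distrib)
        then show ?thesis using pos by simp
      qed
      then show ?thesis using pos by (simp add: dist_norm mult.commute)
    qed
    then show ?thesis unfolding Y_def by (auto simp: not_le not_less)
  qed
  ultimately have "compact (unit_sphere - Y)"
    by (metis (no_types, lifting) Diff_subset bounded_sphere bounded_subset compact_eq_bounded_closed)
  then have "compact (\<phi> ` (unit_sphere - Y))"
    by (rule compact_continuous_image[rotated]) (meson Diff_subset continuous_on_subset smooth smooth_on_continuous)
  then have oY: "open (- \<phi> ` (unit_sphere - Y))" by (simp add: compact_imp_closed open_Compl)
  have "y0 \<in> Y" unfolding Y_def using y0 n1 r by simp
  then have "\<Psi> y0 \<in> - \<phi> ` (unit_sphere - Y)"
    using inj y0 \<Psi>y0 unfolding inj_on_def by auto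
  moreover have "continuous_on U1 \<Psi>" using IF(6) homeomorphism_def by blast
  ultimately obtain s where s: "s > 0" "ball y0 s \<subseteq> U1" "\<And>z. z \<in> ball y0 s \<Longrightarrow> \<Psi> z \<in> - \<phi> ` (unit_sphere - Y)"
  proof -
    have "open (\<Psi> -` (- \<phi> ` (unit_sphere - Y)) \<inter> U1)"
      using continuous_open_preimage[OF \<open>continuous_on U1 \<Psi>\<close> IF(1) oY] by (simp add: Int_commute)
    then obtain s where "s > 0" "ball y0 s \<subseteq> \<Psi> -` (- \<phi> ` (unit_sphere - Y)) \<inter> U1"
      using \<open>\<Psi> y0 \<in> - \<phi> ` (unit_sphere - Y)\<close> IF(3) openE by blast
    then show thesis using that by blast
  qed
  \<comment> \<open>As the image of a ball, \<open>G\<close> is cut by the surface into the images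
    of two half balls, which are connected.\<close>
  define G where "G = \<Psi> ` ball y0 s"
  have GV: "G \<subseteq> V" unfolding G_def using gU s(2) by blast
  have "G = V \<inter> g -` ball y0 s"
  proof (intro equalityI subsetI)
    fix w assume "w \<in> G"
    then obtain z where z: "z \<in> ball y0 s" "w = \<Psi> z" unfolding G_def by blast
    have "z \<in> U1" using z(1) s(2) by blast
    then show "w \<in> V \<inter> g -` ball y0 s" using gU[of z] z by simp
  next
    fix w assume w: "w \<in> V \<inter> g -` ball y0 s"
    then show "w \<in> G" unfolding G_def using gV(2)[of w] by (intro image_eqI[of _ _ "g w"]) auto
  qed
  then have oG: "open G" using continuous_open_preimage[OF cg IF(4) open_ball] by simp
  have FG: "F (\<Psi> z) = z \<bullet> y0 - 1" if "z \<in> ball y0 s" for z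
    unfolding F_def using gU s(2) that by auto
  have pos: "{w\<in>G. F w > 0} = \<Psi> ` (ball y0 s \<inter> {z. y0 \<bullet> z > 1})"
    and neg: "{w\<in>G. F w < 0} = \<Psi> ` (ball y0 s \<inter> {z. y0 \<bullet> z < 1})"
    unfolding G_def using FG by (auto simp: inner_commute image_iff)
  show thesis
  proof
    show "open G" by fact
    show "\<phi> y0 \<in> G" unfolding G_def using \<Psi>y0 s(1) by (metis centre_in_ball imageI)
    show "C1_on F (\<lambda>y. Blinfun (\<lambda>v. g' y v \<bullet> y0)) G" using C1_on_subset[OF FC(1) GV] .
    have "blinfun_apply (\<Psi>' y0) y0 = n" using \<Psi>'y0[of y0] \<open>L y0 = 0\<close> n1 by simp
    moreover have "g (\<phi> y0) = y0" using gU(1)[OF IF(3)] \<Psi>y0 by simp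
    ultimately have "g' (\<phi> y0) n = y0" using g'[OF IF(5)] inj\<Psi> \<Psi>y0 by (metis inv_f_f)
    then have "Blinfun (\<lambda>v. g' (\<phi> y0) v \<bullet> y0) n = 1" using FC(2)[of "\<phi> y0" n] IF(5) \<Psi>y0 n1 by simp
    then show "Blinfun (\<lambda>v. g' (\<phi> y0) v \<bullet> y0) \<noteq> 0" by (metis blinfun.zero_left zero_neq_one)
    have cb: "continuous_on (ball y0 s \<inter> X) \<Psi>" for X
      using \<open>continuous_on U1 \<Psi>\<close> s(2) continuous_on_subset by (metis Int_lower1)
    show "connected {w\<in>G. F w > 0}" unfolding pos
      by (intro connected_continuous_image cb convex_connected convex_Int convex_ball convex_halfspace_gt)
    show "connected {w\<in>G. F w < 0}" unfolding neg
      by (intro connected_continuous_image cb convex_connected convex_Int convex_ball convex_halfspace_lt)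
    fix w assume "w \<in> G"
    then obtain z where z: "z \<in> ball y0 s" "w = \<Psi> z" unfolding G_def by blast
    show "w \<in> \<phi> ` unit_sphere \<longleftrightarrow> F w = 0"
    proof
      assume "w \<in> \<phi> ` unit_sphere"
      then obtain y where yw: "w = \<phi> y" "y \<in> unit_sphere" by blast
      have "y \<in> Y" using s(3)[OF z(1)] z(2) yw by (metis ComplD DiffI image_eqI)
      note y = this yw
      define x where "x = inverse (y \<bullet> y0) *\<^sub>R y"
      have yp: "y \<bullet> y0 > 0" "norm y = 1" using y Y_def by auto
      have x: "x \<in> U1" "x \<bullet> y0 = 1" using y(1) r(2) yp unfolding x_def Y_def by auto
      have "q x = x" unfolding q_def using x(2) by simp
      moreover have "radial x = y" using yp unfolding radial_def x_def by simp
      moreover have "y \<in> U" using x(1) IF(2) calculation unfolding W_def by auto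
      ultimately have "\<Psi> x = w" unfolding \<Psi>_def k_def using x(2) U(4) y by simp
      then have "g w = x" using gU(1) x(1) by blast
      then show "F w = 0" unfolding F_def using x(2) by simp
    next
      assume "F w = 0"
      then have zy: "z \<bullet> y0 = 1" using FG z by simp
      have zW: "z \<in> W" using z(1) s(2) IF(2) by blast
      have "w = f (radial (q z))" using z(2) zy unfolding \<Psi>_def k_def by simp
      moreover have "radial (q z) \<in> unit_sphere" "radial (q z) \<in> U"
        using zW radial_in_sphere unfolding W_def by auto
      ultimately show "w \<in> \<phi> ` unit_sphere" using U(4) by auto
    qed
  qed
qed

text \<open>By Jordan-Brouwer there is a component other than \<open>\<Omega>\<close>, and
  \<open>\<phi> y0\<close> is on the frontier of both. Each of them meets one of the two connected
  sides and therefore contains it, so exactly one side lies in \<open>\<Omega>\<close>; changing the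
  sign of \<open>F\<close> makes it the positive one.\<close>

lemma oriented_defining_function:
  fixes \<phi> :: "'a::euclidean_space \<Rightarrow> 'a"
  assumes emb: "sphere_embedding \<phi>" and y0: "y0 \<in> unit_sphere" and dim: "2 \<le> DIM('a)"
    and \<Omega>: "\<Omega> \<in> components (- \<phi> ` unit_sphere)"
  obtains G F F' where "open G" "\<phi> y0 \<in> G" "C1_on F F' G"
    "\<And>w. w \<in> G \<Longrightarrow> w \<in> \<phi> ` unit_sphere \<longleftrightarrow> F w = (0::real)" "F' (\<phi> y0) \<noteq> 0"
    "\<And>w. w \<in> G \<Longrightarrow> F w > 0 \<Longrightarrow> w \<in> \<Omega>" "\<And>w. w \<in> G \<Longrightarrow> F w < 0 \<Longrightarrow> w \<notin> \<Omega>"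
proof -
  define M where "M = \<phi> ` unit_sphere"
  obtain G F F' where "open G" "\<phi> y0 \<in> G" "C1_on F F' G"
    and FM: "\<And>w. w \<in> G \<Longrightarrow> w \<in> \<phi> ` unit_sphere \<longleftrightarrow> F w = (0::real)" and "F' (\<phi> y0) \<noteq> 0"
    and "connected {w\<in>G. F w > 0}" "connected {w\<in>G. F w < 0}"
    by (rule local_defining_function[OF emb y0]) (rule that)
  note G = this(1-3) FM[folded M_def] this(5-7)
  obtain k where k: "homeomorphism unit_sphere (\<phi> ` unit_sphere) \<phi> k"
    by (rule sphere_embedding_homeomorphism[OF emb])
  have hom: "M homeomorphic (unit_sphere :: 'a set)"
    unfolding M_def homeomorphic_def using homeomorphism_symD[OF k] by (intro exI)
  have \<Omega>M: "\<Omega> \<in> components (- M)" using \<Omega> M_def by simp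
  have "\<not> connected (- M)" using Jordan_Brouwer_separation[OF hom] by simp
  then have "components (- M) \<noteq> {\<Omega>}"
    using Union_components[of "- M"] in_components_connected[OF \<Omega>M] by (metis ccpo_Sup_singleton)
  then obtain \<Omega>' where \<Omega>': "\<Omega>' \<in> components (- M)" "\<Omega>' \<noteq> \<Omega>" using \<Omega>M by blast
  have dis: "\<Omega>' \<inter> \<Omega> = {}" using components_nonoverlap[OF \<Omega>'(1) \<Omega>M] \<Omega>'(2) by simp
  let ?P = "{w\<in>G. F w > 0}" and ?Q = "{w\<in>G. F w < 0}"
  have meets: "W \<inter> (?P \<union> ?Q) \<noteq> {}" if W: "W \<in> components (- M)" for W
  proof -
    have "\<phi> y0 \<in> frontier W"
      using Jordan_Brouwer_frontier[OF hom W dim] y0 M_def by blast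
    then have "\<phi> y0 \<in> G \<inter> closure W" using G(2) by (simp add: frontier_def)
    then have "G \<inter> W \<noteq> {}" using open_Int_closure_eq_empty[OF G(1)] by blast
    then obtain w where w: "w \<in> G" "w \<in> W" by blast
    then have "w \<notin> M" using in_components_subset[OF W] by blast
    then show ?thesis using w G(4) by (auto simp: neq_iff)
  qed
  have PQM: "?P \<subseteq> - M" "?Q \<subseteq> - M" using G(4) by auto
  have sub: "W \<inter> ?P \<noteq> {} \<Longrightarrow> ?P \<subseteq> W" "W \<inter> ?Q \<noteq> {} \<Longrightarrow> ?Q \<subseteq> W" if "W \<in> components (- M)" for W
    using components_maximal[OF that G(6) PQM(1)] components_maximal[OF that G(7) PQM(2)] by blast+
  consider "?P \<subseteq> \<Omega>" "?Q \<inter> \<Omega> = {}" | "?Q \<subseteq> \<Omega>" "?P \<inter> \<Omega> = {}"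
    using meets[OF \<Omega>M] meets[OF \<Omega>'(1)] sub[OF \<Omega>M] sub[OF \<Omega>'(1)] dis by blast
  then show thesis
  proof cases
    case 1
    show thesis by (rule that[OF G(1-3) _ G(5)]) (use G(4) 1 M_def in auto)
  next
    case 2
    have "C1_on (\<lambda>w. - F w) (\<lambda>w. - F' w) G"
      using G(3) unfolding C1_on_def
      by (auto intro!: continuous_on_minus simp: has_derivative_minus uminus_blinfun.rep_eq)
    then show thesis by (rule that[OF G(1,2)]) (use G(4,5) 2 M_def in auto)
  qed
qed

section \<open>Stereographic coordinates with an arbitrary pole\<close>

locale stereographic =
  fixes N e1 e2 :: "'a::euclidean_space"
  assumes norms: "N \<bullet> N = 1" "e1 \<bullet> e1 = 1" "e2 \<bullet> e2 = 1"
    and orth: "e1 \<bullet> N = 0" "e2 \<bullet> N = 0" "e1 \<bullet> e2 = 0"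
    and expand: "x = (x \<bullet> e1) *\<^sub>R e1 + (x \<bullet> e2) *\<^sub>R e2 + (x \<bullet> N) *\<^sub>R N"
begin

text \<open>The second intersection of the sphere with the line through \<open>N\<close> and the
  point of the equatorial plane with coordinates \<open>z\<close>.\<close>

definition emb :: "complex \<Rightarrow> 'a" where
  "emb z = N + (2 / (z \<bullet> z + 1)) *\<^sub>R (Re z *\<^sub>R e1 + Im z *\<^sub>R e2 - N)"

definition proj :: "'a \<Rightarrow> complex" where
  "proj x = Complex (x \<bullet> e1 / (1 - x \<bullet> N)) (x \<bullet> e2 / (1 - x \<bullet> N))"

lemma denom_pos: "z \<bullet> z + 1 > (0::real)" for z :: complex
  by (simp add: add_nonneg_pos)

lemma emb_inner:
  "emb z \<bullet> e1 = 2 * Re z / (z \<bullet> z + 1)" "emb z \<bullet> e2 = 2 * Im z / (z \<bullet> z + 1)"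
  "emb z \<bullet> N = 1 - 2 / (z \<bullet> z + 1)"
proof -
  have "N \<bullet> e1 = 0" "N \<bullet> e2 = 0" "e2 \<bullet> e1 = 0" using orth by (simp_all only: inner_commute)
  then show "emb z \<bullet> e1 = 2 * Re z / (z \<bullet> z + 1)" "emb z \<bullet> e2 = 2 * Im z / (z \<bullet> z + 1)"
    "emb z \<bullet> N = 1 - 2 / (z \<bullet> z + 1)"
    using norms orth by (simp_all add: emb_def inner_add_left inner_diff_left)
qed

lemma inner_expand: "x \<bullet> x = (x \<bullet> e1)\<^sup>2 + (x \<bullet> e2)\<^sup>2 + (x \<bullet> N)\<^sup>2"
proof -
  have "x \<bullet> x = x \<bullet> ((x \<bullet> e1) *\<^sub>R e1 + (x \<bullet> e2) *\<^sub>R e2 + (x \<bullet> N) *\<^sub>R N)" using expand[of x] by simp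
  then show ?thesis by (simp add: inner_add_right power2_eq_square)
qed

lemma sphere_iff: "x \<in> unit_sphere \<longleftrightarrow> x \<bullet> x = 1" for x :: 'a
  by (simp add: norm_eq_1)

lemma emb_in_sphere: "emb z \<in> unit_sphere"
proof -
  define r where "r = z \<bullet> z + 1"
  have r: "r > 0" "(Re z)\<^sup>2 + (Im z)\<^sup>2 = r - 1"
    using denom_pos[of z] by (simp_all add: r_def inner_complex_def power2_eq_square)
  have "emb z \<bullet> emb z = (4 * ((Re z)\<^sup>2 + (Im z)\<^sup>2)) / r\<^sup>2 + (1 - 2 / r)\<^sup>2"
    unfolding inner_expand[of "emb z"] emb_inner r_def[symmetric] by (simp add: power_divide power_mult_distrib add_divide_distrib algebra_simps)
  also have "\<dots> = 1" unfolding r(2) using r(1) by (simp add: field_simps power2_eq_square)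
  finally show ?thesis using sphere_iff[of "emb z"] by simp
qed

lemma emb_neq: "emb z \<bullet> N \<noteq> 1" "emb z \<noteq> N"
  using emb_inner(3)[of z] denom_pos[of z] norms(1) by auto

lemma proj_emb [simp]: "proj (emb z) = z"
  using denom_pos[of z] by (simp add: proj_def emb_inner complex_eq_iff)

lemma sphere_neq: "x \<in> unit_sphere \<Longrightarrow> x \<noteq> N \<Longrightarrow> x \<bullet> N \<noteq> 1"
  using norms(1) sphere_iff[of x] by (smt (verit) inner_commute inner_diff_left inner_diff_right inner_eq_zero_iff right_minus_eq)

lemma emb_proj:
  assumes "x \<in> unit_sphere" "x \<noteq> N"
  shows "emb (proj x) = x"
proof -
  define c where "c = x \<bullet> N"
  have c: "c \<noteq> 1" using sphere_neq[OF assms] c_def by simp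
  have s: "(x \<bullet> e1)\<^sup>2 + (x \<bullet> e2)\<^sup>2 = 1 - c\<^sup>2"
    using inner_expand[of x] assms(1) sphere_iff[of x] c_def by simp
  have "proj x \<bullet> proj x = ((x \<bullet> e1)\<^sup>2 + (x \<bullet> e2)\<^sup>2) / (1 - c)\<^sup>2"
    by (simp add: proj_def inner_complex_def c_def[symmetric] power2_eq_square add_divide_distrib)
  also have "\<dots> = (1 + c) / (1 - c)"
  proof -
    have "1 - c\<^sup>2 = (1 - c) * (1 + c)" by (simp add: algebra_simps power2_eq_square)
    then show ?thesis unfolding s using c by (simp add: power2_eq_square)
  qed
  finally have "proj x \<bullet> proj x = (1 + c) / (1 - c)" .
  moreover have "(1 + c) / (1 - c) + 1 = 2 / (1 - c)" using c by (simp add: field_simps)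
  ultimately have "2 / (proj x \<bullet> proj x + 1) = 1 - c" by simp
  then have "emb (proj x) = N + (1 - c) *\<^sub>R ((x \<bullet> e1 / (1 - c)) *\<^sub>R e1 + (x \<bullet> e2 / (1 - c)) *\<^sub>R e2 - N)"
    unfolding emb_def by (simp add: proj_def c_def)
  also have "\<dots> = N + ((x \<bullet> e1) *\<^sub>R e1 + (x \<bullet> e2) *\<^sub>R e2 - (1 - c) *\<^sub>R N)"
    using c by (simp add: scaleR_right_diff_distrib scaleR_right_distrib)
  also have "\<dots> = (x \<bullet> e1) *\<^sub>R e1 + (x \<bullet> e2) *\<^sub>R e2 + c *\<^sub>R N"
    by (simp add: scaleR_left_diff_distrib)
  finally show ?thesis using expand[of x] c_def by simp
qed

definition emb_deriv :: "complex \<Rightarrow> complex \<Rightarrow> 'a" where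
  "emb_deriv z w = (2 / (z \<bullet> z + 1)) *\<^sub>R (Re w *\<^sub>R e1 + Im w *\<^sub>R e2) -
     (4 * (z \<bullet> w) / (z \<bullet> z + 1)\<^sup>2) *\<^sub>R (Re z *\<^sub>R e1 + Im z *\<^sub>R e2 - N)"

lemma emb_has_derivative: "(emb has_derivative emb_deriv z) (at z)"
proof -
  have nz: "z \<bullet> z + 1 \<noteq> 0" using denom_pos[of z] by simp
  have g: "((\<lambda>z. 2 / (z \<bullet> z + 1)) has_derivative (\<lambda>w. - (4 * (z \<bullet> w) / (z \<bullet> z + 1)\<^sup>2))) (at z)"
    using nz by (auto intro!: derivative_eq_intros simp: fun_eq_iff inner_commute power2_eq_square)
  have l: "((\<lambda>z. Re z *\<^sub>R e1 + Im z *\<^sub>R e2 - N) has_derivative (\<lambda>w. Re w *\<^sub>R e1 + Im w *\<^sub>R e2)) (at z)"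
    by (auto intro!: derivative_eq_intros simp: fun_eq_iff)
  show ?thesis
    unfolding emb_def[abs_def] emb_deriv_def[abs_def]
    using has_derivative_add[OF has_derivative_const has_derivative_scaleR[OF g l], of N]
    by (simp add: algebra_simps)
qed

lemma emb_C1: "C1_on emb (\<lambda>z. Blinfun (emb_deriv z)) UNIV" "Blinfun (emb_deriv z) w = emb_deriv z w"
proof -
  have 2: "continuous_on UNIV (\<lambda>z. emb_deriv z w)" for w
    unfolding emb_deriv_def
    by (intro continuous_intros ballI) (use denom_pos in \<open>simp_all add: less_imp_neq[symmetric]\<close>)
  show "C1_on emb (\<lambda>z. Blinfun (emb_deriv z)) UNIV" "Blinfun (emb_deriv z) w = emb_deriv z w"
    using C1_onI[of UNIV, OF emb_has_derivative 2] by auto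
qed

lemma continuous_emb: "continuous_on A emb"
  using C1_on_continuous[OF emb_C1(1)] continuous_on_subset by blast

lemma continuous_proj: "continuous_on {x. x \<bullet> N \<noteq> 1} proj"
  unfolding proj_def[abs_def] by (intro continuous_intros) auto

lemma homeomorphism_emb: "homeomorphism UNIV (unit_sphere - {N}) emb proj"
proof (rule homeomorphismI)
  show "continuous_on (unit_sphere - {N}) proj"
    by (rule continuous_on_subset[OF continuous_proj]) (use sphere_neq in blast)
qed (use continuous_emb emb_in_sphere emb_neq emb_proj in auto)

lemma open_neq: "open {x::'a. x \<bullet> N \<noteq> 1}"
  by (intro open_Collect_neq continuous_intros)

lemma proj_differentiable:
  assumes "x \<bullet> N \<noteq> 1"
  shows "proj differentiable (at x)"
proof -
  have "proj = (\<lambda>x. (x \<bullet> e1 / (1 - x \<bullet> N)) *\<^sub>R 1 + (x \<bullet> e2 / (1 - x \<bullet> N)) *\<^sub>R \<i>)"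
    by (auto simp: proj_def fun_eq_iff complex_eq_iff)
  moreover have "(\<lambda>x. (x \<bullet> e1 / (1 - x \<bullet> N)) *\<^sub>R 1 + (x \<bullet> e2 / (1 - x \<bullet> N)) *\<^sub>R \<i>) differentiable (at x)"
    unfolding differentiable_def by (rule exI) (rule derivative_eq_intros refl | use assms in force)+
  ultimately show ?thesis by simp
qed

text \<open>On the punctured sphere \<open>emb\<close> after \<open>proj\<close> is the identity.
  Differentiating this along a curve with velocity \<open>v\<close> writes \<open>v\<close> as a
  value of \<open>emb_deriv z\<close>, without solving for \<open>w\<close>.\<close>

lemma emb_deriv_surj_tangent:
  assumes v: "v \<in> sphere_tangent (emb z)"
  obtains w where "emb_deriv z w = v"
proof -
  let ?x = "emb z" and ?S = "unit_sphere - {N}"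
  obtain c where c: "c 0 = ?x" "(c has_derivative (\<lambda>s. s *\<^sub>R v)) (at 0)"
    "\<forall>\<^sub>F s in nhds 0. c s \<in> unit_sphere"
    using velocity_sphere[OF emb_in_sphere v] unfolding velocity_def by blast
  have "isCont c 0" using has_derivative_continuous[OF c(2)] .
  then have "(c \<longlongrightarrow> ?x) (nhds 0)"
    unfolding c(1)[symmetric] by (simp add: tendsto_at_iff_tendsto_nhds[symmetric] isCont_def)
  then have "\<forall>\<^sub>F s in nhds 0. c s \<in> - {N}"
    by (rule topological_tendstoD) (use emb_neq in auto)
  with c(3) have "\<forall>\<^sub>F s in nhds 0. c s \<in> ?S" by eventually_elim auto
  then have vel: "velocity ?S ?x v" unfolding velocity_def using c(1,2) by blast
  have H: "(proj has_derivative frechet_derivative proj (at ?x)) (at ?x)"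
    using proj_differentiable emb_neq(1) frechet_derivative_works by blast
  have "(emb \<circ> proj has_derivative emb_deriv z \<circ> frechet_derivative proj (at ?x)) (at ?x)"
    using diff_chain_at[OF H] emb_has_derivative[of z] by simp
  note D = this
  have "((\<lambda>x. x) has_derivative emb_deriv z \<circ> frechet_derivative proj (at ?x)) (at ?x within ?S)"
    by (rule has_derivative_restrict[OF open_UNIV UNIV_I _ D])
       (use emb_in_sphere emb_neq emb_proj in auto)
  from derivative_unique_on_velocity[OF vel this has_derivative_ident]
  show thesis using that by auto
qed

end

lemma ex_stereographic:
  fixes N :: "real^3"
  assumes "N \<in> unit_sphere"
  obtains e1 e2 where "stereographic N e1 e2"
proof -
  have "norm (axis 3 1 :: real^3) = norm N" using assms by simp
  then obtain f :: "real^3 \<Rightarrow> real^3" where f: "orthogonal_transformation f" "f (axis 3 1) = N"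
    by (rule orthogonal_transformation_exists)
  have lin: "linear f" using f(1) by (rule orthogonal_transformation_linear)
  have inn: "f x \<bullet> f y = x \<bullet> y" for x y
    using f(1) unfolding orthogonal_transformation_def by simp
  have "stereographic N (f (axis 1 1)) (f (axis 2 1))"
  proof
    fix x
    obtain y where y: "x = f y"
      using orthogonal_transformation_surj[OF f(1)] by (metis surjD)
    have "y = (y $ 1) *\<^sub>R axis 1 1 + (y $ 2) *\<^sub>R axis 2 1 + (y $ 3) *\<^sub>R axis 3 1"
      by (simp add: vec_eq_iff forall_3 axis_def)
    then have "f y = f ((y $ 1) *\<^sub>R axis 1 1 + (y $ 2) *\<^sub>R axis 2 1 + (y $ 3) *\<^sub>R axis 3 1)" by simp
    also have "\<dots> = (y $ 1) *\<^sub>R f (axis 1 1) + (y $ 2) *\<^sub>R f (axis 2 1) + (y $ 3) *\<^sub>R N"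
      by (simp add: linear_add[OF lin] linear_scale[OF lin] f(2))
    finally show "x = (x \<bullet> f (axis 1 1)) *\<^sub>R f (axis 1 1) + (x \<bullet> f (axis 2 1)) *\<^sub>R f (axis 2 1) + (x \<bullet> N) *\<^sub>R N"
      unfolding f(2)[symmetric] y inn by (simp add: inner_axis f(2))
  qed (simp_all add: f(2)[symmetric] inn inner_axis_axis)
  then show thesis using that by blast
qed

subsection \<open>Level sets near a regular point\<close>

text \<open>The derivative in direction \<open>d\<close> stays positive on a small ball. Since the
  ball is convex, \<open>f\<close> increases along the whole segment between the two points.\<close>

lemma monotone_direction:
  fixes f :: "'a::euclidean_space \<Rightarrow> real"
  assumes f: "C1_on f f' H" "open H" "q0 \<in> H" and pos: "f' q0 d > 0"
  obtains \<delta> where "\<delta> > 0" "ball q0 \<delta> \<subseteq> H"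
    "\<And>q \<tau>. q \<in> ball q0 \<delta> \<Longrightarrow> q + \<tau> *\<^sub>R d \<in> ball q0 \<delta> \<Longrightarrow> \<tau> > 0 \<Longrightarrow> f q < f (q + \<tau> *\<^sub>R d)"
proof -
  have "continuous_on H (\<lambda>q. f' q d)"
    using f(1) unfolding C1_on_def by (intro continuous_intros) auto
  then have "open (H \<inter> (\<lambda>q. f' q d) -` {0<..})"
    by (intro continuous_open_preimage f(2)) auto
  moreover have "q0 \<in> H \<inter> (\<lambda>q. f' q d) -` {0<..}" using f(3) pos by simp
  ultimately obtain \<delta> where \<delta>: "\<delta> > 0" "ball q0 \<delta> \<subseteq> H \<inter> (\<lambda>q. f' q d) -` {0<..}"
    by (rule openE)
  show thesis
  proof
    show "\<delta> > 0" "ball q0 \<delta> \<subseteq> H" using \<delta> by auto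
    fix q and \<tau> :: real assume q: "q \<in> ball q0 \<delta>" "q + \<tau> *\<^sub>R d \<in> ball q0 \<delta>" "\<tau> > 0"
    have "f (q + 0 *\<^sub>R d) < f (q + \<tau> *\<^sub>R d)"
    proof (rule DERIV_pos_imp_increasing[OF q(3), of "\<lambda>s. f (q + s *\<^sub>R d)"])
      fix s assume s: "0 \<le> s" "s \<le> \<tau>"
      have "(1 - s / \<tau>) *\<^sub>R q + (s / \<tau>) *\<^sub>R (q + \<tau> *\<^sub>R d) \<in> ball q0 \<delta>"
        using convexD[OF convex_ball q(1,2), of "1 - s/\<tau>" "s/\<tau>"] s q(3) by simp
      moreover have "(1 - s / \<tau>) *\<^sub>R q + (s / \<tau>) *\<^sub>R (q + \<tau> *\<^sub>R d) = q + s *\<^sub>R d"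
        using q(3) by (simp add: algebra_simps)
      ultimately have b: "q + s *\<^sub>R d \<in> ball q0 \<delta>" by simp
      have l: "((\<lambda>s. q + s *\<^sub>R d) has_derivative (\<lambda>s. s *\<^sub>R d)) (at s)"
        by (auto intro!: derivative_eq_intros)
      have "(f has_derivative blinfun_apply (f' (q + s *\<^sub>R d))) (at (q + s *\<^sub>R d))"
        using C1_on_derivative[OF f(1)] b \<delta>(2) by blast
      from diff_chain_at[OF l this]
      have "((\<lambda>s. f (q + s *\<^sub>R d)) has_derivative (\<lambda>h. h * f' (q + s *\<^sub>R d) d)) (at s)"
        by (simp add: o_def blinfun.scaleR_right)
      then have "DERIV (\<lambda>s. f (q + s *\<^sub>R d)) s :> f' (q + s *\<^sub>R d) d"
        by (rule has_derivative_imp_has_field_derivative) simp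
      then show "\<exists>y. DERIV (\<lambda>s. f (q + s *\<^sub>R d)) s :> y \<and> 0 < y" using b \<delta>(2) by auto
    qed
    then show "f q < f (q + \<tau> *\<^sub>R d)" by simp
  qed
qed

lemma eventually_pos:
  assumes "isCont c p0" "isCont f (c p0)" "f (c p0) > (0::real)"
  shows "\<forall>\<^sub>F p in nhds p0. f (c p) > 0"
proof -
  have "isCont (\<lambda>p. f (c p)) p0" using isCont_o2[OF assms(1,2)] .
  then have "((\<lambda>p. f (c p)) \<longlongrightarrow> f (c p0)) (nhds p0)"
    using tendsto_at_iff_tendsto_nhds[of "\<lambda>p. f (c p)" p0] by (simp add: isCont_def)
  then show ?thesis using assms(3) by (rule order_tendstoD(1))
qed

text \<open>Near the point \<open>f\<close> is strictly monotone in time, hence has at most one zero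
  on each vertical segment. Its opposite signs at \<open>t0 - d\<close> and \<open>t0 + d\<close>
  over \<open>z0\<close> persist for nearby \<open>x\<close>, and the intermediate value theorem
  gives a zero. The factor \<open>\<sigma>\<close> reduces to the increasing case.\<close>

lemma sweeping_analytic:
  fixes f :: "real \<times> 'a::euclidean_space \<Rightarrow> real"
  assumes f: "C1_on f f' H" "open H" "(t0, z0) \<in> H" and f0: "f (t0, z0) = 0"
    and nz: "f' (t0, z0) (1, 0) \<noteq> 0"
  shows "\<exists>e>0. \<exists>N. open N \<and> z0 \<in> N \<and> ball t0 e \<times> N \<subseteq> H \<and>
      (\<forall>x\<in>N. \<forall>t\<in>ball t0 e. \<forall>t'\<in>ball t0 e. f (t, x) = 0 \<longrightarrow> f (t', x) = 0 \<longrightarrow> t = t')" (is ?A)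
    and "\<forall>e>0. \<exists>N. open N \<and> z0 \<in> N \<and> (\<forall>x\<in>N. \<exists>t\<in>ball t0 e. (t, x) \<in> H \<and> f (t, x) = 0)" (is ?B)
proof -
  define \<sigma> where "\<sigma> = sgn (f' (t0, z0) (1, 0))"
  have \<sigma>: "\<sigma> = 1 \<or> \<sigma> = -1" using nz unfolding \<sigma>_def by (auto simp: sgn_if)
  have "f' (t0, z0) (\<sigma>, 0) = \<sigma> * f' (t0, z0) (1, 0)"
    using blinfun.scaleR_right[of "f' (t0, z0)" \<sigma> "(1, 0)"] by simp
  then have "f' (t0, z0) (\<sigma>, 0) > 0" using nz unfolding \<sigma>_def by (simp add: sgn_if)
  then obtain \<delta> where \<delta>: "\<delta> > 0" "ball (t0, z0) \<delta> \<subseteq> H"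
    "\<And>q \<tau>. q \<in> ball (t0, z0) \<delta> \<Longrightarrow> q + \<tau> *\<^sub>R (\<sigma>, 0) \<in> ball (t0, z0) \<delta> \<Longrightarrow> \<tau> > 0 \<Longrightarrow> f q < f (q + \<tau> *\<^sub>R (\<sigma>, 0))"
    by (rule monotone_direction[OF f]) (rule that)
  have "(t0, z0) \<in> ball (t0, z0) \<delta>" using \<delta>(1) by simp
  then obtain A B where AB: "open A" "open B" "(t0, z0) \<in> A \<times> B" "A \<times> B \<subseteq> ball (t0, z0) \<delta>"
    by (rule open_prod_elim[OF open_ball])
  have "t0 \<in> A" using AB(3) by simp
  then obtain \<epsilon> where \<epsilon>: "\<epsilon> > 0" "ball t0 \<epsilon> \<subseteq> A" by (rule openE[OF AB(1)])
  have inb: "(t, x) \<in> ball (t0, z0) \<delta>" if "t \<in> ball t0 \<epsilon>" "x \<in> B" for t x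
    using that AB(4) \<epsilon>(2) by blast
  have mono: "\<sigma> * f (t, x) < \<sigma> * f (t', x)" if "t \<in> ball t0 \<epsilon>" "t' \<in> ball t0 \<epsilon>" "x \<in> B" "t < t'" for t t' x
    using \<sigma> \<delta>(3)[of "(t, x)" "t' - t"] \<delta>(3)[of "(t', x)" "t' - t"] inb[OF that(1,3)] inb[OF that(2,3)] that(4)
    by auto
  have "t = t'" if "t \<in> ball t0 \<epsilon>" "t' \<in> ball t0 \<epsilon>" "x \<in> B" "f (t, x) = 0" "f (t', x) = 0" for t t' x
    using mono[OF that(1,2,3)] mono[OF that(2,1,3)] that(4,5) by (cases t t' rule: linorder_cases) auto
  then show ?A using \<epsilon> AB inb \<delta>(2) by (intro exI[of _ \<epsilon>] conjI exI[of _ B]) blast+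
  show ?B
  proof (intro allI impI)
    fix e :: real assume "e > 0"
    define d where "d = min e \<epsilon> / 2"
    have d: "d > 0" "d < e" "d < \<epsilon>" using \<open>e > 0\<close> \<epsilon>(1) unfolding d_def by auto
    have tb: "t0 - d \<in> ball t0 \<epsilon>" "t0 + d \<in> ball t0 \<epsilon>" "t0 \<in> ball t0 \<epsilon>" "z0 \<in> B"
      using d AB(3) by (auto simp: dist_real_def)
    have cf: "isCont f (t, x)" if "t \<in> ball t0 \<epsilon>" "x \<in> B" for t x
      using has_derivative_continuous[OF C1_on_derivative[OF f(1)]] inb[OF that] \<delta>(2) by blast
    have s: "\<sigma> * f (t0 + d, z0) > 0" "- (\<sigma> * f (t0 - d, z0)) > 0"
      using mono[OF tb(3,2,4)] mono[OF tb(1,3,4)] d(1) f0 by auto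
    have "\<forall>\<^sub>F x in nhds z0. \<sigma> * f (t0 + d, x) > 0"
      using eventually_pos[where c = "\<lambda>x. (t0 + d, x)" and ?p0.0 = z0 and f = "\<lambda>p. \<sigma> * f p"] s(1) cf[OF tb(2,4)] by (simp add: continuous_intros)
    moreover have "\<forall>\<^sub>F x in nhds z0. - (\<sigma> * f (t0 - d, x)) > 0"
      using eventually_pos[where c = "\<lambda>x. (t0 - d, x)" and ?p0.0 = z0 and f = "\<lambda>p. - (\<sigma> * f p)"] s(2) cf[OF tb(1,4)] by (simp add: continuous_intros)
    moreover have "\<forall>\<^sub>F x in nhds z0. x \<in> B" using AB(2) tb(4) by (rule eventually_nhds_in_open)
    ultimately have "\<forall>\<^sub>F x in nhds z0. x \<in> B \<and> \<sigma> * f (t0 + d, x) > 0 \<and> - (\<sigma> * f (t0 - d, x)) > 0"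
      by eventually_elim simp
    then obtain N where N: "open N" "z0 \<in> N"
      "\<And>x. x \<in> N \<Longrightarrow> x \<in> B \<and> \<sigma> * f (t0 + d, x) > 0 \<and> - (\<sigma> * f (t0 - d, x)) > 0"
      unfolding eventually_nhds by blast
    have "\<exists>t\<in>ball t0 e. (t, x) \<in> H \<and> f (t, x) = 0" if x: "x \<in> N" for x
    proof -
      have tin: "t \<in> ball t0 \<epsilon>" "t \<in> ball t0 e" if "t0 - d \<le> t" "t \<le> t0 + d" for t
        using that d by (auto simp: dist_real_def)
      have "continuous_on {t0 - d..t0 + d} (\<lambda>t. \<sigma> * f (t, x))"
      proof (intro continuous_at_imp_continuous_on ballI)
        fix t assume "t \<in> {t0 - d..t0 + d}"
        then have "isCont f (t, x)" using cf tin(1) N(3)[OF x] by simp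
        then show "isCont (\<lambda>t. \<sigma> * f (t, x)) t"
          by (intro continuous_intros isCont_o2[where g = f and f = "\<lambda>t. (t, x)"]) auto
      qed
      then obtain t where t: "t0 - d \<le> t" "t \<le> t0 + d" "\<sigma> * f (t, x) = 0"
        using IVT'[of "\<lambda>t. \<sigma> * f (t, x)" "t0 - d" 0 "t0 + d"] N(3)[OF x] d(1) by auto
      then have "f (t, x) = 0" using \<sigma> by auto
      moreover have "(t, x) \<in> H" using inb[OF tin(1)[OF t(1,2)]] N(3)[OF x] \<delta>(2) by blast
      ultimately show ?thesis using tin(2)[OF t(1,2)] by blast
    qed
    then show "\<exists>N. open N \<and> z0 \<in> N \<and> (\<forall>x\<in>N. \<exists>t\<in>ball t0 e. (t, x) \<in> H \<and> f (t, x) = 0)"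
      using N(1,2) by blast
  qed
qed

text \<open>On each horizontal segment strict monotonicity and the signs at the ends give exactly
  one zero, so the zero set is the graph of a function \<open>\<rho>\<close> of the height. Once
  \<open>\<rho>\<close> is continuous, the zero set is a continuous image of an interval and the two
  sides are continuous images of a rectangle.\<close>

lemma graph_box:
  fixes g :: "complex \<Rightarrow> real"
  assumes cont: "continuous_on {\<zeta>. \<bar>Re \<zeta>\<bar> \<le> \<delta> \<and> \<bar>Im \<zeta>\<bar> < \<eta>} g"
    and mono: "\<And>\<alpha> \<alpha>' \<beta>. \<bar>\<beta>\<bar> < \<eta> \<Longrightarrow> -\<delta> \<le> \<alpha> \<Longrightarrow> \<alpha> < \<alpha>' \<Longrightarrow> \<alpha>' \<le> \<delta> \<Longrightarrow> g (Complex \<alpha> \<beta>) < g (Complex \<alpha>' \<beta>)"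
    and ends: "\<And>\<beta>. \<bar>\<beta>\<bar> < \<eta> \<Longrightarrow> g (Complex (-\<delta>) \<beta>) < 0" "\<And>\<beta>. \<bar>\<beta>\<bar> < \<eta> \<Longrightarrow> g (Complex \<delta> \<beta>) > 0"
    and \<delta>: "\<delta> > 0"
  shows "connected {\<zeta>. \<bar>Re \<zeta>\<bar> < \<delta> \<and> \<bar>Im \<zeta>\<bar> < \<eta> \<and> g \<zeta> = 0}" (is "connected ?Z")
    and "connected {\<zeta>. \<bar>Re \<zeta>\<bar> < \<delta> \<and> \<bar>Im \<zeta>\<bar> < \<eta> \<and> g \<zeta> > 0}" (is "connected ?P")
    and "connected {\<zeta>. \<bar>Re \<zeta>\<bar> < \<delta> \<and> \<bar>Im \<zeta>\<bar> < \<eta> \<and> g \<zeta> < 0}" (is "connected ?Q")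
proof -
  let ?I = "{-\<eta><..<\<eta>}"
  have "\<exists>\<rho>. \<bar>\<rho>\<bar> < \<delta> \<and> g (Complex \<rho> \<beta>) = 0" if \<beta>: "\<beta> \<in> ?I" for \<beta>
  proof -
    have b: "\<bar>\<beta>\<bar> < \<eta>" using \<beta> by auto
    have "continuous_on {-\<delta>..\<delta>} (\<lambda>\<alpha>. g (Complex \<alpha> \<beta>))"
      by (rule continuous_on_compose2[OF cont]) (use b in \<open>auto intro!: continuous_intros\<close>)
    then obtain \<rho> where \<rho>: "-\<delta> \<le> \<rho>" "\<rho> \<le> \<delta>" "g (Complex \<rho> \<beta>) = 0"
      using IVT'[of "\<lambda>\<alpha>. g (Complex \<alpha> \<beta>)" "-\<delta>" 0 \<delta>] ends[OF b] \<delta> by auto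
    then have "\<rho> \<noteq> -\<delta>" "\<rho> \<noteq> \<delta>" using ends[OF b] by auto
    then show ?thesis using \<rho> by (intro exI[of _ \<rho>]) auto
  qed
  then have "\<forall>\<beta>\<in>?I. \<exists>\<rho>. \<bar>\<rho>\<bar> < \<delta> \<and> g (Complex \<rho> \<beta>) = 0" by blast
  from bchoice[OF this] obtain \<rho> where \<rho>: "\<And>\<beta>. \<beta> \<in> ?I \<Longrightarrow> \<bar>\<rho> \<beta>\<bar> < \<delta> \<and> g (Complex (\<rho> \<beta>) \<beta>) = 0" by blast
  have trich: "(\<alpha> > \<rho> \<beta> \<longrightarrow> g (Complex \<alpha> \<beta>) > 0) \<and> (\<alpha> < \<rho> \<beta> \<longrightarrow> g (Complex \<alpha> \<beta>) < 0)"
    if "\<beta> \<in> ?I" "-\<delta> \<le> \<alpha>" "\<alpha> \<le> \<delta>" for \<alpha> \<beta>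
    using mono[of \<beta> "\<rho> \<beta>" \<alpha>] mono[of \<beta> \<alpha> "\<rho> \<beta>"] \<rho>[OF that(1)] that by auto
  have sgnZ: "g (Complex \<alpha> \<beta>) = 0 \<longleftrightarrow> \<alpha> = \<rho> \<beta>" and sgnP: "g (Complex \<alpha> \<beta>) > 0 \<longleftrightarrow> \<alpha> > \<rho> \<beta>"
    and sgnQ: "g (Complex \<alpha> \<beta>) < 0 \<longleftrightarrow> \<alpha> < \<rho> \<beta>"
    if "\<beta> \<in> ?I" "-\<delta> \<le> \<alpha>" "\<alpha> \<le> \<delta>" for \<alpha> \<beta>
    using trich[OF that] \<rho>[OF that(1)] by (cases \<alpha> "\<rho> \<beta>" rule: linorder_cases; simp)+
  have cg: "continuous_on ?I (\<lambda>\<beta>. g (Complex \<alpha> \<beta>))" if "-\<delta> \<le> \<alpha>" "\<alpha> \<le> \<delta>" for \<alpha>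
    by (rule continuous_on_compose2[OF cont]) (use that in \<open>auto intro!: continuous_intros\<close>)
  have c\<rho>: "continuous_on ?I \<rho>"
    unfolding continuous_on_def
  proof (intro ballI tendstoI)
    fix b e :: real assume b: "b \<in> ?I" and e: "e > 0"
    \<comment> \<open>The two abscissae are clipped to the box, since nothing is known about
      \<open>g\<close> beyond it.\<close>
    define a1 where "a1 = max (\<rho> b - e/2) (-\<delta>)"
    define a2 where "a2 = min (\<rho> b + e/2) \<delta>"
    have a: "-\<delta> \<le> a1" "a1 < \<rho> b" "\<rho> b - e < a1" "a2 \<le> \<delta>" "\<rho> b < a2" "a2 < \<rho> b + e" "a1 \<le> \<delta>" "-\<delta> \<le> a2"
      using \<rho>[OF b] e \<delta> unfolding a1_def a2_def by auto
    have "g (Complex a1 b) < 0" "0 < g (Complex a2 b)"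
      using sgnQ[OF b a(1,7)] sgnP[OF b a(8,4)] a by auto
    moreover have "((\<lambda>\<beta>. g (Complex a1 \<beta>)) \<longlongrightarrow> g (Complex a1 b)) (at b within ?I)"
      "((\<lambda>\<beta>. g (Complex a2 \<beta>)) \<longlongrightarrow> g (Complex a2 b)) (at b within ?I)"
      using cg[OF a(1,7)] cg[OF a(8,4)] b unfolding continuous_on_def by blast+
    ultimately have "\<forall>\<^sub>F \<beta> in at b within ?I. g (Complex a1 \<beta>) < 0" "\<forall>\<^sub>F \<beta> in at b within ?I. 0 < g (Complex a2 \<beta>)"
      using order_tendstoD by blast+
    moreover have "\<forall>\<^sub>F \<beta> in at b within ?I. \<beta> \<in> ?I" by (simp add: eventually_at_filter)
    ultimately show "\<forall>\<^sub>F \<beta> in at b within ?I. dist (\<rho> \<beta>) (\<rho> b) < e"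
    proof eventually_elim
      case (elim \<beta>)
      then have "a1 < \<rho> \<beta>" "\<rho> \<beta> < a2" using sgnQ[OF elim(3) a(1,7)] sgnP[OF elim(3) a(8,4)] by auto
      then show ?case using a by (auto simp: dist_real_def)
    qed
  qed
  have "?Z = (\<lambda>\<beta>. Complex (\<rho> \<beta>) \<beta>) ` ?I"
  proof (intro equalityI subsetI)
    fix \<zeta> assume "\<zeta> \<in> ?Z"
    then have "Im \<zeta> \<in> ?I" "\<zeta> = Complex (\<rho> (Im \<zeta>)) (Im \<zeta>)"
      using sgnZ[of "Im \<zeta>" "Re \<zeta>"] by (auto simp: complex_eq_iff abs_less_iff)
    then show "\<zeta> \<in> (\<lambda>\<beta>. Complex (\<rho> \<beta>) \<beta>) ` ?I" by blast
  qed (use \<rho> in auto)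
  then show "connected ?Z"
    using c\<rho> by (simp only:) (intro connected_continuous_image continuous_intros connected_Ioo)
  \<comment> \<open>These maps interpolate horizontally between the graph and the right and left
    edge.\<close>
  let ?p = "\<lambda>q. Complex (\<rho> (snd q) + fst q * (\<delta> - \<rho> (snd q))) (snd q)"
  let ?q = "\<lambda>q. Complex (\<rho> (snd q) - fst q * (\<rho> (snd q) + \<delta>)) (snd q)"
  let ?D = "{0<..<1::real} \<times> ?I"
  have cD: "connected ?D" by (intro connected_Times connected_Ioo)
  have crs: "continuous_on ?D (\<lambda>q. \<rho> (snd q))"
    by (rule continuous_on_compose2[OF c\<rho>]) (auto intro!: continuous_intros)
  have "?P = ?p ` ?D"
  proof (intro equalityI subsetI)
    fix \<zeta> assume z: "\<zeta> \<in> ?P"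
    then have I: "Im \<zeta> \<in> ?I" and r: "\<rho> (Im \<zeta>) < Re \<zeta>" "Re \<zeta> < \<delta>"
      using sgnP[of "Im \<zeta>" "Re \<zeta>"] by (auto simp: abs_less_iff)
    define l where "l = (Re \<zeta> - \<rho> (Im \<zeta>)) / (\<delta> - \<rho> (Im \<zeta>))"
    have "\<zeta> = ?p (l, Im \<zeta>)" "(l, Im \<zeta>) \<in> ?D" using I r unfolding l_def by (auto simp: complex_eq_iff)
    then show "\<zeta> \<in> ?p ` ?D" by blast
  next
    fix \<zeta> assume "\<zeta> \<in> ?p ` ?D"
    then obtain l b where lb: "0 < l" "l < 1" "b \<in> ?I" "\<zeta> = Complex (\<rho> b + l * (\<delta> - \<rho> b)) b" by auto
    have "0 < \<delta> - \<rho> b" using \<rho>[OF lb(3)] by auto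
    then have "0 < l * (\<delta> - \<rho> b)" "l * (\<delta> - \<rho> b) < \<delta> - \<rho> b"
      using lb(1,2) mult_strict_right_mono[of l 1 "\<delta> - \<rho> b"] by simp_all
    then have r: "\<rho> b < \<rho> b + l * (\<delta> - \<rho> b)" "- \<delta> < \<rho> b + l * (\<delta> - \<rho> b)"
      "\<rho> b + l * (\<delta> - \<rho> b) < \<delta>"
      using \<rho>[OF lb(3)] by linarith+
    then have "g \<zeta> > 0" unfolding lb(4) using sgnP[OF lb(3), of "\<rho> b + l * (\<delta> - \<rho> b)"] by linarith
    then show "\<zeta> \<in> ?P" using r lb(3,4) by (simp add: abs_less_iff)
  qed
  then show "connected ?P"
    using cD crs by (simp only:) (intro connected_continuous_image continuous_intros)
  have "?Q = ?q ` ?D"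
  proof (intro equalityI subsetI)
    fix \<zeta> assume z: "\<zeta> \<in> ?Q"
    then have I: "Im \<zeta> \<in> ?I" and r: "Re \<zeta> < \<rho> (Im \<zeta>)" "-\<delta> < Re \<zeta>"
      using sgnQ[of "Im \<zeta>" "Re \<zeta>"] by (auto simp: abs_less_iff)
    define l where "l = (\<rho> (Im \<zeta>) - Re \<zeta>) / (\<rho> (Im \<zeta>) + \<delta>)"
    have "\<zeta> = ?q (l, Im \<zeta>)" "(l, Im \<zeta>) \<in> ?D" using I r unfolding l_def by (auto simp: complex_eq_iff)
    then show "\<zeta> \<in> ?q ` ?D" by blast
  next
    fix \<zeta> assume "\<zeta> \<in> ?q ` ?D"
    then obtain l b where lb: "0 < l" "l < 1" "b \<in> ?I" "\<zeta> = Complex (\<rho> b - l * (\<rho> b + \<delta>)) b" by auto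
    have "0 < \<rho> b + \<delta>" using \<rho>[OF lb(3)] by auto
    then have "0 < l * (\<rho> b + \<delta>)" "l * (\<rho> b + \<delta>) < \<rho> b + \<delta>"
      using lb(1,2) mult_strict_right_mono[of l 1 "\<rho> b + \<delta>"] by simp_all
    then have r: "\<rho> b - l * (\<rho> b + \<delta>) < \<rho> b" "- \<delta> < \<rho> b - l * (\<rho> b + \<delta>)"
      "\<rho> b - l * (\<rho> b + \<delta>) < \<delta>"
      using \<rho>[OF lb(3)] by linarith+
    then have "g \<zeta> < 0" unfolding lb(4) using sgnQ[OF lb(3), of "\<rho> b - l * (\<rho> b + \<delta>)"] by linarith
    then show "\<zeta> \<in> ?Q" using r lb(3,4) by (simp add: abs_less_iff)
  qed
  then show "connected ?Q"
    using cD crs by (simp only:) (intro connected_continuous_image continuous_intros)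
qed

text \<open>Multiplication by \<open>e\<close> turns and scales a box so that its real axis points
  in a direction in which \<open>f\<close> increases; \<open>graph_box\<close> then applies at every
  time close to \<open>t0\<close>. The points \<open>u\<close> and \<open>v\<close> lie on this axis
  at half the width of the box, and their signs do not change for a short time.\<close>

lemma persistent_analytic:
  fixes f :: "real \<times> complex \<Rightarrow> real"
  assumes f: "C1_on f f' H" "open H" "(t0, z0) \<in> H" and f0: "f (t0, z0) = 0"
    and nz: "f' (t0, z0) (0, e0) \<noteq> 0"
  obtains N u v \<eta> where "open N" "connected N" "z0 \<in> N" "u \<in> N" "v \<in> N" "\<eta> > 0" "ball t0 \<eta> \<times> N \<subseteq> H"
    "\<And>t. t \<in> ball t0 \<eta> \<Longrightarrow> connected {z\<in>N. f (t, z) = 0}"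
    "\<And>t. t \<in> ball t0 \<eta> \<Longrightarrow> connected {z\<in>N. f (t, z) > 0} \<and> f (t, u) > 0"
    "\<And>t. t \<in> ball t0 \<eta> \<Longrightarrow> connected {z\<in>N. f (t, z) < 0} \<and> f (t, v) < 0"
proof -
  define e where "e = sgn (f' (t0, z0) (0, e0)) *\<^sub>R e0"
  have "f' (t0, z0) (0, e) = sgn (f' (t0, z0) (0, e0)) * f' (t0, z0) (0, e0)"
    using blinfun.scaleR_right[of "f' (t0, z0)" _ "(0, e0)"] unfolding e_def by simp
  then have pos: "f' (t0, z0) (0, e) > 0" using nz by (simp add: sgn_if)
  then have e: "e \<noteq> 0" by (metis blinfun.zero_right less_irrefl zero_prod_def)
  obtain \<delta>0 where \<delta>0: "\<delta>0 > 0" "ball (t0, z0) \<delta>0 \<subseteq> H"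
    "\<And>q \<tau>. q \<in> ball (t0, z0) \<delta>0 \<Longrightarrow> q + \<tau> *\<^sub>R (0, e) \<in> ball (t0, z0) \<delta>0 \<Longrightarrow> \<tau> > 0 \<Longrightarrow> f q < f (q + \<tau> *\<^sub>R (0, e))"
    by (rule monotone_direction[OF f pos]) (rule that)
  have "(t0, z0) \<in> ball (t0, z0) \<delta>0" using \<delta>0(1) by simp
  then obtain A B where AB: "open A" "open B" "(t0, z0) \<in> A \<times> B" "A \<times> B \<subseteq> ball (t0, z0) \<delta>0"
    by (rule open_prod_elim[OF open_ball])
  have "z0 \<in> B" "t0 \<in> A" using AB(3) by auto
  obtain s where s: "s > 0" "ball z0 s \<subseteq> B" by (rule openE[OF AB(2) \<open>z0 \<in> B\<close>])
  \<comment> \<open>With both coordinates bounded by \<open>\<delta>\<close>, one of them strictly,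
    \<open>norm \<zeta>\<close> is less than \<open>2 * \<delta>\<close>, which keeps
    \<open>P \<zeta>\<close> in the ball of radius \<open>s\<close>.\<close>
  define \<delta> where "\<delta> = s / norm e / 2"
  have \<delta>: "\<delta> > 0" using s e unfolding \<delta>_def by simp
  define P where "P \<zeta> = z0 + \<zeta> * e" for \<zeta>
  have PB: "P \<zeta> \<in> B" if "\<bar>Re \<zeta>\<bar> \<le> \<delta>" "\<bar>Im \<zeta>\<bar> < \<delta>" for \<zeta>
  proof -
    have "norm \<zeta> < 2 * \<delta>" using cmod_le[of \<zeta>] that by linarith
    then have "norm (\<zeta> * e) < s" unfolding \<delta>_def using e by (simp add: norm_mult field_simps)
    then show ?thesis using s(2) unfolding P_def by (auto simp: dist_norm norm_minus_commute)
  qed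
  have inb: "(t, P \<zeta>) \<in> ball (t0, z0) \<delta>0" if "t \<in> A" "\<bar>Re \<zeta>\<bar> \<le> \<delta>" "\<bar>Im \<zeta>\<bar> < \<delta>" for t \<zeta>
    using that AB(4) PB by blast
  have mono: "f (t, P (Complex \<alpha> \<beta>)) < f (t, P (Complex \<alpha>' \<beta>))"
    if "t \<in> A" "\<bar>\<beta>\<bar> < \<delta>" "-\<delta> \<le> \<alpha>" "\<alpha> < \<alpha>'" "\<alpha>' \<le> \<delta>" for t \<alpha> \<alpha>' \<beta>
  proof -
    have "(t, P (Complex \<alpha>' \<beta>)) = (t, P (Complex \<alpha> \<beta>)) + (\<alpha>' - \<alpha>) *\<^sub>R (0, e)"
      unfolding P_def by (simp add: complex_eq_iff algebra_simps)
    then show ?thesis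
      using \<delta>0(3)[of "(t, P (Complex \<alpha> \<beta>))" "\<alpha>' - \<alpha>"] inb[of t "Complex \<alpha> \<beta>"] inb[of t "Complex \<alpha>' \<beta>"] that
      by auto
  qed
  have cf: "isCont f (t, P \<zeta>)" if "t \<in> A" "\<bar>Re \<zeta>\<bar> \<le> \<delta>" "\<bar>Im \<zeta>\<bar> < \<delta>" for t \<zeta>
    using has_derivative_continuous[OF C1_on_derivative[OF f(1)]] inb[OF that] \<delta>0(2) by blast
  have P0: "f (t0, P (Complex 0 0)) = 0" using f0 unfolding P_def by (simp add: zero_complex.code[symmetric] Complex_eq_0)
  have sg: "f (t0, P (Complex a 0)) > 0" if "0 < a" "a \<le> \<delta>" for a
    using mono[OF \<open>t0 \<in> A\<close>, of 0 0 a] that P0 \<delta> by simp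
  have sl: "- f (t0, P (Complex (-a) 0)) > 0" if "0 < a" "a \<le> \<delta>" for a
    using mono[OF \<open>t0 \<in> A\<close>, of 0 "-a" 0] that P0 \<delta> by simp
  have cP: "isCont (\<lambda>q. (fst q, P (Complex (a q) (b q)))) p" if "isCont a p" "isCont b p" for a b :: "real \<times> real \<Rightarrow> real" and p
    using that unfolding P_def isCont_def by (intro tendsto_intros tendsto_Complex)
  \<comment> \<open>This and \<open>evn\<close> are used twice: with \<open>snd\<close> for
    \<open>b\<close> they fix the signs along the right and left edges for all small heights, and
    with the constant 0 they fix the signs at the two markers.\<close>
  have evp: "\<forall>\<^sub>F q in nhds (t0, 0). f (fst q, P (Complex a (b q))) > 0"
    if "0 < a" "a \<le> \<delta>" "isCont b (t0, 0)" "b (t0, 0) = 0" for a and b :: "real \<times> real \<Rightarrow> real"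
    using eventually_pos[where c = "\<lambda>q. (fst q, P (Complex a (b q)))" and ?p0.0 = "(t0, 0)" and f = f]
      cP[OF continuous_const that(3), of a] cf[OF \<open>t0 \<in> A\<close>, of "Complex a 0"] sg[OF that(1,2)] that \<delta> by simp
  have evn: "\<forall>\<^sub>F q in nhds (t0, 0). - f (fst q, P (Complex (-a) (b q))) > 0"
    if "0 < a" "a \<le> \<delta>" "isCont b (t0, 0)" "b (t0, 0) = 0" for a and b :: "real \<times> real \<Rightarrow> real"
    using eventually_pos[where c = "\<lambda>q. (fst q, P (Complex (-a) (b q)))" and ?p0.0 = "(t0, 0)" and f = "\<lambda>x. - f x"]
      cP[OF continuous_const that(3), of "-a"] cf[OF \<open>t0 \<in> A\<close>, of "Complex (-a) 0"] sl[OF that(1,2)] that \<delta>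
    by (simp add: continuous_minus)
  have d2: "0 < \<delta>/2" "\<delta>/2 \<le> \<delta>" using \<delta> by auto
  have isn: "isCont snd (t0, 0::real)" "isCont (\<lambda>q::real\<times>real. 0::real) (t0, 0)" by (auto intro!: continuous_intros)
  have "open (A \<times> {-\<delta><..<\<delta>})" "(t0, 0) \<in> A \<times> {-\<delta><..<\<delta>}" using AB(1) \<open>t0 \<in> A\<close> \<delta> by (auto intro: open_Times)
  then have "\<forall>\<^sub>F q in nhds (t0, 0). q \<in> A \<times> {-\<delta><..<\<delta>}" by (rule eventually_nhds_in_open)
  with evp[OF \<delta> order_refl isn(1) snd_conv] evn[OF \<delta> order_refl isn(1) snd_conv]
    evp[OF d2 isn(2) refl] evn[OF d2 isn(2) refl]
  have "\<forall>\<^sub>F q in nhds (t0, 0). q \<in> A \<times> {-\<delta><..<\<delta>} \<and>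
      f (fst q, P (Complex \<delta> (snd q))) > 0 \<and> f (fst q, P (Complex (-\<delta>) (snd q))) < 0 \<and>
      f (fst q, P (Complex (\<delta>/2) 0)) > 0 \<and> f (fst q, P (Complex (-(\<delta>/2)) 0)) < 0"
    by eventually_elim simp
  then obtain S where S: "open S" "(t0, 0) \<in> S" "\<And>q. q \<in> S \<Longrightarrow> q \<in> A \<times> {-\<delta><..<\<delta>} \<and>
      f (fst q, P (Complex \<delta> (snd q))) > 0 \<and> f (fst q, P (Complex (-\<delta>) (snd q))) < 0 \<and>
      f (fst q, P (Complex (\<delta>/2) 0)) > 0 \<and> f (fst q, P (Complex (-(\<delta>/2)) 0)) < 0"
    unfolding eventually_nhds by blast
  obtain A1 B1 where AB1: "open A1" "open B1" "(t0, 0) \<in> A1 \<times> B1" "A1 \<times> B1 \<subseteq> S"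
    by (rule open_prod_elim[OF S(1,2)])
  have "t0 \<in> A1" "0 \<in> B1" using AB1(3) by auto
  obtain \<eta>1 where \<eta>1: "\<eta>1 > 0" "ball t0 \<eta>1 \<subseteq> A1" by (rule openE[OF AB1(1) \<open>t0 \<in> A1\<close>])
  obtain \<eta> where \<eta>: "\<eta> > 0" "ball 0 \<eta> \<subseteq> B1" by (rule openE[OF AB1(2) \<open>0 \<in> B1\<close>])
  have Sb: "t \<in> A \<and> \<bar>\<beta>\<bar> < \<delta> \<and> f (t, P (Complex \<delta> \<beta>)) > 0 \<and> f (t, P (Complex (-\<delta>) \<beta>)) < 0 \<and>
      f (t, P (Complex (\<delta>/2) 0)) > 0 \<and> f (t, P (Complex (-(\<delta>/2)) 0)) < 0"
    if "t \<in> ball t0 \<eta>1" "\<bar>\<beta>\<bar> < \<eta>" for t \<beta>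
  proof -
    have "(t, \<beta>) \<in> S" using that \<eta>1(2) \<eta>(2) AB1(4) by (auto simp: subset_iff)
    from S(3)[OF this] show ?thesis by auto
  qed
  have \<eta>\<delta>: "\<bar>\<beta>\<bar> < \<delta>" if "\<bar>\<beta>\<bar> < \<eta>" for \<beta> using Sb[of t0 \<beta>] \<eta>1(1) that by simp
  define R where "R = {\<zeta>. \<bar>Re \<zeta>\<bar> < \<delta> \<and> \<bar>Im \<zeta>\<bar> < \<eta>}"
  have contP: "continuous_on X P" for X unfolding P_def by (intro continuous_intros)
  have PR: "{z \<in> P ` R. p z} = P ` {\<zeta>. \<bar>Re \<zeta>\<bar> < \<delta> \<and> \<bar>Im \<zeta>\<bar> < \<eta> \<and> p (P \<zeta>)}" for p
    unfolding R_def by blast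
  have box: "connected {\<zeta>. \<bar>Re \<zeta>\<bar> < \<delta> \<and> \<bar>Im \<zeta>\<bar> < \<eta> \<and> f (t, P \<zeta>) = 0}"
    "connected {\<zeta>. \<bar>Re \<zeta>\<bar> < \<delta> \<and> \<bar>Im \<zeta>\<bar> < \<eta> \<and> f (t, P \<zeta>) > 0}"
    "connected {\<zeta>. \<bar>Re \<zeta>\<bar> < \<delta> \<and> \<bar>Im \<zeta>\<bar> < \<eta> \<and> f (t, P \<zeta>) < 0}" if t: "t \<in> ball t0 \<eta>1" for t
  proof -
    have tA: "t \<in> A" using Sb[OF t, of 0] \<eta>(1) by simp
    have "continuous_on {\<zeta>. \<bar>Re \<zeta>\<bar> \<le> \<delta> \<and> \<bar>Im \<zeta>\<bar> < \<eta>} (\<lambda>\<zeta>. f (t, P \<zeta>))"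
    proof (intro continuous_at_imp_continuous_on ballI)
      fix \<zeta> assume "\<zeta> \<in> {\<zeta>. \<bar>Re \<zeta>\<bar> \<le> \<delta> \<and> \<bar>Im \<zeta>\<bar> < \<eta>}"
      then have "isCont f (t, P \<zeta>)" using cf[OF tA] \<eta>\<delta> by simp
      then show "isCont (\<lambda>\<zeta>. f (t, P \<zeta>)) \<zeta>"
        by (intro isCont_o2[where g = f and f = "\<lambda>\<zeta>. (t, P \<zeta>)"]) (auto simp: P_def intro!: continuous_intros)
    qed
    from graph_box[OF this mono[OF tA \<eta>\<delta>] _ _ \<delta>] Sb[OF t]
    show "connected {\<zeta>. \<bar>Re \<zeta>\<bar> < \<delta> \<and> \<bar>Im \<zeta>\<bar> < \<eta> \<and> f (t, P \<zeta>) = 0}"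
      "connected {\<zeta>. \<bar>Re \<zeta>\<bar> < \<delta> \<and> \<bar>Im \<zeta>\<bar> < \<eta> \<and> f (t, P \<zeta>) > 0}"
      "connected {\<zeta>. \<bar>Re \<zeta>\<bar> < \<delta> \<and> \<bar>Im \<zeta>\<bar> < \<eta> \<and> f (t, P \<zeta>) < 0}" by blast+
  qed
  have Rconv: "connected R"
  proof (intro convex_connected)
    have "R = {\<zeta>. Re \<zeta> < \<delta>} \<inter> {\<zeta>. Re \<zeta> > -\<delta>} \<inter> {\<zeta>. Im \<zeta> < \<eta>} \<inter> {\<zeta>. Im \<zeta> > -\<eta>}"
      unfolding R_def by (auto simp: abs_less_iff)
    then show "convex R"
      by (simp add: convex_Int convex_halfspace_Re_lt convex_halfspace_Re_gt convex_halfspace_Im_lt convex_halfspace_Im_gt)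
  qed
  have "P ` R = {z. \<bar>Re ((z - z0) / e)\<bar> < \<delta> \<and> \<bar>Im ((z - z0) / e)\<bar> < \<eta>}"
  proof (intro equalityI subsetI)
    fix z assume "z \<in> {z. \<bar>Re ((z - z0) / e)\<bar> < \<delta> \<and> \<bar>Im ((z - z0) / e)\<bar> < \<eta>}"
    then have "(z - z0) / e \<in> R" "P ((z - z0) / e) = z" using e unfolding R_def P_def by auto
    then show "z \<in> P ` R" by (metis imageI)
  qed (use e in \<open>auto simp: R_def P_def\<close>)
  moreover have "open {z. \<bar>Re ((z - z0) / e)\<bar> < \<delta> \<and> \<bar>Im ((z - z0) / e)\<bar> < \<eta>}"
    using e by (intro open_Collect_conj open_Collect_less continuous_intros) auto
  ultimately have oPR: "open (P ` R)" by simp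
  show thesis
  proof (rule that[of "P ` R" "P (Complex (\<delta>/2) 0)" "P (Complex (-(\<delta>/2)) 0)" \<eta>1])
    show "open (P ` R)" by fact
    show "connected (P ` R)" using contP Rconv by (rule connected_continuous_image)
    have "0 \<in> R" "P 0 = z0" unfolding R_def P_def using \<delta> \<eta> by auto
    then show "z0 \<in> P ` R" by (metis imageI)
    show "P (Complex (\<delta>/2) 0) \<in> P ` R" "P (Complex (-(\<delta>/2)) 0) \<in> P ` R"
      using \<delta> \<eta> unfolding R_def by auto
    show "\<eta>1 > 0" by fact
    show "ball t0 \<eta>1 \<times> P ` R \<subseteq> H"
    proof clarify
      fix t \<zeta> assume t: "t \<in> ball t0 \<eta>1" and \<zeta>: "\<zeta> \<in> R"
      have "t \<in> A" using Sb[OF t, of 0] \<eta>(1) by simp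
      then have "(t, P \<zeta>) \<in> ball (t0, z0) \<delta>0" using inb[of t \<zeta>] \<zeta> \<eta>\<delta> unfolding R_def by simp
      then show "(t, P \<zeta>) \<in> H" using \<delta>0(2) by blast
    qed
    fix t assume t: "t \<in> ball t0 \<eta>1"
    show "connected {z \<in> P ` R. f (t, z) = 0}"
      unfolding PR[of "\<lambda>z. f (t, z) = 0"] by (rule connected_continuous_image[OF contP box(1)[OF t]])
    show "connected {z \<in> P ` R. f (t, z) > 0} \<and> f (t, P (Complex (\<delta>/2) 0)) > 0"
      unfolding PR[of "\<lambda>z. f (t, z) > 0"]
      using connected_continuous_image[OF contP box(2)[OF t]] Sb[OF t, of 0] \<eta>(1) by simp
    show "connected {z \<in> P ` R. f (t, z) < 0} \<and> f (t, P (Complex (-(\<delta>/2)) 0)) < 0"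
      unfolding PR[of "\<lambda>z. f (t, z) < 0"]
      using connected_continuous_image[OF contP box(3)[OF t]] Sb[OF t, of 0] \<eta>(1) by simp
  qed
qed

subsection \<open>Links\<close>

lemma jordan_if_homeomorphic_circle:
  assumes "J homeomorphic sphere (0::complex) 1"
  shows "jordan J"
proof -
  let ?c = "\<lambda>x::real. exp (2 * of_real pi * \<i> * of_real x) :: complex"
  have eq: "x = y \<or> x = 0 \<and> y = 1 \<or> x = 1 \<and> y = 0"
    if x: "x \<in> {0..1}" and y: "y \<in> {0..1}" and c: "?c x = ?c y" for x y
  proof -
    obtain n :: int where "2 * of_real pi * \<i> * of_real x =
        2 * of_real pi * \<i> * of_real y + of_real (real_of_int (2 * n) * pi) * \<i>"
      using c unfolding exp_eq by blast
    then have "complex_of_real (2 * pi) * \<i> * complex_of_real x = of_real (2 * pi) * \<i> * of_real (y + of_int n)"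
      by (simp add: algebra_simps)
    then have "complex_of_real x = of_real (y + of_int n)" by simp
    then have "x = y + of_int n" by (simp only: of_real_eq_iff)
    moreover have "n = 0 \<or> n = 1 \<or> n = -1"
    proof -
      have "- 1 \<le> real_of_int n" "real_of_int n \<le> 1" using \<open>x = y + of_int n\<close> x y by auto
      then show ?thesis by linarith
    qed
    ultimately show ?thesis using x y by auto
  qed
  have sp: "simple_path ?c"
    unfolding simple_path_def path_def loop_free_def using eq by (auto intro!: continuous_intros)
  have im: "path_image ?c = sphere 0 1"
  proof (intro equalityI subsetI)
    fix z :: complex assume "z \<in> sphere 0 1"
    then have z: "norm z = 1" by simp
    have "z = ?c (Arg2pi z / (2 * pi))"
      using Arg2pi_eq[of z] z by (simp add: mult.commute mult.left_commute)
    moreover have "Arg2pi z / (2 * pi) \<in> {0..1}"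
      using Arg2pi_ge_0[of z] Arg2pi_lt_2pi[of z] by (simp add: less_imp_le)
    ultimately show "z \<in> path_image ?c" unfolding path_image_def by blast
  qed (auto simp: path_image_def norm_exp_eq_Re)
  obtain f g where fg: "homeomorphism (sphere (0::complex) 1) J f g"
    using assms homeomorphic_sym homeomorphic_def by metis
  have "simple_path (f \<circ> ?c)"
  proof (rule simple_path_continuous_image[OF sp], unfold im)
    show "continuous_on (sphere 0 1) f" using fg homeomorphism_def by blast
    show "inj_on f (sphere 0 1)" using homeomorphism_apply1[OF fg] by (rule inj_on_inverseI)
  qed
  moreover have "pathfinish (f \<circ> ?c) = pathstart (f \<circ> ?c)"
    using exp_two_pi_i by (simp add: pathfinish_def pathstart_def)
  moreover have "J = path_image (f \<circ> ?c)"
    using im homeomorphism_image1[OF fg] by (simp add: path_image_compose)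
  ultimately show ?thesis unfolding jordan_def by blast
qed

text \<open>Each member and the union of the others are disjoint closed sets, so a connected subset
  cannot meet both.\<close>

lemma components_disjoint_Union:
  fixes \<C> :: "'a::t2_space set set"
  assumes "finite \<C>" "\<And>C. C \<in> \<C> \<Longrightarrow> compact C \<and> connected C \<and> C \<noteq> {}" "disjoint \<C>"
  shows "components (\<Union>\<C>) = \<C>"
proof -
  have sub: "X \<subseteq> C" if C: "C \<in> \<C>" and X: "connected X" "X \<subseteq> \<Union>\<C>" "X \<inter> C \<noteq> {}" for X C
  proof (rule ccontr)
    assume n: "\<not> X \<subseteq> C"
    have "closed C" "closed (\<Union>(\<C> - {C}))"
      using assms C by (auto intro!: closed_Union compact_imp_closed)
    moreover have "C \<inter> \<Union>(\<C> - {C}) = {}"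
      using assms(3) C by (auto simp: pairwise_def disjnt_def)
    moreover have "X \<subseteq> C \<union> \<Union>(\<C> - {C})" "X \<inter> \<Union>(\<C> - {C}) \<noteq> {}" using X n by blast+
    ultimately show False
      using X(1,3) unfolding connected_closed by (metis Int_commute inf_bot_right inf_assoc)
  qed
  have "C \<in> components (\<Union>\<C>)" if "C \<in> \<C>" for C
    unfolding in_components_maximal using assms(2)[OF that] sub[OF that] that by blast
  moreover have "X \<in> \<C>" if X: "X \<in> components (\<Union>\<C>)" for X
  proof -
    obtain x where x: "x \<in> X" using in_components_nonempty[OF X] by blast
    then obtain C where C: "C \<in> \<C>" "x \<in> C" using in_components_subset[OF X] by blast
    have "C \<in> components (\<Union>\<C>)" using calculation C(1) .
    then have "X = C" using components_eq[OF X] x C(2) by auto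
    then show ?thesis using C by simp
  qed
  ultimately show ?thesis by blast
qed

lemma embedded_circle_homeomorphic:
  assumes "embedded_circle C"
  shows "C homeomorphic sphere (0::complex) 1"
proof -
  obtain \<gamma> :: "real^2 \<Rightarrow> 'a" where \<gamma>: "sphere_embedding \<gamma>" "C = \<gamma> ` unit_sphere"
    using assms unfolding embedded_circle_def by blast
  obtain k where "homeomorphism unit_sphere (\<gamma> ` unit_sphere) \<gamma> k"
    by (rule sphere_embedding_homeomorphism[OF \<gamma>(1)])
  then have "(unit_sphere :: (real^2) set) homeomorphic C" unfolding \<gamma>(2) homeomorphic_def by blast
  moreover have "(unit_sphere :: (real^2) set) homeomorphic sphere (0::complex) 1"
    by (intro homeomorphic_spheres_gen) auto
  ultimately show ?thesis using homeomorphic_sym homeomorphic_trans by blast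
qed

lemma circle_compact_connected:
  assumes "C homeomorphic sphere (0::complex) 1"
  shows "compact C" "connected C" "C \<noteq> {}"
proof -
  show "compact C" using homeomorphic_compactness[OF assms] by simp
  show "connected C" using homeomorphic_connectedness[OF assms] connected_sphere[of "0::complex" 1] by simp
  show "C \<noteq> {}" using assms homeomorphic_empty(2) by fastforce
qed

lemma components_link:
  assumes "is_link L"
  shows "finite (components L)" "\<And>C. C \<in> components L \<Longrightarrow> C homeomorphic sphere (0::complex) 1"
proof -
  obtain \<C> where C: "finite \<C>" "\<forall>C\<in>\<C>. embedded_circle C" "disjoint \<C>" "L = \<Union>\<C>"
    using assms unfolding is_link_def by blast
  have "components L = \<C>" unfolding C(4)
    using C circle_compact_connected[OF embedded_circle_homeomorphic] by (intro components_disjoint_Union) auto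
  then show "finite (components L)" "\<And>C. C \<in> components L \<Longrightarrow> C homeomorphic sphere (0::complex) 1"
    using C embedded_circle_homeomorphic by auto
qed

lemma homeomorphism_image_component:
  assumes C: "C \<in> components S" and h: "homeomorphism S T f g"
  shows "f ` C \<in> components T"
proof -
  have fC: "C \<noteq> {}" "C \<subseteq> S" "connected C"
    and max: "\<forall>D. D \<noteq> {} \<and> C \<subseteq> D \<and> D \<subseteq> S \<and> connected D \<longrightarrow> D = C"
    using C unfolding in_components_maximal by simp_all
  have c: "continuous_on S f" "continuous_on T g" "f ` S = T" "g ` T = S"
    "\<And>x. x \<in> S \<Longrightarrow> g (f x) = x" "\<And>y. y \<in> T \<Longrightarrow> f (g y) = y"
    using h unfolding homeomorphism_def by auto
  show ?thesis unfolding in_components_maximal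
  proof (intro conjI allI impI)
    show "f ` C \<noteq> {}" using fC(1) by simp
    show "f ` C \<subseteq> T" using fC(2) c(3) by blast
    show "connected (f ` C)"
      by (rule connected_continuous_image[OF continuous_on_subset[OF c(1) fC(2)] fC(3)])
    fix D assume D: "D \<noteq> {} \<and> f ` C \<subseteq> D \<and> D \<subseteq> T \<and> connected D"
    have "x \<in> g ` D" if "x \<in> C" for x
      using that c(5)[of x] fC(2) D by (metis image_eqI subsetD)
    then have "C \<subseteq> g ` D" by blast
    moreover have "connected (g ` D)"
      using connected_continuous_image[OF continuous_on_subset[OF c(2)], of D] D by blast
    moreover have "g ` D \<subseteq> S" "g ` D \<noteq> {}" using D c(4) by blast+
    ultimately have gD: "g ` D = C" using max by simp
    have "f ` g ` D = (\<lambda>y. y) ` D" unfolding image_image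
      by (rule image_cong) (use c(6) D in auto)
    then show "D = f ` C" using gD by simp
  qed
qed

lemma components_homeomorphism:
  assumes "homeomorphism S T f g"
  shows "components T = (`) f ` components S"
proof -
  have "C \<in> (`) f ` components S" if C: "C \<in> components T" for C
  proof -
    have "f ` g ` C = (\<lambda>y. y) ` C" unfolding image_image
      by (rule image_cong) (use homeomorphism_apply2[OF assms] in_components_subset[OF C] in auto)
    then show ?thesis using homeomorphism_image_component[OF C homeomorphism_symD[OF assms]] by (metis image_eqI image_ident)
  qed
  moreover have "C \<in> components T" if "C \<in> (`) f ` components S" for C
    using that by (rule imageE) (simp add: homeomorphism_image_component[OF _ assms])
  ultimately show ?thesis by (rule subset_antisym[OF subsetI subsetI])
qed

text \<open>The sphere is connected, so it would itself be a circle; but it is simply connected and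
  a circle is not. This guarantees a pole off the intersection.\<close>

lemma sphere_not_union_of_circles:
  assumes "components (unit_sphere :: (real^3) set) = \<C>"
    and "\<And>C. C \<in> \<C> \<Longrightarrow> C homeomorphic sphere (0::complex) 1"
  shows False
proof -
  have "connected (unit_sphere :: (real^3) set)" by (intro connected_sphere) simp
  moreover have "(unit_sphere :: (real^3) set) \<noteq> {}" by simp
  ultimately have "components (unit_sphere :: (real^3) set) = {unit_sphere}"
    by (simp add: components_eq_sing_iff)
  then have "(unit_sphere :: (real^3) set) homeomorphic sphere (0::complex) 1"
    using assms by simp
  then have "simply_connected (sphere (0::complex) 1)"
    using homeomorphic_simply_connected_eq simply_connected_sphere[of "0 :: real^3" 1] by auto
  then show False using simply_connected_sphere_eq[of "0 :: complex" 1] by simp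
qed

text \<open>A tube argument: the times at which some point of \<open>Y\<close> leaves
  \<open>V\<close> are the projection of a compact set, hence form a closed set, and
  \<open>t0\<close> is not among them. Intersecting with \<open>cball t0 1\<close> makes the time
  domain compact.\<close>

lemma eventually_compact_in_open:
  fixes \<Phi> :: "real \<times> 'a::euclidean_space \<Rightarrow> 'b::topological_space"
  assumes "continuous_on (I \<times> X) \<Phi>" "closed I" "compact Y" "Y \<subseteq> X" "open V" "t0 \<in> I"
    and "\<And>y. y \<in> Y \<Longrightarrow> \<Phi> (t0, y) \<in> V"
  shows "\<forall>\<^sub>F t in nhds t0. t \<in> I \<longrightarrow> (\<forall>y\<in>Y. \<Phi> (t, y) \<in> V)"
proof -
  let ?J = "I \<inter> cball t0 1"
  have cJ: "compact ?J" using assms(2) by (intro closed_Int_compact) auto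
  have "continuous_on (?J \<times> Y) \<Phi>" using assms(1) by (rule continuous_on_subset) (use assms(4) in auto)
  moreover have "compact (?J \<times> Y)" using cJ assms(3) by (rule compact_Times)
  ultimately have "closed ((?J \<times> Y) \<inter> \<Phi> -` (- V))"
    using assms(5) by (intro continuous_closed_preimage compact_imp_closed) auto
  then have "compact ((?J \<times> Y) \<inter> \<Phi> -` (- V))"
    using \<open>compact (?J \<times> Y)\<close> by (metis inf_assoc inf.idem closed_Int_compact inf_commute)
  then have "compact (fst ` ((?J \<times> Y) \<inter> \<Phi> -` (- V)))" (is "compact ?B")
    by (intro compact_continuous_image continuous_intros)
  then have "open (- ?B)" by (simp add: compact_imp_closed open_Compl)
  moreover have "t0 \<in> - ?B" using assms(7) by auto
  ultimately have "\<forall>\<^sub>F t in nhds t0. t \<in> - ?B" by (rule eventually_nhds_in_open)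
  moreover have "\<forall>\<^sub>F t in nhds t0. t \<in> ball t0 1" by (intro eventually_nhds_in_open) auto
  ultimately show ?thesis
  proof eventually_elim
    case (elim t)
    have "t \<in> cball t0 1" using elim(2) by auto
    show ?case
    proof (intro impI ballI, rule ccontr)
      fix y assume "t \<in> I" "y \<in> Y" "\<Phi> (t, y) \<notin> V"
      then have "(t, y) \<in> (?J \<times> Y) \<inter> \<Phi> -` (- V)" using \<open>t \<in> cball t0 1\<close> by simp
      then have "t \<in> ?B" by (metis fst_conv imageI)
      then show False using elim(1) by blast
    qed
  qed
qed

text \<open>The closure is taken in the whole space and may contain the pole. At
  \<open>emb z\<close>, however, only points near \<open>emb z\<close> matter, and there
  \<open>proj\<close> is continuous.\<close>

lemma (in stereographic) closure_emb:
  assumes "S \<subseteq> unit_sphere"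
  shows "emb z \<in> closure S \<longleftrightarrow> z \<in> closure (emb -` S)"
proof
  assume "z \<in> closure (emb -` S)"
  then have "emb z \<in> emb ` closure (emb -` S)" by blast
  also have "\<dots> \<subseteq> closure S"
    by (rule image_closure_subset) (use continuous_emb closure_subset[of S] in auto)
  finally show "emb z \<in> closure S" .
next
  assume z: "emb z \<in> closure S"
  let ?O = "{x. x \<bullet> N \<noteq> 1}"
  have "emb z \<in> ?O \<inter> closure S" using z emb_neq(1) by simp
  then have "emb z \<in> closure (?O \<inter> S)" using open_Int_closure_subset[OF open_neq] by blast
  then obtain a where a: "\<And>n. a n \<in> ?O \<inter> S" "a \<longlonglongrightarrow> emb z" unfolding closure_sequential by blast
  have "isCont proj (emb z)"
    using continuous_proj open_neq emb_neq(1)[of z] by (simp add: continuous_on_eq_continuous_at)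
  then have "(\<lambda>n. proj (a n)) \<longlonglongrightarrow> proj (emb z)" using a(2) isCont_tendsto_compose by blast
  moreover have "proj (a n) \<in> emb -` S" for n
  proof -
    have "a n \<in> unit_sphere" "a n \<noteq> N" using a(1)[of n] assms norms(1) by auto
    then show ?thesis using emb_proj[of "a n"] a(1)[of n] by simp
  qed
  ultimately show "z \<in> closure (emb -` S)"
    unfolding closure_sequential proj_emb by (intro exI[of _ "\<lambda>n. proj (a n)"]) simp
qed

subsection \<open>The moving sphere\<close>

lemma derivative_nonzero_both_signs:
  fixes g :: "real \<Rightarrow> real"
  assumes der: "DERIV g 0 :> l" and l: "l \<noteq> 0" and g0: "g 0 = 0" and ev: "\<forall>\<^sub>F s in nhds 0. Q s"
  shows "\<exists>s. Q s \<and> g s > 0" "\<exists>s. Q s \<and> g s < 0"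
proof -
  obtain d where d: "d > 0" "\<And>s. \<bar>s\<bar> < d \<Longrightarrow> Q s"
    using ev unfolding eventually_nhds_metric dist_real_def by auto
  have "\<exists>s. \<bar>s\<bar> < d \<and> g s > 0" "\<exists>s. \<bar>s\<bar> < d \<and> g s < 0"
  proof -
    have *: "(\<exists>s. \<bar>s\<bar> < d \<and> h s > 0) \<and> (\<exists>s. \<bar>s\<bar> < d \<and> h s < 0)"
      if h: "DERIV h 0 :> m" "m > 0" "h 0 = 0" for h and m :: real
    proof -
      obtain d1 where d1: "d1 > 0" "\<And>k. 0 < k \<Longrightarrow> k < d1 \<Longrightarrow> h 0 < h (0 + k)"
        using DERIV_pos_inc_right[OF h(1,2)] by auto
      obtain d2 where d2: "d2 > 0" "\<And>k. 0 < k \<Longrightarrow> k < d2 \<Longrightarrow> h (0 - k) < h 0"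
        using DERIV_pos_inc_left[OF h(1,2)] by auto
      define k where "k = min d (min d1 d2) / 2"
      have k: "0 < k" "k < d" "k < d1" "k < d2" using d(1) d1(1) d2(1) unfolding k_def by auto
      show ?thesis using d1(2)[OF k(1,3)] d2(2)[OF k(1,4)] k h(3)
        by (intro conjI exI[of _ k] exI[of _ "-k"]) auto
    qed
    have "(\<exists>s. \<bar>s\<bar> < d \<and> g s > 0) \<and> (\<exists>s. \<bar>s\<bar> < d \<and> g s < 0)"
    proof (cases "l > 0")
      case True
      then show ?thesis using *[OF der True g0] by blast
    next
      case False
      then show ?thesis using *[OF DERIV_minus[OF der]] l g0 by auto
    qed
    then show "\<exists>s. \<bar>s\<bar> < d \<and> g s > 0" "\<exists>s. \<bar>s\<bar> < d \<and> g s < 0" by blast+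
  qed
  then show "\<exists>s. Q s \<and> g s > 0" "\<exists>s. Q s \<and> g s < 0" using d(2) by blast+
qed

locale moving_sphere =
  fixes \<phi> :: "real^3 \<Rightarrow> real^3" and \<Phi> :: "real \<times> (real^3) \<Rightarrow> real^3" and \<Omega> :: "(real^3) set"
  assumes emb: "sphere_embedding \<phi>" and good: "good_family \<phi> \<Phi>"
    and \<Omega>: "\<Omega> \<in> components (- \<phi> ` unit_sphere)"
begin

definition M :: "(real^3) set" where "M = \<phi> ` unit_sphere"

definition L :: "real \<Rightarrow> (real^3) set" where "L t = {x \<in> unit_sphere. \<Phi> (t, x) \<in> M}"

definition A :: "real \<Rightarrow> (real^3) set" where "A t = {x \<in> unit_sphere. \<Phi> (t, x) \<in> \<Omega>}"

definition B :: "real \<Rightarrow> (real^3) set" where "B t = {x \<in> unit_sphere. \<Phi> (t, x) \<notin> M \<union> \<Omega>}"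

definition changing_circles :: "real \<Rightarrow> (real^3) set set" where
  "changing_circles t = {C \<in> components (L t). C \<subseteq> closure (A t) \<inter> closure (B t)}"

lemma smooth_\<Phi>: "smooth_on ({0..1} \<times> unit_sphere) \<Phi>"
  and slice_embedding: "t \<in> {0..1} \<Longrightarrow> sphere_embedding (\<lambda>x. \<Phi> (t, x))"
  and link: "t \<in> {0..1} \<Longrightarrow> is_link (M \<inter> (\<lambda>x. \<Phi> (t, x)) ` unit_sphere)"
  and trans: "transversal unit_sphere sphere_tangent \<phi> ({0..1} \<times> unit_sphere) cylinder_tangent \<Phi>"
  using good unfolding good_family_def family_of_embeddings_def M_def by auto

lemma continuous_\<Phi>: "continuous_on ({0..1} \<times> unit_sphere) \<Phi>"
  using smooth_\<Phi> by (rule smooth_on_continuous)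

lemma compact_M: "compact M"
  unfolding M_def using emb smooth_on_continuous unfolding sphere_embedding_def
  by (intro compact_continuous_image) auto

lemma open_colours: "open (- M)" "open \<Omega>" "open (- (M \<union> \<Omega>))"
proof -
  show o: "open (- M)" using compact_M by (simp add: compact_imp_closed open_Compl)
  have \<Omega>': "\<Omega> \<in> components (- M)" using \<Omega> M_def by simp
  show "open \<Omega>" by (rule open_components[OF o \<Omega>'])
  have "- (M \<union> \<Omega>) = \<Union>(components (- M) - {\<Omega>})"
  proof (intro equalityI subsetI)
    fix x assume x: "x \<in> - (M \<union> \<Omega>)"
    then have "x \<in> \<Union>(components (- M))" by simp
    then show "x \<in> \<Union>(components (- M) - {\<Omega>})" using x by blast
  next
    fix x assume "x \<in> \<Union>(components (- M) - {\<Omega>})"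
    then obtain W where W: "W \<in> components (- M)" "W \<noteq> \<Omega>" "x \<in> W" by blast
    then show "x \<in> - (M \<union> \<Omega>)"
      using components_nonoverlap[OF W(1) \<Omega>'] in_components_subset[OF W(1)] by blast
  qed
  moreover have "open (\<Union>(components (- M) - {\<Omega>}))"
    using open_components[OF o] by (intro open_Union) auto
  ultimately show "open (- (M \<union> \<Omega>))" by simp
qed

lemma M_\<Omega>_disjoint: "M \<inter> \<Omega> = {}"
  using in_components_subset[OF \<Omega>] unfolding M_def by blast

lemma components_L:
  assumes t: "t \<in> {0..1}"
  shows "finite (components (L t))" "\<And>C. C \<in> components (L t) \<Longrightarrow> C homeomorphic sphere (0::complex) 1"
proof -
  let ?f = "\<lambda>x. \<Phi> (t, x)"
  obtain g where g: "homeomorphism unit_sphere (?f ` unit_sphere) ?f g"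
    by (rule sphere_embedding_homeomorphism[OF slice_embedding[OF t]])
  have im: "?f ` L t = M \<inter> ?f ` unit_sphere" unfolding L_def by auto
  have sub: "L t \<subseteq> unit_sphere" unfolding L_def by auto
  have h: "homeomorphism (L t) (M \<inter> ?f ` unit_sphere) ?f g"
    by (rule homeomorphism_of_subsets[OF g sub subset_refl im])
  note hs = homeomorphism_symD[OF h]
  note comp = components_homeomorphism[OF hs]
  show "finite (components (L t))"
    unfolding comp using components_link(1)[OF link[OF t]] by (rule finite_imageI)
  fix C assume "C \<in> components (L t)"
  then obtain C' where C': "C' \<in> components (M \<inter> ?f ` unit_sphere)" "C = g ` C'"
    unfolding comp by (rule imageE)
  have "homeomorphism C' C g ?f"
    by (rule homeomorphism_of_subsets[OF hs in_components_subset[OF C'(1)] subset_refl]) (simp add: C'(2))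
  then have "C' homeomorphic C" unfolding homeomorphic_def by (intro exI)
  then show "C homeomorphic sphere (0::complex) 1"
    using components_link(2)[OF link[OF t] C'(1)] homeomorphic_trans homeomorphic_sym by metis
qed

text \<open>The function is \<open>F \<circ> E\<close>, with \<open>F\<close> the oriented defining
  function of the fixed sphere and \<open>E\<close> a local extension of \<open>\<Phi>\<close>. The
  derivative of \<open>F\<close> kills the tangent plane of the fixed sphere without being zero, so
  a transversal differential must contain a vector on which it does not vanish. This is used for the
  whole family at interior times and for a single transversal slice.\<close>

lemma local_function:
  assumes t0: "t0 \<in> {0..1}" and x0: "x0 \<in> L t0"
  obtains H f f' where "open H" "(t0, x0) \<in> H" "C1_on f f' H"
    "\<And>t x. t \<in> {0..1} \<Longrightarrow> x \<in> unit_sphere \<Longrightarrow> (t, x) \<in> H \<Longrightarrow> x \<in> L t \<longleftrightarrow> f (t, x) = (0::real)"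
    "\<And>t x. t \<in> {0..1} \<Longrightarrow> x \<in> unit_sphere \<Longrightarrow> (t, x) \<in> H \<Longrightarrow> f (t, x) > 0 \<Longrightarrow> x \<in> A t"
    "\<And>t x. t \<in> {0..1} \<Longrightarrow> x \<in> unit_sphere \<Longrightarrow> (t, x) \<in> H \<Longrightarrow> f (t, x) < 0 \<Longrightarrow> x \<in> B t"
    "0 < t0 \<Longrightarrow> t0 < 1 \<Longrightarrow> \<exists>v\<in>cylinder_tangent (t0, x0). f' (t0, x0) v \<noteq> 0"
    "transversal unit_sphere sphere_tangent (\<lambda>x. \<Phi> (t0, x)) unit_sphere sphere_tangent \<phi> \<Longrightarrow>
      \<exists>b\<in>sphere_tangent x0. f' (t0, x0) (0, b) \<noteq> 0"
proof -
  have xS: "x0 \<in> unit_sphere" using x0 L_def by auto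
  obtain y0 where y0: "y0 \<in> unit_sphere" "\<Phi> (t0, x0) = \<phi> y0" using x0 unfolding L_def M_def by auto
  have smooth\<phi>: "smooth_on unit_sphere \<phi>" using emb sphere_embedding_def by blast
  have D2: "2 \<le> DIM(real^3)" by simp
  obtain G F F' where G: "open G" "\<phi> y0 \<in> G" "C1_on F F' G"
    and FM: "\<And>w. w \<in> G \<Longrightarrow> w \<in> \<phi> ` unit_sphere \<longleftrightarrow> F w = (0::real)" and F'0: "F' (\<phi> y0) \<noteq> 0"
    and FP: "\<And>w. w \<in> G \<Longrightarrow> F w > 0 \<Longrightarrow> w \<in> \<Omega>" and FN: "\<And>w. w \<in> G \<Longrightarrow> F w < 0 \<Longrightarrow> w \<notin> \<Omega>"
    by (rule oriented_defining_function[OF emb y0(1) D2 \<Omega>]) (rule that)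
  have mem: "(t0, x0) \<in> {0..1} \<times> unit_sphere" using t0 xS by simp
  obtain U E E' where U: "open U" "(t0, x0) \<in> U" "C1_on E E' U"
    and UE: "\<And>y. y \<in> {0..1} \<times> unit_sphere \<Longrightarrow> y \<in> U \<Longrightarrow> E y = \<Phi> y"
    by (rule smooth_on_C1[OF smooth_\<Phi> mem]) (rule that)
  have E0: "E (t0, x0) = \<phi> y0" using UE[OF mem U(2)] y0(2) by simp
  define H where "H = U \<inter> E -` G"
  have oH: "open H" unfolding H_def by (rule continuous_open_preimage[OF C1_on_continuous[OF U(3)] U(1) G(1)])
  have H0: "(t0, x0) \<in> H" unfolding H_def using U(2) E0 G(2) by simp
  have fC: "C1_on (F \<circ> E) (\<lambda>p. F' (E p) o\<^sub>L E' p) H"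
    by (rule C1_on_compose[OF C1_on_subset[OF U(3)] G(3)]) (auto simp: H_def)
  have EH: "E (t, x) = \<Phi> (t, x)" "\<Phi> (t, x) \<in> G" if "t \<in> {0..1}" "x \<in> unit_sphere" "(t, x) \<in> H" for t x
    using UE[of "(t, x)"] that unfolding H_def by auto
  \<comment> \<open>\<open>F\<close> vanishes on the fixed sphere, so its composition with an
    extension of \<open>\<phi>\<close> is zero on the unit sphere and has zero derivative along
    tangent vectors.\<close>
  have kill: "F' (\<phi> y0) u = 0" if u: "u \<in> differential_image unit_sphere sphere_tangent \<phi> y0" for u
  proof -
    obtain v where v: "v \<in> sphere_tangent y0" "u = frechet_derivative \<phi> (at y0 within unit_sphere) v"
      using u unfolding differential_image_def by blast
    obtain V P P' where V: "open V" "y0 \<in> V" "C1_on P P' V"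
      and VP: "\<And>y. y \<in> unit_sphere \<Longrightarrow> y \<in> V \<Longrightarrow> P y = \<phi> y"
      by (rule smooth_on_C1[OF smooth\<phi> y0(1)]) (rule that)
    have uP: "u = P' y0 v"
      unfolding v(2) by (rule frechet_derivative_on_velocity[OF V(1,2) y0(1) C1_on_derivative[OF V(3,2)] VP
            velocity_sphere[OF y0(1) v(1)]])
    have P0: "P y0 = \<phi> y0" using VP y0(1) V(2) by blast
    define V' where "V' = V \<inter> P -` G"
    have oV': "open V'" unfolding V'_def by (rule continuous_open_preimage[OF C1_on_continuous[OF V(3)] V(1) G(1)])
    have V'0: "y0 \<in> V'" unfolding V'_def using V(2) P0 G(2) by simp
    have PC: "C1_on (F \<circ> P) (\<lambda>p. F' (P p) o\<^sub>L P' p) V'"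
      by (rule C1_on_compose[OF C1_on_subset[OF V(3)] G(3)]) (auto simp: V'_def)
    have zero: "(F \<circ> P) y = 0" if "y \<in> unit_sphere" "y \<in> V'" for y
      using FM[of "P y"] VP[of y] that unfolding V'_def by auto
    have "((\<lambda>y. 0) has_derivative blinfun_apply (F' (P y0) o\<^sub>L P' y0)) (at y0 within unit_sphere)"
      by (rule has_derivative_restrict[OF oV' V'0 y0(1) C1_on_derivative[OF PC V'0]]) (use zero in auto)
    from derivative_unique_on_velocity[OF velocity_sphere[OF y0(1) v(1)] this has_derivative_const]
    show ?thesis unfolding uP P0 by simp
  qed
  obtain w where w: "F' (\<phi> y0) w \<noteq> 0"
    using F'0 by (metis blinfun_eqI blinfun.zero_left)
  have app: "(F' (E (t0, x0)) o\<^sub>L E' (t0, x0)) v = F' (\<phi> y0) (E' (t0, x0) v)" for v by (simp add: E0)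
  show thesis
  proof (rule that[OF oH H0 fC])
    fix t x assume tx: "t \<in> {0..1}" "x \<in> unit_sphere" "(t, x) \<in> H"
    show "x \<in> L t \<longleftrightarrow> (F \<circ> E) (t, x) = 0"
      using FM[OF EH(2)[OF tx]] EH(1)[OF tx] tx(2) unfolding L_def M_def by simp
    show "x \<in> A t" if "(F \<circ> E) (t, x) > 0"
      using FP[OF EH(2)[OF tx]] EH(1)[OF tx] tx(2) that unfolding A_def by simp
    show "x \<in> B t" if "(F \<circ> E) (t, x) < 0"
      using FN[OF EH(2)[OF tx]] FM[OF EH(2)[OF tx]] EH(1)[OF tx] tx(2) that unfolding B_def M_def by auto
  next
    assume t01: "0 < t0" "t0 < 1"
    have "{u + v |u v. u \<in> differential_image unit_sphere sphere_tangent \<phi> y0 \<and>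
        v \<in> differential_image ({0..1} \<times> unit_sphere) cylinder_tangent \<Phi> (t0, x0)} = UNIV"
      by (rule trans[unfolded transversal_def, rule_format, OF y0(1) mem y0(2)[symmetric]])
    then obtain u v where uv: "w = u + v" "u \<in> differential_image unit_sphere sphere_tangent \<phi> y0"
      "v \<in> differential_image ({0..1} \<times> unit_sphere) cylinder_tangent \<Phi> (t0, x0)" by blast
    obtain b where b: "b \<in> cylinder_tangent (t0, x0)"
      "v = frechet_derivative \<Phi> (at (t0, x0) within {0..1} \<times> unit_sphere) b"
      using uv(3) unfolding differential_image_def by blast
    have "v = E' (t0, x0) b"
      unfolding b(2) by (rule frechet_derivative_on_velocity[OF U(1,2) mem C1_on_derivative[OF U(3,2)] UE
            velocity_cylinder[OF t01 xS b(1)]])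
    moreover have "F' (\<phi> y0) v \<noteq> 0" using w kill[OF uv(2)] unfolding uv(1) by (simp add: blinfun.add_right)
    ultimately show "\<exists>v\<in>cylinder_tangent (t0, x0). (F' (E (t0, x0)) o\<^sub>L E' (t0, x0)) v \<noteq> 0"
      using b(1) app by auto
  next
    assume tr: "transversal unit_sphere sphere_tangent (\<lambda>x. \<Phi> (t0, x)) unit_sphere sphere_tangent \<phi>"
    have "{u + v |u v. u \<in> differential_image unit_sphere sphere_tangent (\<lambda>x. \<Phi> (t0, x)) x0 \<and>
        v \<in> differential_image unit_sphere sphere_tangent \<phi> y0} = UNIV"
      by (rule tr[unfolded transversal_def, rule_format, OF xS y0(1) y0(2)])
    then obtain u v where uv: "w = u + v" "u \<in> differential_image unit_sphere sphere_tangent (\<lambda>x. \<Phi> (t0, x)) x0"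
      "v \<in> differential_image unit_sphere sphere_tangent \<phi> y0" by blast
    obtain b where b: "b \<in> sphere_tangent x0"
      "u = frechet_derivative (\<lambda>x. \<Phi> (t0, x)) (at x0 within unit_sphere) b"
      using uv(2) unfolding differential_image_def by blast
    have o: "open ((\<lambda>x. (t0, x)) -` U)" using U(1) by (intro open_vimage continuous_intros) auto
    have "((\<lambda>x. (t0, x)) has_derivative (\<lambda>b. (0, b))) (at x0)" by (auto intro!: derivative_eq_intros)
    from diff_chain_at[OF this C1_on_derivative[OF U(3,2)]]
    have d: "((\<lambda>x. E (t0, x)) has_derivative (\<lambda>b. E' (t0, x0) (0, b))) (at x0)" by (simp add: o_def)
    have "u = E' (t0, x0) (0, b)" unfolding b(2)
      by (rule frechet_derivative_on_velocity[OF o _ xS d _ velocity_sphere[OF xS b(1)]])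
         (use U(2) UE t0 in auto)
    moreover have "F' (\<phi> y0) u \<noteq> 0" using w kill[OF uv(3)] unfolding uv(1) by (simp add: blinfun.add_right)
    ultimately show "\<exists>b\<in>sphere_tangent x0. (F' (E (t0, x0)) o\<^sub>L E' (t0, x0)) (0, b) \<noteq> 0"
      using b(1) app by auto
  qed
qed

text \<open>Along a curve in the sphere on which the local function has nonzero derivative, it takes
  both signs arbitrarily close to \<open>x0\<close>, and the signs are the colours.\<close>

lemma L_in_both_closures:
  assumes t0: "t0 \<in> {0..1}" and x0: "x0 \<in> L t0"
    and tr: "transversal unit_sphere sphere_tangent (\<lambda>x. \<Phi> (t0, x)) unit_sphere sphere_tangent \<phi>"
  shows "x0 \<in> closure (A t0) \<inter> closure (B t0)"
proof -
  have xS: "x0 \<in> unit_sphere" using x0 L_def by auto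
  obtain H f f' where H: "open H" "(t0, x0) \<in> H" "C1_on f f' H"
    and fL: "\<And>t x. t \<in> {0..1} \<Longrightarrow> x \<in> unit_sphere \<Longrightarrow> (t, x) \<in> H \<Longrightarrow> x \<in> L t \<longleftrightarrow> f (t, x) = (0::real)"
    and fA: "\<And>t x. t \<in> {0..1} \<Longrightarrow> x \<in> unit_sphere \<Longrightarrow> (t, x) \<in> H \<Longrightarrow> f (t, x) > 0 \<Longrightarrow> x \<in> A t"
    and fB: "\<And>t x. t \<in> {0..1} \<Longrightarrow> x \<in> unit_sphere \<Longrightarrow> (t, x) \<in> H \<Longrightarrow> f (t, x) < 0 \<Longrightarrow> x \<in> B t"
    and nz: "transversal unit_sphere sphere_tangent (\<lambda>x. \<Phi> (t0, x)) unit_sphere sphere_tangent \<phi> \<Longrightarrow>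
      \<exists>b\<in>sphere_tangent x0. f' (t0, x0) (0, b) \<noteq> 0"
    by (rule local_function[OF t0 x0]) (rule that)
  obtain b where b: "b \<in> sphere_tangent x0" "f' (t0, x0) (0, b) \<noteq> 0" using nz[OF tr] by blast
  obtain c where c: "c (0::real) = x0" "(c has_derivative (\<lambda>s. s *\<^sub>R b)) (at 0)"
    "\<forall>\<^sub>F s in nhds 0. c s \<in> unit_sphere"
    using velocity_sphere[OF xS b(1)] unfolding velocity_def by blast
  have tc: "(c \<longlongrightarrow> x0) (nhds 0)"
    using has_derivative_continuous[OF c(2)] tendsto_at_iff_tendsto_nhds[of c 0] c(1) by (simp add: isCont_def)
  have d: "((\<lambda>s. (t0, c s)) has_derivative (\<lambda>s. s *\<^sub>R (0, b))) (at 0)"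
    by (auto intro!: derivative_eq_intros c(2) simp: fun_eq_iff)
  have "(f has_derivative blinfun_apply (f' (t0, x0))) (at (t0, c 0))"
    using C1_on_derivative[OF H(3,2)] c(1) by simp
  from diff_chain_at[OF d this]
  have "((\<lambda>s. f (t0, c s)) has_derivative (\<lambda>s. s * f' (t0, x0) (0, b))) (at 0)"
    by (simp add: o_def blinfun.scaleR_right del: scaleR_Pair)
  then have der: "DERIV (\<lambda>s. f (t0, c s)) 0 :> f' (t0, x0) (0, b)"
    by (rule has_derivative_imp_has_field_derivative) simp
  have f0: "f (t0, c 0) = 0" using fL[OF t0 xS H(2)] x0 c(1) by simp
  have "\<exists>y\<in>A t0. dist y x0 < e" "\<exists>y\<in>B t0. dist y x0 < e" if "e > 0" for e
  proof -
    have "\<forall>\<^sub>F s in nhds 0. dist (c s) x0 < e" using tendstoD[OF tc that] .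
    moreover have "((\<lambda>s. (t0, c s)) \<longlongrightarrow> (t0, x0)) (nhds 0)" by (intro tendsto_intros tc)
    then have "\<forall>\<^sub>F s in nhds 0. (t0, c s) \<in> H" using H(1,2) by (rule topological_tendstoD)
    ultimately have ev: "\<forall>\<^sub>F s in nhds 0. dist (c s) x0 < e \<and> (t0, c s) \<in> H \<and> c s \<in> unit_sphere"
      using c(3) by eventually_elim simp
    show "\<exists>y\<in>A t0. dist y x0 < e"
      using derivative_nonzero_both_signs(1)[OF der b(2) f0 ev] fA[OF t0] by blast
    show "\<exists>y\<in>B t0. dist y x0 < e"
      using derivative_nonzero_both_signs(2)[OF der b(2) f0 ev] fB[OF t0] by blast
  qed
  then show ?thesis unfolding Int_iff closure_approachable by blast
qed

lemma L_proper:
  assumes t: "t \<in> {0..1}"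
  obtains N where "N \<in> unit_sphere" "N \<notin> L t"
proof -
  have "L t \<noteq> unit_sphere"
    using sphere_not_union_of_circles[OF refl] components_L(2)[OF t] by metis
  then show thesis using that unfolding L_def by blast
qed

end

section \<open>Transfer of the parity argument from the plane to the sphere\<close>

context moving_sphere
begin

text \<open>In the chart with a pole off \<open>L t0\<close> the intersections form a
  \<open>curve_family\<close>. The assumption \<open>tr\<close> supplies, at each intersection
  point, one of the two local pictures: a transversal slice gives a persistent arc, and at an
  interior time the differential of the family gives a persistent arc or sweeping.\<close>

lemma parity_locally_constant:
  assumes t0: "t0 \<in> {0..1}"
    and tr: "L t0 \<noteq> {} \<Longrightarrow> 0 < t0 \<and> t0 < 1 \<or>
      transversal unit_sphere sphere_tangent (\<lambda>x. \<Phi> (t0, x)) unit_sphere sphere_tangent \<phi>"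
  shows "\<forall>\<^sub>F t in nhds t0. t \<in> {0..1} \<longrightarrow>
    (odd (card (changing_circles t)) \<longleftrightarrow> odd (card (changing_circles t0)))"
proof -
  obtain N where N: "N \<in> unit_sphere" "N \<notin> L t0" by (rule L_proper[OF t0])
  obtain e1 e2 where "stereographic N e1 e2" by (rule ex_stereographic[OF N(1)])
  then interpret st: stereographic N e1 e2 .
  \<comment> \<open>At these times all curves are visible in the chart. By \<open>evT\<close> they
    include all times of the interval close to \<open>t0\<close>.\<close>
  define T where "T = {t \<in> {0..1}. N \<notin> L t}"
  define Z where "Z t = st.emb -` L t" for t
  define A' where "A' t = st.emb -` A t" for t
  define B' where "B' t = st.emb -` B t" for t
  note eS = st.emb_in_sphere
  have T: "t \<in> {0..1}" "N \<notin> L t" if "t \<in> T" for t using that T_def by auto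
  have t0T: "t0 \<in> T" using t0 N T_def by simp
  have eventually_stays: "\<forall>\<^sub>F t in nhds t0. t \<in> {0..1} \<longrightarrow> (\<forall>y\<in>Y. \<Phi> (t, y) \<in> V)"
    if "compact Y" "Y \<subseteq> unit_sphere" "open V" "\<And>y. y \<in> Y \<Longrightarrow> \<Phi> (t0, y) \<in> V" for Y V
    by (rule eventually_compact_in_open[OF continuous_\<Phi> closed_atLeastAtMost that(1-3) t0 that(4)])
  have "\<forall>\<^sub>F t in nhds t0. t \<in> {0..1} \<longrightarrow> (\<forall>y\<in>{N}. \<Phi> (t, y) \<in> - M)"
    by (rule eventually_stays) (use N open_colours(1) in \<open>auto simp: L_def\<close>)
  then have evT: "\<forall>\<^sub>F t in nhds t0. t \<in> {0..1} \<longrightarrow> t \<in> T"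
    by eventually_elim (auto simp: T_def L_def)
  have emb_Z: "st.emb ` Z t = L t" if t: "t \<in> T" for t
  proof (intro equalityI subsetI)
    fix x assume x: "x \<in> L t"
    then have "x \<in> unit_sphere" "x \<noteq> N" using T(2)[OF t] L_def by auto
    then have "st.emb (st.proj x) = x" by (rule st.emb_proj)
    then show "x \<in> st.emb ` Z t" unfolding Z_def using x by (intro image_eqI[of _ _ "st.proj x"]) simp_all
  qed (auto simp: Z_def)
  have hom: "homeomorphism (Z t) (L t) st.emb st.proj" if t: "t \<in> T" for t
  proof (rule homeomorphism_of_subsets[OF st.homeomorphism_emb subset_UNIV _ emb_Z[OF t]])
    show "L t \<subseteq> unit_sphere - {N}" using T(2)[OF t] L_def by auto
  qed
  have cont: "continuous_on UNIV (\<lambda>z. \<Phi> (t, st.emb z))" if "t \<in> {0..1}" for t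
    by (rule continuous_on_compose2[OF continuous_\<Phi>])
       (use that eS in \<open>auto intro!: continuous_intros st.continuous_emb\<close>)
  have Z_iff: "z \<in> Z t \<longleftrightarrow> \<Phi> (t, st.emb z) \<in> M" for z t
    unfolding Z_def L_def using eS[of z] by simp
  have A_iff: "z \<in> A' t \<longleftrightarrow> \<Phi> (t, st.emb z) \<in> \<Omega>" for z t
    unfolding A'_def A_def using eS[of z] by simp
  have B_iff: "z \<in> B' t \<longleftrightarrow> \<Phi> (t, st.emb z) \<in> - (M \<union> \<Omega>)" for z t
    unfolding B'_def B_def using eS[of z] by simp
  have TE: "\<forall>\<^sub>F t in nhds t0. t \<in> {0..1} \<longrightarrow> P t \<Longrightarrow> \<forall>\<^sub>F t in nhds t0. t \<in> T \<longrightarrow> P t" for P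
    by (erule eventually_mono) (use T(1) in blast)
  have persist: "\<forall>\<^sub>F t in nhds t0. t \<in> T \<longrightarrow> \<Phi> (t, st.emb x) \<in> V"
    if "open V" "\<Phi> (t0, st.emb x) \<in> V" for x V
  proof (rule TE)
    show "\<forall>\<^sub>F t in nhds t0. t \<in> {0..1} \<longrightarrow> \<Phi> (t, st.emb x) \<in> V"
      using eventually_stays[of "{st.emb x}" V] that eS[of x] by simp
  qed
  interpret cf: curve_family T t0 Z A' B'
  proof
    show "t0 \<in> T" by fact
    fix t assume t: "t \<in> T"
    note comp = components_homeomorphism[OF homeomorphism_symD[OF hom[OF t]]]
    show "finite (components (Z t))"
      unfolding comp using components_L(1)[OF T(1)[OF t]] by (rule finite_imageI)
    show "open (A' t)"
      using open_vimage[OF open_colours(2) cont[OF T(1)[OF t]]] by (simp add: vimage_def A_iff[symmetric])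
    show "open (B' t)"
      using open_vimage[OF open_colours(3) cont[OF T(1)[OF t]]] by (simp only: vimage_def B_iff[symmetric] Collect_mem_eq)
    show "A' t \<inter> B' t = {}" using A_iff B_iff by blast
    show "A' t \<union> B' t = - Z t" using A_iff B_iff Z_iff M_\<Omega>_disjoint by blast
    fix C assume C: "C \<in> components (Z t)"
    have "homeomorphism C (st.emb ` C) st.emb st.proj"
      by (rule homeomorphism_of_subsets[OF hom[OF t] in_components_subset[OF C] subset_refl refl])
    then have "C homeomorphic st.emb ` C" unfolding homeomorphic_def by (intro exI)
    moreover have "st.emb ` C homeomorphic sphere (0::complex) 1"
      by (rule components_L(2)[OF T(1)[OF t] homeomorphism_image_component[OF C hom[OF t]]])
    ultimately show "jordan C" by (intro jordan_if_homeomorphic_circle) (rule homeomorphic_trans)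
  next
    fix V assume V: "open V" "Z t0 \<subseteq> V"
    \<comment> \<open>The pole is not in \<open>?W\<close>. Keeping the image of the complement of
      \<open>?W\<close> off \<open>M\<close> therefore also prevents \<open>Z t\<close> from
      escaping to infinity in the chart.\<close>
    let ?W = "{x. x \<bullet> N \<noteq> 1} \<inter> st.proj -` V"
    have oW: "open ?W" by (rule continuous_open_preimage[OF st.continuous_proj st.open_neq V(1)])
    have "\<forall>\<^sub>F t in nhds t0. t \<in> {0..1} \<longrightarrow> (\<forall>y\<in>unit_sphere - ?W. \<Phi> (t, y) \<in> - M)"
    proof (rule eventually_stays)
      show "compact (unit_sphere - ?W)" using oW by (intro compact_diff) auto
      fix y assume y: "y \<in> unit_sphere - ?W"
      show "\<Phi> (t0, y) \<in> - M"
      proof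
        assume "\<Phi> (t0, y) \<in> M"
        then have "y \<in> L t0" using y unfolding L_def by simp
        then have "y \<noteq> N" using N(2) by blast
        have e: "st.emb (st.proj y) = y" by (rule st.emb_proj) (use y \<open>y \<noteq> N\<close> in auto)
        then have "st.proj y \<in> V" using V(2) \<open>y \<in> L t0\<close> unfolding Z_def by auto
        then show False using y st.sphere_neq[of y] \<open>y \<noteq> N\<close> by auto
      qed
    qed (use open_colours(1) in auto)
    then have "\<forall>\<^sub>F t in nhds t0. t \<in> {0..1} \<longrightarrow> Z t \<subseteq> V"
    proof eventually_elim
      case (elim t)
      show ?case
      proof (intro impI subsetI)
        fix z assume "t \<in> {0..1}" "z \<in> Z t"
        then have "st.emb z \<in> ?W" using elim eS[of z] Z_iff[of z t] by blast
        then show "z \<in> V" by simp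
      qed
    qed
    then show "\<forall>\<^sub>F t in nhds t0. t \<in> T \<longrightarrow> Z t \<subseteq> V" by (rule TE)
  next
    fix x assume "x \<in> A' t0"
    then show "\<forall>\<^sub>F t in nhds t0. t \<in> T \<longrightarrow> x \<in> A' t"
      unfolding A_iff by (rule persist[OF open_colours(2)])
  next
    fix x assume "x \<in> B' t0"
    then show "\<forall>\<^sub>F t in nhds t0. t \<in> T \<longrightarrow> x \<in> B' t"
      unfolding B_iff by (rule persist[OF open_colours(3)])
  qed
  have types: "cf.persistent_at y \<or> cf.sweeping_at y" if y: "y \<in> Z t0" for y
  proof -
    let ?x = "st.emb y"
    have xL: "?x \<in> L t0" using y Z_def by auto
    obtain H f f' where H: "open H" "(t0, ?x) \<in> H" "C1_on f f' H"
      and fL: "\<And>t x. t \<in> {0..1} \<Longrightarrow> x \<in> unit_sphere \<Longrightarrow> (t, x) \<in> H \<Longrightarrow> x \<in> L t \<longleftrightarrow> f (t, x) = (0::real)"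
      and nz1: "0 < t0 \<Longrightarrow> t0 < 1 \<Longrightarrow> \<exists>v\<in>cylinder_tangent (t0, ?x). f' (t0, ?x) v \<noteq> 0"
      and nz2: "transversal unit_sphere sphere_tangent (\<lambda>x. \<Phi> (t0, x)) unit_sphere sphere_tangent \<phi> \<Longrightarrow>
        \<exists>b\<in>sphere_tangent ?x. f' (t0, ?x) (0, b) \<noteq> 0"
      by (rule local_function[OF t0 xL]) (rule that)
    define E where "E p = (fst p, st.emb (snd p))" for p :: "real \<times> complex"
    have dE: "(E has_derivative (\<lambda>q. (fst q, st.emb_deriv (snd p) (snd q)))) (at p)" for p
    proof -
      have "(snd has_derivative snd) (at p)" by (auto intro!: derivative_eq_intros)
      from diff_chain_at[OF this st.emb_has_derivative]
      have "((\<lambda>p. st.emb (snd p)) has_derivative (\<lambda>q. st.emb_deriv (snd p) (snd q))) (at p)" by (simp add: o_def)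
      then show ?thesis unfolding E_def[abs_def] by (auto intro!: derivative_eq_intros)
    qed
    have cE: "continuous_on UNIV (\<lambda>p. (fst q, st.emb_deriv (snd p) (snd q)))" for q :: "real \<times> complex"
    proof -
      have "continuous_on UNIV (\<lambda>z. Blinfun (st.emb_deriv z) (snd q))"
        using st.emb_C1(1) unfolding C1_on_def by (intro continuous_intros) auto
      then have "continuous_on UNIV (\<lambda>z. st.emb_deriv z (snd q))" unfolding st.emb_C1(2) .
      then have "continuous_on UNIV (\<lambda>p. st.emb_deriv (snd p) (snd q))"
        by (rule continuous_on_compose2) (auto intro!: continuous_intros)
      then show ?thesis by (intro continuous_intros)
    qed
    note EC = C1_onI[of UNIV, OF dE cE]
    define E' where "E' p = Blinfun (\<lambda>(q :: real \<times> complex). (fst q, st.emb_deriv (snd p) (snd q)))" for p :: "real \<times> complex"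
    have EC1: "C1_on E E' UNIV" using EC(1) unfolding E'_def .
    have E'_apply: "E' p q = (fst q, st.emb_deriv (snd p) (snd q))" for p q
      using EC(2) unfolding E'_def by simp
    define g where "g = f \<circ> E"
    define g' where "g' p = f' (E p) o\<^sub>L E' p" for p
    define K where "K = E -` H"
    have oK: "open K" unfolding K_def by (rule open_vimage[OF H(1) C1_on_continuous[OF EC1]])
    have K0: "(t0, y) \<in> K" unfolding K_def E_def using H(2) by simp
    have gC: "C1_on g g' K" unfolding g_def g'_def[abs_def]
      by (rule C1_on_compose[OF C1_on_subset[OF EC1 subset_UNIV] H(3)]) (auto simp: K_def)
    have gZ: "z \<in> Z t \<longleftrightarrow> g (t, z) = 0" if "t \<in> T" "(t, z) \<in> K" for t z
      using fL[OF T(1)[OF that(1)] eS[of z]] that(2) unfolding Z_def g_def K_def E_def by simp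
    have g0: "g (t0, y) = 0" using gZ[OF t0T K0] y by simp
    have g'_apply: "g' (t0, y) (a, w) = f' (t0, ?x) (a, st.emb_deriv y w)" for a w
      unfolding g'_def by (simp add: E'_apply E_def)
    have "cf.persistent_at y" if nz: "g' (t0, y) (0, w) \<noteq> 0" for w
    proof -
      obtain N u v \<eta> where N: "open N" "connected N" "y \<in> N" "u \<in> N" "v \<in> N" "\<eta> > 0" "ball t0 \<eta> \<times> N \<subseteq> K"
        and c0: "\<And>t. t \<in> ball t0 \<eta> \<Longrightarrow> connected {z\<in>N. g (t, z) = 0}"
        and cP: "\<And>t. t \<in> ball t0 \<eta> \<Longrightarrow> connected {z\<in>N. g (t, z) > 0} \<and> g (t, u) > 0"
        and cQ: "\<And>t. t \<in> ball t0 \<eta> \<Longrightarrow> connected {z\<in>N. g (t, z) < 0} \<and> g (t, v) < 0"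
        by (rule persistent_analytic[OF gC oK K0 g0 nz]) (rule that)
      have "cf.crosses_box N u v t" if t: "t \<in> ball t0 \<eta>" "t \<in> T" for t
      proof -
        have iff: "z \<in> Z t \<longleftrightarrow> g (t, z) = 0" if "z \<in> N" for z
          using gZ[OF t(2)] N(7) t(1) that by blast
        have "Z t \<inter> N = {z\<in>N. g (t, z) = 0}" using iff by blast
        moreover have "N - Z t = {z\<in>N. g (t, z) > 0} \<union> {z\<in>N. g (t, z) < 0}"
          using iff by (auto simp: neq_iff)
        ultimately show ?thesis unfolding cf.crosses_box_def using c0[OF t(1)] cP[OF t(1)] cQ[OF t(1)] N(4,5)
          by (intro conjI exI[of _ "{z\<in>N. g (t, z) > 0}"] exI[of _ "{z\<in>N. g (t, z) < 0}"]) auto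
      qed
      moreover have "\<forall>\<^sub>F t in nhds t0. t \<in> ball t0 \<eta>" using N(6) by (intro eventually_nhds_in_open) auto
      ultimately have "\<forall>\<^sub>F t in nhds t0. t \<in> T \<longrightarrow> cf.crosses_box N u v t"
        by (auto elim!: eventually_mono)
      then show ?thesis unfolding cf.persistent_at_def using N(1-3) by blast
    qed
    moreover have "cf.sweeping_at y" if nz: "g' (t0, y) (1, 0) \<noteq> 0" and t01: "0 < t0" "t0 < 1"
    proof -
      note sw = sweeping_analytic[OF gC oK K0 g0 nz]
      \<comment> \<open>A zero of \<open>g\<close> at time \<open>t\<close> is an intersection point
        only if \<open>t\<close> belongs to \<open>T\<close>, so a full interval about
        \<open>t0\<close> has to lie in \<open>T\<close>; here \<open>t0\<close> must be
        interior.\<close>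
      have "\<forall>\<^sub>F t in nhds t0. t \<in> {0<..<1}" using t01 by (intro eventually_nhds_in_open) auto
      with evT have "\<forall>\<^sub>F t in nhds t0. t \<in> T" by eventually_elim auto
      then obtain d where d: "d > 0" "\<And>t. dist t t0 < d \<Longrightarrow> t \<in> T" unfolding eventually_nhds_metric by blast
      then have dT: "ball t0 d \<subseteq> T" by (auto simp: dist_commute)
      obtain e N where e: "e > 0" "open N" "y \<in> N" "ball t0 e \<times> N \<subseteq> K"
        and uniq: "\<forall>x\<in>N. \<forall>t\<in>ball t0 e. \<forall>t'\<in>ball t0 e. g (t, x) = 0 \<longrightarrow> g (t', x) = 0 \<longrightarrow> t = t'"
        using sw(1) by blast
      have gZ': "x \<in> Z t \<longleftrightarrow> g (t, x) = 0" if "x \<in> N" "t \<in> T \<inter> ball t0 e" for x t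
        using gZ[of t x] e(4) that by blast
      have "\<forall>x\<in>N. \<forall>t\<in>T \<inter> ball t0 e. \<forall>t'\<in>T \<inter> ball t0 e. x \<in> Z t \<longrightarrow> x \<in> Z t' \<longrightarrow> t = t'"
        using uniq gZ' by blast
      then have 1: "\<exists>e>0. \<exists>N. open N \<and> y \<in> N \<and>
          (\<forall>x\<in>N. \<forall>t\<in>T \<inter> ball t0 e. \<forall>t'\<in>T \<inter> ball t0 e. x \<in> Z t \<longrightarrow> x \<in> Z t' \<longrightarrow> t = t')"
        using e(1-3) by (intro exI[of _ e] conjI exI[of _ N])
      have 2: "\<exists>N. open N \<and> y \<in> N \<and> (\<forall>x\<in>N. \<exists>t\<in>T \<inter> ball t0 e. x \<in> Z t)" if "e > 0" for e
      proof -
        have "min e d > 0" using that d(1) by simp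
        then obtain N where N: "open N" "y \<in> N" "\<forall>x\<in>N. \<exists>t\<in>ball t0 (min e d). (t, x) \<in> K \<and> g (t, x) = 0"
          using sw(2) by blast
        have "\<exists>t\<in>T \<inter> ball t0 e. x \<in> Z t" if x: "x \<in> N" for x
        proof -
          obtain t where t: "t \<in> ball t0 (min e d)" "(t, x) \<in> K" "g (t, x) = 0" using N(3) x by blast
          then have "t \<in> T" "t \<in> ball t0 e" using dT by auto
          then show ?thesis using gZ[OF _ t(2)] t(3) by blast
        qed
        then show ?thesis using N(1,2) by blast
      qed
      show ?thesis unfolding cf.sweeping_at_def using 1 2 by simp
    qed
    \<comment> \<open>At an interior time the differential is nonzero on some tangent vector, hence,
      by linearity, on its time part or on its space part. At an end of the interval the slice is
      transversal, which gives the space part directly.\<close>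
    moreover have "(\<exists>w. g' (t0, y) (0, w) \<noteq> 0) \<or> g' (t0, y) (1, 0) \<noteq> 0 \<and> 0 < t0 \<and> t0 < 1"
    proof (cases "0 < t0 \<and> t0 < 1")
      case True
      then obtain v where v: "v \<in> cylinder_tangent (t0, ?x)" "f' (t0, ?x) v \<noteq> 0" using nz1 by blast
      have "snd v \<in> sphere_tangent ?x" using v(1) by (auto simp: cylinder_tangent_def)
      then obtain w where w: "st.emb_deriv y w = snd v" by (rule st.emb_deriv_surj_tangent)
      have "g' (t0, y) (fst v, w) \<noteq> 0" unfolding g'_apply w using v(2) by simp
      moreover have "(fst v, w) = fst v *\<^sub>R (1, 0) + (0, w)" by simp
      ultimately have "fst v * g' (t0, y) (1, 0) + g' (t0, y) (0, w) \<noteq> 0"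
        by (metis blinfun.add_right blinfun.scaleR_right real_scaleR_def)
      then show ?thesis using True by auto
    next
      case False
      then obtain b where b: "b \<in> sphere_tangent ?x" "f' (t0, ?x) (0, b) \<noteq> 0" using nz2 tr xL by blast
      obtain w where w: "st.emb_deriv y w = b" using b(1) by (rule st.emb_deriv_surj_tangent)
      then show ?thesis using b(2) g'_apply by metis
    qed
    ultimately show ?thesis by blast
  qed
  have card_eq: "card (cf.changing t) = card (changing_circles t)" if t: "t \<in> T" for t
  proof -
    have "A t \<subseteq> unit_sphere" "B t \<subseteq> unit_sphere" unfolding A_def B_def by auto
    then have "st.emb z \<in> closure (A t) \<inter> closure (B t) \<longleftrightarrow> z \<in> closure (A' t) \<inter> closure (B' t)" for z
      unfolding A'_def B'_def using st.closure_emb by blast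
    then have cl: "st.emb ` C \<subseteq> closure (A t) \<inter> closure (B t) \<longleftrightarrow> C \<subseteq> closure (A' t) \<inter> closure (B' t)" for C
      by (simp only: image_subset_iff subset_eq[of C])
    have "changing_circles t = (`) st.emb ` cf.changing t"
      unfolding changing_circles_def cf.changing_def components_homeomorphism[OF hom[OF t]]
        Compr_image_eq cl ..
    moreover have "inj_on ((`) st.emb) (cf.changing t)"
      by (intro inj_onI) (simp add: inj_image_eq_iff[OF inj_on_inverseI[of UNIV st.proj st.emb]])
    ultimately show ?thesis by (simp add: card_image)
  qed
  have "\<forall>\<^sub>F t in nhds t0. t \<in> T \<longrightarrow> (odd (card (cf.changing t)) \<longleftrightarrow> odd (card (cf.changing t0)))"
    by (rule cf.changing_parity_locally_constant[OF types])
  with evT show ?thesis by eventually_elim (use card_eq t0T in auto)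
qed

end

section \<open>Conclusion: constancy of the parity along the time interval\<close>

theorem theorem1:
  fixes \<phi> :: "real^3 \<Rightarrow> real^3"
    and \<Phi> :: "real \<times> (real^3) \<Rightarrow> real^3"
    and \<nu> :: "real^3 \<Rightarrow> real^3"
    and \<mu> :: "real \<Rightarrow> real^3 \<Rightarrow> real^3"
  assumes "sphere_embedding \<phi>"
    and "good_family \<phi> \<Phi>"
    and "normal_orientation \<phi> \<nu>"
    and "\<forall>t\<in>{0..1}. normal_orientation (\<lambda>x. \<Phi> (t, x)) (\<mu> t)"
    and "transversal unit_sphere sphere_tangent (\<lambda>x. \<Phi> (0, x)) unit_sphere sphere_tangent \<phi>"
    and "embedded_circle ((\<lambda>x. \<Phi> (0, x)) ` unit_sphere \<inter> \<phi> ` unit_sphere)"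
  shows "(\<lambda>x. \<Phi> (1, x)) ` unit_sphere \<inter> \<phi> ` unit_sphere \<noteq> {}"
proof
  assume disjoint: "(\<lambda>x. \<Phi> (1, x)) ` unit_sphere \<inter> \<phi> ` unit_sphere = {}"
  obtain k where k: "homeomorphism unit_sphere (\<phi> ` unit_sphere) \<phi> k"
    by (rule sphere_embedding_homeomorphism[OF assms(1)])
  have "\<phi> ` unit_sphere homeomorphic (unit_sphere :: (real^3) set)"
    unfolding homeomorphic_def using homeomorphism_symD[OF k] by (intro exI)
  \<comment> \<open>A disconnected complement is in particular nonempty, which provides a component
    for the colouring.\<close>
  then have "\<not> connected (- \<phi> ` unit_sphere)" using Jordan_Brouwer_separation zero_less_one by blast
  then have "components (- \<phi> ` unit_sphere) \<noteq> {}" by (auto simp: components_eq_empty)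
  then obtain \<Omega> where "\<Omega> \<in> components (- \<phi> ` unit_sphere)" by blast
  then interpret moving_sphere \<phi> \<Phi> \<Omega> using assms(1,2) by unfold_locales
  have "\<Phi> (1, x) \<notin> \<phi> ` unit_sphere" if "x \<in> unit_sphere" for x using disjoint that by blast
  then have L1: "L 1 = {}" unfolding L_def M_def by blast
  let ?P = "\<lambda>t. odd (card (changing_circles t))"
  \<comment> \<open>Interior times rely on transversality of the family, time 0 on the assumed
    transversality of the slice, and at time 1 there is no intersection point to examine.\<close>
  have loc: "\<forall>\<^sub>F t in nhds a. t \<in> {0..1} \<longrightarrow> (?P t \<longleftrightarrow> ?P a)" if a: "a \<in> {0..1}" for a
  proof (rule parity_locally_constant[OF a])
    assume "L a \<noteq> {}"
    then have "a \<noteq> 1" using L1 by auto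
    then show "0 < a \<and> a < 1 \<or>
      transversal unit_sphere sphere_tangent (\<lambda>x. \<Phi> (a, x)) unit_sphere sphere_tangent \<phi>"
      using a assms(5) by (cases "a = 0") auto
  qed
  have P0: "?P 0"
  proof -
    have 0: "(0::real) \<in> {0..1}" by simp
    obtain g where g: "homeomorphism unit_sphere ((\<lambda>x. \<Phi> (0, x)) ` unit_sphere) (\<lambda>x. \<Phi> (0, x)) g"
      by (rule sphere_embedding_homeomorphism[OF slice_embedding[OF 0]])
    have sub: "L 0 \<subseteq> unit_sphere" and im: "(\<lambda>x. \<Phi> (0, x)) ` L 0 = (\<lambda>x. \<Phi> (0, x)) ` unit_sphere \<inter> \<phi> ` unit_sphere"
      unfolding L_def M_def by auto
    have "homeomorphism (L 0) ((\<lambda>x. \<Phi> (0, x)) ` unit_sphere \<inter> \<phi> ` unit_sphere) (\<lambda>x. \<Phi> (0, x)) g"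
      by (rule homeomorphism_of_subsets[OF g sub subset_refl im])
    then have "L 0 homeomorphic (\<lambda>x. \<Phi> (0, x)) ` unit_sphere \<inter> \<phi> ` unit_sphere"
      unfolding homeomorphic_def by (intro exI)
    then have "L 0 homeomorphic sphere (0::complex) 1"
      using embedded_circle_homeomorphic[OF assms(6)] by (rule homeomorphic_trans)
    from circle_compact_connected[OF this] have "components (L 0) = {L 0}"
      by (simp add: components_eq_sing_iff)
    \<comment> \<open>Transversality puts both colours next to every point of the circle, so the
      single component at time 0 is changing and the count is 1.\<close>
    moreover have "L 0 \<subseteq> closure (A 0) \<inter> closure (B 0)"
      using L_in_both_closures[OF 0 _ assms(5)] by blast
    ultimately have "changing_circles 0 = {L 0}" unfolding changing_circles_def by auto
    then show ?thesis by simp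
  qed
  have "?P 1"
  proof (rule connected_induction_simple[of "{0..1}" 0 1 ?P])
    fix a :: real assume a: "a \<in> {0..1}"
    obtain S where S: "open S" "a \<in> S" "\<And>t. t \<in> S \<Longrightarrow> t \<in> {0..1} \<longrightarrow> (?P t \<longleftrightarrow> ?P a)"
      using loc[OF a] unfolding eventually_nhds by blast
    have "openin (top_of_set {0..1}) ({0..1} \<inter> S)" using S(1) by (rule openin_open_Int)
    moreover have "a \<in> {0..1} \<inter> S" using a S(2) by (rule IntI)
    moreover have "\<forall>x\<in>{0..1} \<inter> S. \<forall>y\<in>{0..1} \<inter> S. ?P x \<longrightarrow> ?P y" using S(3) by blast
    ultimately show "\<exists>T. openin (top_of_set {0..1}) T \<and> a \<in> T \<and> (\<forall>x\<in>T. \<forall>y\<in>T. ?P x \<longrightarrow> ?P y)"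
      by (intro exI conjI)
  qed (use P0 in \<open>simp_all add: connected_Icc\<close>)
  moreover have "changing_circles 1 = {}" unfolding changing_circles_def L1 by simp
  ultimately show False by simp
qed

end
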